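(* Let $\alpha,s$ be positive integers such that $\alpha\equiv s\pmod{q-1}$. Let $\delta$ be the smallest non-negative integer such that, simultaneously, $q^\delta-\alpha\geq0$ and $s+\ell_q(q^\delta-\alpha)\geq2$. Then the formal series $$V_{\alpha,s}(t_1,\ldots,t_s)=\widetilde{\pi}^{-\alpha}L(\chi_{t_1}\cdots\chi_{t_s},\alpha)\,\omega(t_1)\cdots\omega(t_s)\prod_{i=1}^s\prod_{j=0}^{\delta-1}\left(1-\frac{t_i}{\theta^{q^j}}\right)\in K_\infty[[t_1,\ldots,t_s]]$$ is in fact a symmetric polynomial of $K[t_1,\ldots,t_s]$, of total degree $\delta(\alpha,s)$ such that $$\delta(\alpha,s)\leq s\left(\frac{s+\ell_q(q^\delta-\alpha)}{q-1}\right)-s.$$ (Empty products are equal to one.)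
   Context: Let $q$ be a prime power, $A=\mathbb{F}_q[\theta]$, $K=\mathbb{F}_q(\theta)$, $K_\infty=\mathbb{F}_q((\theta^{-1}))$, $\mathbb{C}_\infty$ the completion of an algebraic closure of $K_\infty$. Fix a $(q-1)$-th root $(-\theta)^{1/(q-1)}\in\mathbb{C}_\infty$ of $-\theta$; set $\widetilde{\pi}=\theta(-\theta)^{1/(q-1)}\prod_{i\ge1}(1-\theta^{1-q^i})^{-1}$ and, with the same root, $\omega(t)=(-\theta)^{1/(q-1)}\prod_{i\ge 0}(1-t/\theta^{q^i})^{-1}$, viewed as a formal power series in $t$. $A^+(d)$ is the set of monic polynomials of degree $d$ in $A$. For variables $t_1,\ldots,t_s$, $\chi_{t_i}:A\to\mathbb{F}_q[t_1,\ldots,t_s]$ is the $\mathbb{F}_q$-algebra homomorphism with $\chi_{t_i}(\theta)=t_i$, and $$L(\chi_{t_1}\cdots\chi_{t_s},\alpha)=\sum_{d\ge0}\sum_{a\in A^+(d)}\chi_{t_1}(a)\cdots\chi_{t_s}(a)\,a^{-\alpha}\in K_\infty[[t_1,\ldots,t_s]].$$ For a non-negative integer $k=k_0+k_1q+\cdots+k_rq^r$ with $k_i\in\{0,\ldots,q-1\}$, $\ell_q(k)=k_0+\cdots+k_r$. *)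

theory Defs
  imports
    "HOL-Analysis.Analysis"
    "HOL-Library.Poly_Mapping"
    "HOL-Computational_Algebra.Computational_Algebra"
    "HOL-Combinatorics.Permutations"
    "HOL-Number_Theory.Cong"
begin

section \<open>Formal power series in several variables\<close>

text \<open>
  Formal power series over \<open>'a\<close> in variables \<open>t\<^sub>0, t\<^sub>1, t\<^sub>2, \<dots>\<close>, given by their coefficients;
  a monomial is a finitely supported exponent vector \<open>nat \<Rightarrow>\<^sub>0 nat\<close>.
  The ring \<open>R[[t\<^sub>1, \<dots>, t\<^sub>s]]\<close> is the subring of the series in which only the variables with
  index in \<open>{1..s}\<close> occur.
\<close>

typedef 'a mfps = "UNIV :: ((nat \<Rightarrow>\<^sub>0 nat) \<Rightarrow> 'a) set"
  morphisms mfps_coeff Abs_mfps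
  by simp

setup_lifting type_definition_mfps

lemma mfps_eqI: "(\<And>m. mfps_coeff F m = mfps_coeff G m) \<Longrightarrow> F = G"
  by (metis ext mfps_coeff_inject)

lemma mfps_coeff_Abs [simp]: "mfps_coeff (Abs_mfps f) = f"
  by (simp add: Abs_mfps_inverse)

definition splittings :: "(nat \<Rightarrow>\<^sub>0 nat) \<Rightarrow> ((nat \<Rightarrow>\<^sub>0 nat) \<times> (nat \<Rightarrow>\<^sub>0 nat)) set" where
  "splittings k = {(m, n). m + n = k}"

lemma finite_splittings [simp]: "finite (splittings k)"
proof -
  let ?B = "\<Union>x\<in>Poly_Mapping.keys k. {..Poly_Mapping.lookup k x}"
  let ?F = "{f :: nat \<Rightarrow> nat. \<forall>x. (x \<in> Poly_Mapping.keys k \<longrightarrow> f x \<in> ?B) \<and>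
    (x \<notin> Poly_Mapping.keys k \<longrightarrow> f x = 0)}"
  let ?M = "{m. Poly_Mapping.lookup m \<in> ?F}"
  have "finite ?F"
    by (rule finite_set_of_finite_funs) auto
  then have "finite ?M"
    by (rule finite_vimageI[where h = Poly_Mapping.lookup, unfolded vimage_def])
       (rule injI, simp only: poly_mapping_eq_iff)
  then have "finite (?M \<times> ?M)" by simp
  have M: "m \<in> ?M" if "m + n = k" for m n
  proof -
    have le: "Poly_Mapping.lookup m x \<le> Poly_Mapping.lookup k x" for x
      using that by (auto simp: lookup_add)
    have "Poly_Mapping.lookup m x = 0" if "x \<notin> Poly_Mapping.keys k" for x
      using le[of x] that by (simp add: in_keys_iff)
    moreover have "Poly_Mapping.lookup m x \<in> ?B" if "x \<in> Poly_Mapping.keys k" for x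
      using le[of x] that by (intro UN_I[of x]) auto
    ultimately show ?thesis by simp
  qed
  have "splittings k \<subseteq> ?M \<times> ?M"
  proof
    fix z assume "z \<in> splittings k"
    then obtain m n where z: "z = (m, n)" "m + n = k"
      by (auto simp: splittings_def)
    from z(2) have "n + m = k" by (simp add: add.commute)
    from M[OF z(2)] M[OF this] show "z \<in> ?M \<times> ?M"
      unfolding z(1) by (rule SigmaI)
  qed
  with \<open>finite (?M \<times> ?M)\<close> show ?thesis by (rule rev_finite_subset)
qed

instantiation mfps :: (zero) zero
begin
lift_definition zero_mfps :: "'a mfps" is "\<lambda>_. 0" .
instance ..
end

instantiation mfps :: ("{zero, one}") one
begin
lift_definition one_mfps :: "'a mfps" is "\<lambda>m. if m = 0 then 1 else 0" .
instance ..
end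

instantiation mfps :: (plus) plus
begin
lift_definition plus_mfps :: "'a mfps \<Rightarrow> 'a mfps \<Rightarrow> 'a mfps" is "\<lambda>f g m. f m + g m" .
instance ..
end

instantiation mfps :: (minus) minus
begin
lift_definition minus_mfps :: "'a mfps \<Rightarrow> 'a mfps \<Rightarrow> 'a mfps" is "\<lambda>f g m. f m - g m" .
instance ..
end

instantiation mfps :: (uminus) uminus
begin
lift_definition uminus_mfps :: "'a mfps \<Rightarrow> 'a mfps" is "\<lambda>f m. - f m" .
instance ..
end

instantiation mfps :: ("{comm_monoid_add, times}") times
begin
lift_definition times_mfps :: "'a mfps \<Rightarrow> 'a mfps \<Rightarrow> 'a mfps" is
  "\<lambda>f g k. \<Sum>(m, n)\<in>splittings k. f m * g n" .
instance ..
end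

lemma mfps_coeff_simps [simp]:
  "mfps_coeff 0 m = 0"
  "mfps_coeff 1 m = (if m = 0 then 1 else 0)"
  "mfps_coeff (F + G) m = mfps_coeff F m + mfps_coeff G m"
  "mfps_coeff (F' - G') m = mfps_coeff F' m - mfps_coeff G' m"
  "mfps_coeff (- F'') m = - mfps_coeff F'' m"
  by (transfer; simp)+

lemma mfps_coeff_mult:
  "mfps_coeff (F * G) k = (\<Sum>(m, n)\<in>splittings k. mfps_coeff F m * mfps_coeff G n)"
  by transfer simp

instance mfps :: (comm_ring_1) comm_ring_1
proof
  fix F G H :: "'a mfps"
  show "F * G * H = F * (G * H)"
  proof (rule mfps_eqI)
    fix k
    let ?f = "mfps_coeff F" and ?g = "mfps_coeff G" and ?h = "mfps_coeff H"
    have "mfps_coeff (F * G * H) k =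
        (\<Sum>z\<in>(SIGMA (m, n):splittings k. splittings m).
          case z of ((m, n), (p, q)) \<Rightarrow> ?f p * ?g q * ?h n)"
      by (subst sum.Sigma[symmetric])
         (auto simp: mfps_coeff_mult sum_distrib_right intro!: sum.cong)
    also have "\<dots> = (\<Sum>z\<in>(SIGMA (m, n):splittings k. splittings n).
          case z of ((m, n), (p, q)) \<Rightarrow> ?f m * (?g p * ?h q))"
      by (rule sum.reindex_bij_witness[where
            i = "\<lambda>((m, n), (p, q)). ((m + p, q), (m, p))" and
            j = "\<lambda>((m, n), (p, q)). ((p, q + n), (q, n))"])
         (auto simp: splittings_def mult.assoc add.assoc)
    also have "\<dots> = mfps_coeff (F * (G * H)) k"
      by (subst sum.Sigma[symmetric])
         (auto simp: mfps_coeff_mult sum_distrib_left intro!: sum.cong)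
    finally show "mfps_coeff (F * G * H) k = mfps_coeff (F * (G * H)) k" .
  qed
  show "F * G = G * F"
    by (rule mfps_eqI, unfold mfps_coeff_mult,
        rule sum.reindex_bij_witness[where i = prod.swap and j = prod.swap])
       (auto simp: splittings_def add.commute mult.commute)
  show "1 * F = F"
  proof (rule mfps_eqI)
    fix k
    have "mfps_coeff (1 * F) k =
        (\<Sum>z\<in>splittings k. if z = (0, k) then mfps_coeff F k else 0)"
      unfolding mfps_coeff_mult by (rule sum.cong) (auto simp: splittings_def split: if_splits)
    also have "\<dots> = mfps_coeff F k"
      by (subst sum.delta[OF finite_splittings]) (simp add: splittings_def)
    finally show "mfps_coeff (1 * F) k = mfps_coeff F k" .
  qed
  show "(F + G) * H = F * H + G * H"
    by (rule mfps_eqI)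
       (simp add: mfps_coeff_mult distrib_right sum.distrib case_prod_unfold)
  show "0 \<noteq> (1 :: 'a mfps)"
    by (metis mfps_coeff_simps(1,2) zero_neq_one)
qed (rule mfps_eqI, simp add: algebra_simps)+

definition mfps_const :: "'a::zero \<Rightarrow> 'a mfps" where
  "mfps_const c = Abs_mfps (\<lambda>m. if m = 0 then c else 0)"

definition mfps_var :: "nat \<Rightarrow> 'a::zero_neq_one mfps" where
  "mfps_var i = Abs_mfps (\<lambda>m. if m = Poly_Mapping.single i 1 then 1 else 0)"

definition map_mfps :: "('a \<Rightarrow> 'b) \<Rightarrow> 'a mfps \<Rightarrow> 'b mfps" where
  "map_mfps h F = Abs_mfps (\<lambda>m. h (mfps_coeff F m))"

text \<open>Substitution of the variable \<open>t\<^sub>i\<close> into a univariate series.\<close>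

definition mfps_of_fps :: "nat \<Rightarrow> 'a::zero fps \<Rightarrow> 'a mfps" where
  "mfps_of_fps i f = Abs_mfps (\<lambda>m.
     if Poly_Mapping.keys m \<subseteq> {i} then fps_nth f (Poly_Mapping.lookup m i) else 0)"

definition polys_over :: "'a::zero set \<Rightarrow> nat \<Rightarrow> 'a mfps set" where
  "polys_over R s = {F. finite {m. mfps_coeff F m \<noteq> 0} \<and>
     (\<forall>m. mfps_coeff F m \<in> R) \<and>
     (\<forall>m. mfps_coeff F m \<noteq> 0 \<longrightarrow> Poly_Mapping.keys m \<subseteq> {1..s})}"

definition symmetric_mfps :: "nat \<Rightarrow> 'a mfps \<Rightarrow> bool" where
  "symmetric_mfps s F \<longleftrightarrow> (\<forall>\<sigma>. \<sigma> permutes {1..s} \<longrightarrow>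
     (\<forall>m. mfps_coeff F (Poly_Mapping.map_key \<sigma> m) = mfps_coeff F m))"

definition monom_degree :: "(nat \<Rightarrow>\<^sub>0 nat) \<Rightarrow> nat" where
  "monom_degree m = (\<Sum>i\<in>Poly_Mapping.keys m. Poly_Mapping.lookup m i)"

text \<open>Only meaningful for series with finite support; the zero polynomial gets degree \<open>0\<close>.\<close>

definition total_degree :: "'a::zero mfps \<Rightarrow> nat" where
  "total_degree F = Max (insert 0 (monom_degree ` {m. mfps_coeff F m \<noteq> 0}))"


section \<open>The rings \<open>A \<subseteq> K \<subseteq> K\<^sub>\<infinity> \<subseteq> \<complex>\<^sub>\<infinity>\<close>\<close>

text \<open>
  \<open>\<F>\<^sub>q\<close> is a type \<open>'f\<close> of sort \<open>{field, finite}\<close>, \<open>q = CARD('f)\<close>, and \<open>A = \<F>\<^sub>q[\<theta>]\<close> is \<open>'f poly\<close>.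
  \<open>K\<^sub>\<infinity> = \<F>\<^sub>q((\<theta>\<inverse>))\<close> is \<open>'f fls\<close>, whose formal variable \<open>fls_X\<close> plays the role of \<open>\<theta>\<inverse>\<close>.
  Its library metric is induced by the absolute value \<open>|x| = 2 powr - v(x)\<close>, where \<open>v\<close> is the valuation
  with \<open>v(\<theta>\<inverse>) = 1\<close>.
\<close>

definition A_to_Kinf :: "'f::field poly \<Rightarrow> 'f fls" where
  "A_to_Kinf a = poly (map_poly fls_const a) fls_X_inv"

definition K_in_Kinf :: "'f::field fls set" where
  "K_in_Kinf = {A_to_Kinf a / A_to_Kinf b | a b. b \<noteq> 0}"

text \<open>
  \<open>C_infinity \<iota>\<close>: the field \<open>'c\<close>, with absolute value \<open>|x| = dist x 0\<close>, is via \<open>\<iota>\<close> the completion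
  of an algebraic closure of \<open>K\<^sub>\<infinity>\<close>.  The elements of \<open>'c\<close> algebraic over \<open>K\<^sub>\<infinity>\<close> form
  an algebraically closed field, they are dense, and \<open>'c\<close> is complete (by its sort).
  This determines \<open>'c\<close> up to isometric isomorphism over \<open>K\<^sub>\<infinity>\<close>.
\<close>

definition algebraic_elements :: "('k::field \<Rightarrow> 'c::field) \<Rightarrow> 'c set" where
  "algebraic_elements \<iota> = {x. \<exists>p. p \<noteq> 0 \<and> poly (map_poly \<iota> p) x = 0}"

locale C_infinity =
  fixes \<iota> :: "'f::{field, finite} fls \<Rightarrow> 'c::{field, complete_space}"
  assumes hom_one: "\<iota> 1 = 1"
    and hom_add: "\<iota> (a + b) = \<iota> a + \<iota> b"
    and hom_mult: "\<iota> (a * b) = \<iota> a * \<iota> b"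
    and isometry: "dist (\<iota> a) (\<iota> b) = dist a b"
    and dist_diff: "dist x y = dist (x - y) (0 :: 'c)"
    and abs_mult: "dist (x * y) (0 :: 'c) = dist x 0 * dist y 0"
    and abs_ultrametric: "dist (x + y) (0 :: 'c) \<le> max (dist x 0) (dist y 0)"
    and alg_closed: "degree p > 0 \<Longrightarrow> set (coeffs p) \<subseteq> algebraic_elements \<iota> \<Longrightarrow>
          \<exists>x\<in>algebraic_elements \<iota>. poly p x = 0"
    and dense: "closure (algebraic_elements \<iota>) = UNIV"


section \<open>The \<open>L\<close>-series, \<open>\<omega>\<close> and the period\<close>

definition theta :: "('f::field fls \<Rightarrow> 'c) \<Rightarrow> 'c" where
  "theta \<iota> = \<iota> fls_X_inv"

text \<open>In the next two definitions \<open>r\<close> is the chosen \<open>(q-1)\<close>-th root of \<open>-\<theta>\<close>.\<close>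

definition pi_tilde ::
    "('f::{field, finite} fls \<Rightarrow> 'c::{field, metric_space}) \<Rightarrow> 'c \<Rightarrow> 'c" where
  "pi_tilde \<iota> r = theta \<iota> * r *
     prodinf (\<lambda>i. inverse (1 - theta \<iota> powi (1 - int (CARD('f) ^ Suc i))))"

text \<open>
  The infinite product converges coefficientwise for the topology of \<open>\<complex>\<^sub>\<infinity>\<close>; it diverges for
  the library topology on \<open>'c fps\<close>, which ignores the topology of the coefficients.
\<close>

definition omega ::
    "('f::{field, finite} fls \<Rightarrow> 'c::{field, metric_space}) \<Rightarrow> 'c \<Rightarrow> 'c fps" where
  "omega \<iota> r = Abs_fps (\<lambda>n. lim (\<lambda>N. fps_nth
     (fps_const r * (\<Prod>i<N. inverse (1 - fps_const (inverse (theta \<iota> ^ (CARD('f) ^ i))) * fps_X))) n))"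

definition monic_polys :: "nat \<Rightarrow> 'f::field poly set" where
  "monic_polys d = {a. lead_coeff a = 1 \<and> degree a = d}"

definition chi :: "nat \<Rightarrow> 'f::field poly \<Rightarrow> 'f mfps" where
  "chi i a = poly (map_poly mfps_const a) (mfps_var i)"

text \<open>As for \<open>omega\<close>, the sum over \<open>d\<close> is taken coefficientwise in \<open>K\<^sub>\<infinity>\<close>.\<close>

definition L_series :: "nat \<Rightarrow> nat \<Rightarrow> 'f::{field, finite} fls mfps" where
  "L_series s \<alpha> = Abs_mfps (\<lambda>m. suminf (\<lambda>d. mfps_coeff
     (\<Sum>a\<in>monic_polys d. map_mfps fls_const (\<Prod>i=1..s. chi i a) *
        mfps_const (inverse (A_to_Kinf a ^ \<alpha>))) m))"

text \<open>For \<open>q \<ge> 2\<close> the digits of \<open>k\<close> in positions beyond \<open>k\<close> vanish, since \<open>k < q ^ k\<close>.\<close>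

definition digit_sum :: "nat \<Rightarrow> nat \<Rightarrow> nat" where
  "digit_sum q k = (\<Sum>i\<le>k. k div q ^ i mod q)"

definition delta :: "nat \<Rightarrow> nat \<Rightarrow> nat \<Rightarrow> nat" where
  "delta q \<alpha> s = (LEAST d. \<alpha> \<le> q ^ d \<and> 2 \<le> s + digit_sum q (q ^ d - \<alpha>))"

definition V_series ::
    "('f::{field, finite} fls \<Rightarrow> 'c::{field, metric_space}) \<Rightarrow> 'c \<Rightarrow> nat \<Rightarrow> nat \<Rightarrow> 'c mfps" where
  "V_series \<iota> r \<alpha> s =
     mfps_const (inverse (pi_tilde \<iota> r ^ \<alpha>)) * map_mfps \<iota> (L_series s \<alpha>) *
     (\<Prod>i=1..s. mfps_of_fps i (omega \<iota> r)) *
     (\<Prod>i=1..s. \<Prod>j<delta CARD('f) \<alpha> s.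
        1 - mfps_const (inverse (theta \<iota> ^ (CARD('f) ^ j))) * mfps_var i)"

end

theory Submission
  imports Defs
begin

text \<open>
  Write \<open>\<Omega>(t) = \<omega>(t) \<Prod>\<^sub>j (1 - t/\<theta>\<^bsup>q^j\<^esup>)\<close>, the product over \<open>j < \<delta>\<close>: up to the factor \<open>r\<close> it is the inverse of
  the entire function \<open>\<Prod>\<^sub>j (1 - t/\<theta>\<^bsup>q^j\<^esup>)\<close>, \<open>j \<ge> \<delta>\<close>.  The coefficient of \<open>V\<close> at the monomial
  \<open>t\<^bsup>x\<^esup>\<close> is then the limit of
    \<open>\<pi>\<^bsup>-\<alpha>\<^esup> \<Sum>\<^sub>a a\<^bsup>-\<alpha>\<^esup> \<Prod>\<^sub>i [t\<^bsup>x(i)\<^esup>] (a(t) \<Omega>(t))\<close>,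
  the sum being over the monic \<open>a\<close> of degree \<open>< D\<close> (\<open>V_coeff_tendsto\<close>).  Every factor is an
  \<open>\<F>\<^sub>q\<close>-linear form in \<open>a\<close>.  This expression is symmetric, and it reduces all questions
  to a single variable: one factor is looked at as a coefficient of a series in \<open>t\<close>, the other ones
  are kept as unspecified bounded linear forms.

  Polynomiality and degree.  Everything rests on one fact: a product of fewer than \<open>D(q-1)\<close> affine
  forms sums to zero over the \<open>D\<close>-dimensional \<open>\<F>\<^sub>q\<close>-space of polynomials of degree \<open>< D\<close>
  (\<open>sum_prod_affine_eq_0\<close>).  At \<open>t = \<theta>\<^bsup>q^k\<^esup>\<close> with \<open>k \<ge> \<delta>\<close> the sum becomes a
  sum of \<open>a\<^bsup>q^k-\<alpha>\<^esup>\<close> times linear forms, which is a product of a fixed number of linear forms and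
  hence vanishes for large \<open>D\<close> (\<open>partial_L_zero\<close>).  Approximating \<open>a\<^bsup>-\<alpha>\<^esup>\<close> by
  \<open>a\<^bsup>q^M-\<alpha>\<^esup>\<close> up to a power of \<open>\<theta>\<close>, it also shows that the coefficients in \<open>t\<close> decay like
  \<open>|\<theta>|\<close> to the power \<open>-q\<^bsup>\<delta>+n-m\<^esup>\<close> (\<open>nrm_coeff_partial_L_decay\<close>).  Dividing successively by the
  linear factors belonging to these zeros moves the decay one step at a time, and in the limit all
  coefficients from a certain degree on are forced to be zero (\<open>partial_L_times_Om_tendsto_0\<close>).

  Rationality.  The coefficients of \<open>\<omega>\<close> are torsion points \<open>\<pi> e(\<theta>\<^bsup>-n-1\<^esup>)\<close> of the Carlitz
  module, where \<open>e\<close> is the exponential function of the lattice \<open>A\<close> (\<open>omega_coeff\<close>).  Hence for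
  large \<open>N\<close> the factors \<open>[t\<^bsup>n\<^esup>] (a(t) \<Omega>(t))\<close> are polynomials over \<open>K\<close> in the torsion point
  \<open>\<pi> e(a/\<theta>\<^bsup>N\<^esup>)\<close>, which depends on \<open>a\<close> modulo \<open>\<theta>\<^bsup>N\<^esup>\<close> only (\<open>wform_poly\<close>).  The sum of
  \<open>\<pi>\<^bsup>-\<alpha>\<^esup> a\<^bsup>-\<alpha>\<^esup>\<close> over a non-zero residue class is a polynomial over \<open>K\<close> in the inverse of that torsion
  point (\<open>goss_polynomial\<close>).  So the coefficient is a combination over \<open>K\<close> of power sums, with
  positive and negative exponents, of the non-zero roots of a polynomial over \<open>K\<close>, and these lie
  in \<open>K\<close> (\<open>power_sum_Kc\<close>).
\<close>

section \<open>Finite fields\<close>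

lemma card_field_ge_2: "2 \<le> CARD('f::{field, finite})"
proof -
  have "card {0, 1 :: 'f} \<le> CARD('f)"
    by (rule card_mono) auto
  then show ?thesis by simp
qed

lemma finite_field_power_card:
  fixes c :: "'f::{field, finite}"
  shows "c ^ CARD('f) = c"
proof (cases "c = 0")
  case False
  have "(\<Prod>y\<in>UNIV-{0}. c * y) = \<Prod>(UNIV-{0})"
    by (rule prod.reindex_bij_witness[of _ "\<lambda>y. y / c" "\<lambda>y. c * y"]) (use False in auto)
  then have "c ^ (CARD('f) - 1) * \<Prod>(UNIV-{0::'f}) = 1 * \<Prod>(UNIV-{0::'f})"
    by (simp add: prod.distrib)
  then have "c ^ (CARD('f) - 1) = 1"
    by (subst (asm) mult_cancel_right) auto
  then have "c * c ^ (CARD('f) - 1) = c" by simp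
  then show ?thesis by (simp flip: power_Suc)
qed auto

lemma finite_field_power_card_minus_1:
  fixes c :: "'f::{field, finite}"
  assumes "c \<noteq> 0"
  shows "c ^ (CARD('f) - 1) = 1"
proof -
  have "c * c ^ (CARD('f) - 1) = c * 1"
    using finite_field_power_card[of c] by (simp flip: power_Suc)
  then show ?thesis using assms by simp
qed

lemma of_nat_card_field: "of_nat CARD('f) = (0 :: 'f::{field, finite})"
proof -
  have "(\<Sum>y\<in>UNIV. y + 1) = (\<Sum>y\<in>UNIV. y :: 'f)"
    by (rule sum.reindex_bij_witness[of _ "\<lambda>y. y - 1" "\<lambda>y. y + 1"]) auto
  then show ?thesis by (simp add: sum.distrib)
qed

lemma minus_one_power_card_minus_1: "(-1 :: 'f::{field, finite}) ^ (CARD('f) - 1) = 1"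
  by (rule finite_field_power_card_minus_1) simp

lemma sum_power_finite_field:
  fixes j :: nat
  assumes "j < CARD('f) - 1"
  shows "(\<Sum>c\<in>UNIV. c ^ j) = (0 :: 'f::{field, finite})"
proof (cases "j = 0")
  case True
  then show ?thesis by (simp add: of_nat_card_field)
next
  case False
  define p :: "'f poly" where "p = monom 1 j - 1"
  have deg: "degree p \<le> j"
    unfolding p_def by (rule degree_diff_le) (auto simp: degree_monom_le)
  have "coeff p j = 1" using False by (simp add: p_def)
  then have p: "p \<noteq> 0" by auto
  have "\<exists>g. g \<noteq> 0 \<and> poly p g \<noteq> 0"
  proof (rule ccontr)
    assume "\<not> ?thesis"
    then have "UNIV - {0} \<subseteq> {x. poly p x = 0}" by auto
    then have "card (UNIV - {0::'f}) \<le> card {x. poly p x = 0}"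
      by (intro card_mono poly_roots_finite p) auto
    also have "\<dots> \<le> degree p" by (rule card_poly_roots_bound[OF p])
    finally show False using deg assms by simp
  qed
  then obtain g where "g \<noteq> 0" "poly p g \<noteq> 0" by blast
  then have g: "g \<noteq> 0" "g ^ j \<noteq> 1"
    by (simp_all add: p_def poly_monom)
  have "(\<Sum>c\<in>UNIV. (g * c) ^ j) = (\<Sum>c\<in>UNIV. c ^ j)"
    by (rule sum.reindex_bij_witness[of _ "\<lambda>y. y / g" "\<lambda>y. g * y"]) (use g in auto)
  then have "g ^ j * (\<Sum>c\<in>UNIV. c ^ j) = 1 * (\<Sum>c\<in>UNIV. c ^ j)"
    unfolding power_mult_distrib sum_distrib_left by simp
  then have "(g ^ j - 1) * (\<Sum>c\<in>UNIV. c ^ j) = 0"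
    unfolding left_diff_distrib by simp
  then show ?thesis using g by simp
qed

text \<open>
  The polynomial \<open>(X + 1)\<^bsup>q\<^esup> - X\<^bsup>q\<^esup> - 1\<close> has degree less than \<open>q\<close> and vanishes on all of \<open>\<F>\<^sub>q\<close>.
  This yields the additivity of \<open>x \<mapsto> x\<^bsup>q\<^esup>\<close> without writing \<open>q\<close> as a power of the characteristic.
\<close>

lemma of_nat_card_choose:
  assumes "0 < k" "k < CARD('f)"
  shows "of_nat (CARD('f) choose k) = (0 :: 'f::{field, finite})"
proof -
  let ?q = "CARD('f)"
  define p :: "'f poly" where "p = (\<Sum>k\<in>{0<..<?q}. monom (of_nat (?q choose k)) k)"
  have split: "{..?q} = insert 0 (insert ?q {0<..<?q})" using assms by auto
  have ev: "poly p c = 0" for c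
  proof -
    have "c + 1 = (c + 1) ^ ?q" by (simp add: finite_field_power_card)
    also have "\<dots> = (\<Sum>k\<le>?q. of_nat (?q choose k) * c ^ k)"
      by (simp add: binomial_ring)
    also have "\<dots> = 1 + c ^ ?q + poly p c"
      unfolding split using assms by (subst sum.insert; simp add: p_def poly_sum poly_monom)
    finally show ?thesis by (simp add: finite_field_power_card)
  qed
  have "p = 0"
  proof (rule ccontr)
    assume p: "p \<noteq> 0"
    have "?q = card {x. poly p x = 0}" by (simp add: ev)
    also have "\<dots> \<le> degree p" by (rule card_poly_roots_bound[OF p])
    also have "\<dots> \<le> ?q - 1"
      unfolding p_def by (rule degree_sum_le) (auto intro: order.trans[OF degree_monom_le])
    finally show False using assms by simp
  qed
  moreover have "coeff p k = of_nat (?q choose k)"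
    using assms by (simp add: p_def coeff_sum)
  ultimately show ?thesis by simp
qed

section \<open>Ultrametric analysis\<close>

definition nrm :: "'c::{zero, metric_space} \<Rightarrow> real" where
  "nrm x = dist x 0"

context C_infinity
begin

lemma hom_zero [simp]: "\<iota> 0 = 0"
  using hom_add[of 0 0] by (metis add_cancel_right_right)

lemma hom_sum: "\<iota> (sum f S) = (\<Sum>x\<in>S. \<iota> (f x))"
  by (induction S rule: infinite_finite_induct) (auto simp: hom_add)

lemma hom_power: "\<iota> (a ^ n) = \<iota> a ^ n"
  by (induction n) (auto simp: hom_mult hom_one)

lemma hom_eq_0_iff [simp]: "\<iota> a = 0 \<longleftrightarrow> a = 0"
  using isometry[of a 0] by (metis dist_eq_0_iff hom_zero)

lemma hom_inverse: "\<iota> (inverse a) = inverse (\<iota> a)"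
proof (cases "a = 0")
  case False
  then have "\<iota> (inverse a) * \<iota> a = 1" by (simp flip: hom_mult add: hom_one)
  then show ?thesis by (metis inverse_unique mult.commute)
qed simp

lemma hom_divide: "\<iota> (a / b) = \<iota> a / \<iota> b"
  by (simp add: divide_inverse hom_mult hom_inverse)

lemma nrm_0 [simp]: "nrm (0 :: 'c) = 0"
  by (simp add: nrm_def)

lemma nrm_eq_0_iff [simp]: "nrm (x :: 'c) = 0 \<longleftrightarrow> x = 0"
  by (simp add: nrm_def)

lemma nrm_ge_0 [simp]: "0 \<le> nrm (x :: 'c)"
  by (simp add: nrm_def)

lemma nrm_pos_iff [simp]: "0 < nrm (x :: 'c) \<longleftrightarrow> x \<noteq> 0"
  using nrm_ge_0[of x] nrm_eq_0_iff[of x] by linarith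

lemma nrm_mult: "nrm (x * y :: 'c) = nrm x * nrm y"
  by (simp add: nrm_def abs_mult)

lemma nrm_1 [simp]: "nrm (1 :: 'c) = 1"
  using nrm_mult[of 1 1] by simp

lemma nrm_power: "nrm (x ^ n :: 'c) = nrm x ^ n"
  by (induction n) (auto simp: nrm_mult)

lemma nrm_minus [simp]: "nrm (- x :: 'c) = nrm x"
proof -
  have "nrm (-1 :: 'c) ^ 2 = 1" by (simp flip: nrm_power)
  then have "nrm (-1 :: 'c) = 1" by (simp add: power2_eq_1_iff) (smt (verit) nrm_ge_0)
  then show ?thesis using nrm_mult[of "-1" x] by simp
qed

lemma nrm_inverse: "nrm (inverse x :: 'c) = inverse (nrm x)"
proof (cases "x = 0")
  case False
  then have "nrm (inverse x) * nrm x = 1" by (simp flip: nrm_mult)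
  then show ?thesis by (metis inverse_unique mult.commute)
qed simp

lemma nrm_divide: "nrm (x / y :: 'c) = nrm x / nrm y"
  by (simp add: divide_inverse nrm_mult nrm_inverse)

lemma nrm_prod: "nrm (prod f S :: 'c) = (\<Prod>x\<in>S. nrm (f x))"
  by (induction S rule: infinite_finite_induct) (auto simp: nrm_mult)

lemma nrm_add_le: "nrm x \<le> B \<Longrightarrow> nrm y \<le> B \<Longrightarrow> nrm (x + y :: 'c) \<le> B"
  using abs_ultrametric[of x y] by (simp add: nrm_def)

lemma nrm_diff_le: "nrm x \<le> B \<Longrightarrow> nrm y \<le> B \<Longrightarrow> nrm (x - y :: 'c) \<le> B"
  using nrm_add_le[of x B "- y"] by simp

lemma nrm_sum_le: "0 \<le> B \<Longrightarrow> (\<And>x. x \<in> S \<Longrightarrow> nrm (f x) \<le> B) \<Longrightarrow> nrm (sum f S :: 'c) \<le> B"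
  by (induction S rule: infinite_finite_induct) (auto intro: nrm_add_le)

lemma nrm_add_eq:
  assumes "nrm y < nrm x"
  shows "nrm (x + y :: 'c) = nrm x"
proof (rule antisym)
  show "nrm (x + y) \<le> nrm x" using assms by (intro nrm_add_le) auto
  show "nrm x \<le> nrm (x + y)"
  proof (rule ccontr)
    assume "\<not> ?thesis"
    then have "max (nrm (x + y)) (nrm y) < nrm x" using assms by simp
    moreover have "nrm ((x + y) - y) \<le> max (nrm (x + y)) (nrm y)"
      by (rule nrm_diff_le) auto
    ultimately show False by (simp add: max_def split: if_splits)
  qed
qed

lemma dist_conv_nrm: "dist x y = nrm (x - y :: 'c)"
  using dist_diff[of x y] by (simp add: nrm_def)

lemma tendsto_iff_nrm: "(X \<longlonglongrightarrow> L) \<longleftrightarrow> (\<lambda>n. nrm (X n - L :: 'c)) \<longlonglongrightarrow> 0"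
  by (subst tendsto_dist_iff) (simp add: dist_conv_nrm)

lemma tendsto_nrm: "X \<longlonglongrightarrow> L \<Longrightarrow> (\<lambda>n. nrm (X n :: 'c)) \<longlonglongrightarrow> nrm L"
  unfolding nrm_def by (intro tendsto_intros)

lemma tendsto_nrm_0_iff: "(X \<longlonglongrightarrow> (0 :: 'c)) \<longleftrightarrow> (\<lambda>n. nrm (X n)) \<longlonglongrightarrow> 0"
  using tendsto_iff_nrm[of X 0] by simp

lemma tendsto_0_nrm_le:
  assumes "\<And>n. nrm (X n :: 'c) \<le> B n" "B \<longlonglongrightarrow> 0"
  shows "X \<longlonglongrightarrow> 0"
  unfolding tendsto_nrm_0_iff
  by (rule tendsto_sandwich[OF _ _ tendsto_const assms(2)]) (auto intro: always_eventually assms(1))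

lemma tendsto_c_add:
  assumes "X \<longlonglongrightarrow> (a :: 'c)" "Y \<longlonglongrightarrow> b"
  shows "(\<lambda>n. X n + Y n) \<longlonglongrightarrow> a + b"
proof -
  have B: "(\<lambda>n. nrm (X n - a) + nrm (Y n - b)) \<longlonglongrightarrow> 0"
    using tendsto_add[OF assms[unfolded tendsto_iff_nrm]] by simp
  have "nrm (X n + Y n - (a + b)) \<le> nrm (X n - a) + nrm (Y n - b)" for n
    using nrm_add_le[of "X n - a" "nrm (X n - a) + nrm (Y n - b)" "Y n - b"]
    by (simp add: algebra_simps)
  from tendsto_0_nrm_le[OF this B] show ?thesis
    by (simp add: tendsto_nrm_0_iff tendsto_iff_nrm[of _ "a + b"])
qed

lemma tendsto_c_mult:
  assumes "X \<longlonglongrightarrow> (a :: 'c)" "Y \<longlonglongrightarrow> b"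
  shows "(\<lambda>n. X n * Y n) \<longlonglongrightarrow> a * b"
proof -
  have 1: "(\<lambda>n. nrm ((X n - a) * Y n)) \<longlonglongrightarrow> 0 * nrm b"
    using assms(1) tendsto_nrm[OF assms(2)] unfolding tendsto_iff_nrm nrm_mult
    by (intro tendsto_mult)
  have 2: "(\<lambda>n. nrm (a * (Y n - b))) \<longlonglongrightarrow> nrm a * 0"
    using assms(2) unfolding tendsto_iff_nrm nrm_mult by (intro tendsto_mult tendsto_const)
  have "(\<lambda>n. (X n - a) * Y n + a * (Y n - b)) \<longlonglongrightarrow> 0 + 0"
    using 1 2 by (intro tendsto_c_add) (simp_all add: tendsto_nrm_0_iff)
  then show ?thesis
    by (simp add: tendsto_iff_nrm algebra_simps)
qed

lemma tendsto_c_minus: "X \<longlonglongrightarrow> (a :: 'c) \<Longrightarrow> (\<lambda>n. - X n) \<longlonglongrightarrow> - a"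
  using tendsto_c_mult[OF tendsto_const[of "-1"], of X a] by simp

lemma tendsto_c_diff:
  "X \<longlonglongrightarrow> (a :: 'c) \<Longrightarrow> Y \<longlonglongrightarrow> b \<Longrightarrow> (\<lambda>n. X n - Y n) \<longlonglongrightarrow> a - b"
  using tendsto_c_add[OF _ tendsto_c_minus, of X a Y b] by simp

lemma tendsto_c_power: "X \<longlonglongrightarrow> (a :: 'c) \<Longrightarrow> (\<lambda>n. X n ^ k) \<longlonglongrightarrow> a ^ k"
  by (induction k) (auto intro: tendsto_c_mult)

lemma tendsto_c_sum:
  "(\<And>i. i \<in> S \<Longrightarrow> X i \<longlonglongrightarrow> (a i :: 'c)) \<Longrightarrow> (\<lambda>n. \<Sum>i\<in>S. X i n) \<longlonglongrightarrow> (\<Sum>i\<in>S. a i)"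
  by (induction S rule: infinite_finite_induct) (auto intro: tendsto_c_add)

lemma tendsto_c_inverse:
  assumes "X \<longlonglongrightarrow> (a :: 'c)" "a \<noteq> 0"
  shows "(\<lambda>n. inverse (X n)) \<longlonglongrightarrow> inverse a"
proof -
  have "(\<lambda>n. nrm (X n - a) * (inverse (nrm (X n)) * inverse (nrm a))) \<longlonglongrightarrow>
      0 * (inverse (nrm a) * inverse (nrm a))"
    using assms tendsto_nrm[OF assms(1)] unfolding tendsto_iff_nrm
    by (intro tendsto_mult tendsto_inverse tendsto_const) auto
  moreover have "\<forall>\<^sub>F n in sequentially. nrm (X n) > 0"
    by (rule order_tendstoD[OF tendsto_nrm[OF assms(1)]]) (use assms in simp)
  then have "\<forall>\<^sub>F n in sequentially.
      nrm (X n - a) * (inverse (nrm (X n)) * inverse (nrm a)) = nrm (inverse (X n) - inverse a)"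
  proof eventually_elim
    case (elim n)
    then have "inverse (X n) - inverse a = - ((X n - a) * (inverse (X n) * inverse a))"
      using assms(2) by (simp add: field_simps)
    then show ?case by (simp only: nrm_minus nrm_mult nrm_inverse)
  qed
  ultimately show ?thesis
    unfolding tendsto_iff_nrm by (simp add: filterlim_cong)
qed

lemma nrm_diff_le_of_steps:
  assumes "\<And>n. N \<le> n \<Longrightarrow> nrm (X (Suc n) - X n :: 'c) \<le> B" "0 \<le> B" "N \<le> n"
  shows "nrm (X n - X N) \<le> B"
  using assms(3)
proof (induction n rule: dec_induct)
  case (step n)
  have "nrm ((X (Suc n) - X n) + (X n - X N)) \<le> B"
    by (rule nrm_add_le) (use step assms(1) in auto)
  then show ?case by simp
qed (use assms(2) in simp)

text \<open>
  In an ultrametric space a sequence is Cauchy as soon as its consecutive differences tend to zero.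
\<close>

lemma convergent_of_steps:
  assumes "(\<lambda>n. X (Suc n) - X n) \<longlonglongrightarrow> (0 :: 'c)"
  obtains L where "X \<longlonglongrightarrow> L"
proof -
  have "Cauchy X"
  proof (rule metric_CauchyI)
    fix e :: real assume e: "e > 0"
    have "\<forall>\<^sub>F n in sequentially. nrm (X (Suc n) - X n) < e / 2"
      using assms e unfolding tendsto_nrm_0_iff by (intro order_tendstoD) auto
    then obtain N where N: "\<And>n. N \<le> n \<Longrightarrow> nrm (X (Suc n) - X n) \<le> e / 2"
      by (auto simp: eventually_sequentially intro: less_imp_le)
    show "\<exists>M. \<forall>m\<ge>M. \<forall>n\<ge>M. dist (X m) (X n) < e"
    proof (intro exI allI impI)
      fix m n assume mn: "m \<ge> N" "n \<ge> N"
      have "nrm ((X m - X N) - (X n - X N)) \<le> e / 2"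
        by (rule nrm_diff_le; rule nrm_diff_le_of_steps) (use mn e N in auto)
      then show "dist (X m) (X n) < e" using e by (simp add: dist_conv_nrm)
    qed
  qed
  then show ?thesis
    using that Cauchy_convergent_iff convergent_def by blast
qed

lemma nrm_limit_le:
  assumes "X \<longlonglongrightarrow> (L :: 'c)" "\<And>n. N \<le> n \<Longrightarrow> nrm (X n) \<le> B"
  shows "nrm L \<le> B"
  by (rule LIMSEQ_le_const2[OF tendsto_nrm[OF assms(1)]]) (use assms(2) in auto)

end

section \<open>The embedding of \<open>A\<close>\<close>

text \<open>
  As a variable the cardinality \<open>q\<close> of \<open>\<F>\<^sub>q\<close> carries no hidden type argument.
\<close>

locale C_infinity_card = C_infinity \<iota>
  for \<iota> :: "'f::{field, finite} fls \<Rightarrow> 'c::{field, complete_space}" +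
  fixes q :: nat
  assumes q_def: "q = CARD('f)"
begin

definition cst :: "'f \<Rightarrow> 'c" where "cst c = \<iota> (fls_const c)"

definition emb :: "'f poly \<Rightarrow> 'c" where "emb a = \<iota> (A_to_Kinf a)"

abbreviation \<theta> :: 'c where "\<theta> \<equiv> theta \<iota>"

lemma q_ge_2: "2 \<le> q"
  unfolding q_def by (rule card_field_ge_2)

lemma q_pos [simp]: "0 < q"
  using q_ge_2 by linarith

lemma q_ge_1 [simp]: "Suc 0 \<le> q"
  using q_ge_2 by simp

lemma cst_0 [simp]: "cst 0 = 0" and cst_1 [simp]: "cst 1 = 1"
  by (simp_all add: cst_def hom_one)

lemma cst_add: "cst (a + b) = cst a + cst b"
  by (simp add: cst_def hom_add flip: fls_plus_const)

lemma cst_mult: "cst (a * b) = cst a * cst b"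
  by (simp add: cst_def flip: hom_mult)

lemma cst_power: "cst (a ^ n) = cst a ^ n"
  by (simp add: cst_def hom_power fls_const_power)

lemma cst_sum: "cst (sum f S) = (\<Sum>x\<in>S. cst (f x))"
  by (induction S rule: infinite_finite_induct) (auto simp: cst_add)

lemma cst_eq_0_iff [simp]: "cst a = 0 \<longleftrightarrow> a = 0"
  by (simp add: cst_def)

lemma cst_power_card: "cst a ^ q = cst a"
  by (simp add: finite_field_power_card q_def flip: cst_power)

lemma cst_of_nat: "cst (of_nat n) = of_nat n"
  by (induction n) (auto simp: cst_add)

lemma nrm_hom: "nrm (\<iota> x) = dist x 0"
  using isometry[of x 0] by (simp add: nrm_def)

lemma nrm_cst: "nrm (cst c) \<le> 1"
  by (simp add: cst_def nrm_hom dist_fls_def)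

lemma nrm_theta [simp]: "nrm \<theta> = 2"
  by (simp add: theta_def nrm_hom dist_fls_def)

lemma theta_nz [simp]: "\<theta> \<noteq> 0"
  using nrm_theta nrm_0 by force

lemma frobenius_add: "(x + y :: 'c) ^ q = x ^ q + y ^ q"
proof -
  have *: "of_nat (q choose k) = (0 :: 'c)" if "k \<in> {0<..<q}" for k
    using of_nat_card_choose[of k, where ?'f = 'f] that by (simp add: q_def flip: cst_of_nat)
  have "{..q} = insert 0 (insert q {0<..<q})" using q_ge_2 by auto
  then have "(x + y) ^ q = y ^ q + (x ^ q + (\<Sum>k\<in>{0<..<q}. of_nat (q choose k) * x ^ k * y ^ (q - k)))"
    unfolding binomial_ring using q_ge_2 by simp
  also have "(\<Sum>k\<in>{0<..<q}. of_nat (q choose k) * x ^ k * y ^ (q - k)) = 0"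
    by (rule sum.neutral) (auto simp: *)
  finally show ?thesis by simp
qed

lemma frobenius_power_add: "(x + y :: 'c) ^ (q ^ n) = x ^ (q ^ n) + y ^ (q ^ n)"
  by (induction n arbitrary: x y) (simp_all add: frobenius_add power_mult)

lemma frobenius_power_minus: "(- x :: 'c) ^ (q ^ n) = - (x ^ (q ^ n))"
  using frobenius_power_add[of x "- x" n] by (simp add: eq_neg_iff_add_eq_0 add.commute zero_power)

lemma frobenius_power_diff: "(x - y :: 'c) ^ (q ^ n) = x ^ (q ^ n) - y ^ (q ^ n)"
  using frobenius_power_add[of x "- y" n] by (simp add: frobenius_power_minus)

lemma frobenius_diff: "(x - y :: 'c) ^ q = x ^ q - y ^ q"
  using frobenius_power_diff[of x y 1] by simp

lemma frobenius_power_sum: "(sum f S :: 'c) ^ (q ^ n) = (\<Sum>x\<in>S. f x ^ (q ^ n))"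
  by (induction S rule: infinite_finite_induct) (auto simp: frobenius_power_add)

lemma frobenius_sum: "(sum f S :: 'c) ^ q = (\<Sum>x\<in>S. f x ^ q)"
  using frobenius_power_sum[of f S 1] by simp

lemma cst_power_card_power: "cst a ^ (q ^ n) = cst a"
  by (induction n) (simp_all add: power_mult cst_power_card)

lemma A_to_Kinf_pCons: "A_to_Kinf (pCons c a) = fls_const c + fls_X_inv * A_to_Kinf (a :: 'f poly)"
  by (simp add: A_to_Kinf_def map_poly_pCons)

lemma emb_pCons: "emb (pCons c a) = cst c + \<theta> * emb a"
  by (simp add: emb_def A_to_Kinf_pCons hom_add hom_mult cst_def theta_def)

lemma emb_0 [simp]: "emb 0 = 0"
  by (simp add: emb_def A_to_Kinf_def)

lemma emb_1 [simp]: "emb 1 = 1"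
  using emb_pCons[of 1 0] by (simp add: one_pCons)

lemma emb_add: "emb (a + b) = emb a + emb b"
  by (induction a b rule: poly_induct2) (simp_all add: emb_pCons cst_add algebra_simps)

lemma emb_smult: "emb (smult c a) = cst c * emb a"
  by (induction a) (simp_all add: emb_pCons cst_mult algebra_simps)

lemma emb_mult: "emb (a * b) = emb a * emb b"
  by (induction a) (simp_all add: emb_pCons emb_add emb_smult algebra_simps)

lemma emb_monom: "emb (monom c n) = cst c * \<theta> ^ n"
  by (induction n) (simp_all add: monom_0 monom_Suc emb_pCons)

lemma nrm_emb:
  assumes "a \<noteq> 0"
  shows "nrm (emb a) = 2 ^ degree a"
  using assms
proof (induction a)
  case (pCons c a)
  show ?case
  proof (cases "a = 0")
    case True
    then have c: "c \<noteq> 0" using pCons by simp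
    have "nrm (cst c * cst (inverse c)) = 1" using c by (simp flip: cst_mult)
    then have "1 \<le> nrm (cst c)"
      using nrm_cst[of "inverse c"] nrm_cst[of c] mult_left_mono[of "nrm (cst (inverse c))" 1 "nrm (cst c)"]
      by (simp add: nrm_mult)
    then have "nrm (cst c) = 1" using nrm_cst[of c] by simp
    then show ?thesis using True by (simp add: emb_pCons)
  next
    case False
    then have n: "nrm (emb a) = 2 ^ degree a" using pCons by auto
    have "nrm (\<theta> * emb a + cst c) = nrm (\<theta> * emb a)"
    proof (rule nrm_add_eq)
      have "nrm (cst c) \<le> 1" by (rule nrm_cst)
      also have "(1 :: real) < 2 * 2 ^ degree a"
        using one_less_power[of "2 :: real" "Suc (degree a)"] by simp
      finally show "nrm (cst c) < nrm (\<theta> * emb a)" by (simp add: nrm_mult n)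
    qed
    then show ?thesis using False n by (simp add: emb_pCons nrm_mult add.commute)
  qed
qed simp

lemma emb_eq_0_iff [simp]: "emb a = 0 \<longleftrightarrow> a = 0"
  using nrm_emb[of a] by force

lemma emb_minus: "emb (- a) = - emb a"
  using emb_add[of a "- a"] by (simp add: eq_neg_iff_add_eq_0 add.commute)

end

section \<open>Sums over the polynomials of bounded degree\<close>

definition polys_lt :: "nat \<Rightarrow> 'f::zero poly set" where
  "polys_lt D = {a. \<forall>i\<ge>D. coeff a i = 0}"

lemma zero_in_polys_lt [simp]: "0 \<in> polys_lt D"
  by (simp add: polys_lt_def)

lemma polys_lt_0 [simp]: "polys_lt 0 = {0}"
  by (auto simp: polys_lt_def poly_eq_iff)

lemma polys_lt_mono: "D \<le> D' \<Longrightarrow> polys_lt D \<subseteq> polys_lt D'"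
  by (auto simp: polys_lt_def)

lemma degree_less_if_polys_lt: "a \<in> polys_lt D \<Longrightarrow> a \<noteq> 0 \<Longrightarrow> degree a < D"
  by (metis (mono_tags, lifting) leading_coeff_0_iff mem_Collect_eq not_le polys_lt_def)

lemma polys_lt_if_degree_less: "degree a < D \<Longrightarrow> a \<in> polys_lt D"
  by (auto simp: polys_lt_def intro: coeff_eq_0)

lemma polys_lt_Suc_bij:
  "bij_betw (\<lambda>(a, c). a + monom c D) (polys_lt D \<times> UNIV) (polys_lt (Suc D) :: 'f::{field, finite} poly set)"
  by (rule bij_betw_byWitness[where f' = "\<lambda>a. (a - monom (coeff a D) D, coeff a D)"])
     (auto simp: polys_lt_def poly_eq_iff Suc_le_eq)

lemma finite_polys_lt [simp]: "finite (polys_lt D :: 'f::{field, finite} poly set)"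
proof (induction D)
  case (Suc D)
  then show ?case
    using bij_betw_finite[OF polys_lt_Suc_bij[where ?'f = 'f, of D]] by simp
qed simp

lemma sum_polys_lt_Suc:
  "(\<Sum>a\<in>polys_lt (Suc D). f (a :: 'f::{field, finite} poly)) =
   (\<Sum>a\<in>polys_lt D. \<Sum>c\<in>UNIV. f (a + monom c D))"
  unfolding sum.cartesian_product sum.reindex_bij_betw[OF polys_lt_Suc_bij, symmetric]
  by (rule sum.cong) auto

lemma monic_polys_bij:
  "bij_betw (\<lambda>a. monom 1 d + a) (polys_lt d) (monic_polys d :: 'f::{field, finite} poly set)"
proof (rule bij_betw_byWitness[where f' = "\<lambda>a. a - monom 1 d"])
  show "(\<lambda>a. monom 1 d + a) ` polys_lt d \<subseteq> (monic_polys d :: 'f poly set)"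
  proof safe
    fix a :: "'f poly" assume a: "a \<in> polys_lt d"
    have "degree (monom 1 d + a) = d"
    proof (cases "a = 0")
      case False
      then show ?thesis
        using degree_less_if_polys_lt[OF a] by (simp add: degree_add_eq_left degree_monom_eq)
    qed (simp add: degree_monom_eq)
    then show "monom 1 d + a \<in> monic_polys d"
      using a by (simp add: monic_polys_def polys_lt_def)
  qed
  show "(\<lambda>a. a - monom 1 d) ` monic_polys d \<subseteq> (polys_lt d :: 'f poly set)"
  proof safe
    fix a :: "'f poly" assume a: "a \<in> monic_polys d"
    have "coeff (a - monom 1 d) i = 0" if "d \<le> i" for i
    proof (cases "i = d")
      case False
      with that a show ?thesis
        by (simp add: monic_polys_def coeff_eq_0[of a i])
    qed (use a in \<open>auto simp: monic_polys_def\<close>)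
    then show "a - monom 1 d \<in> polys_lt d" by (simp add: polys_lt_def)
  qed
qed auto

lemma finite_monic_polys [simp]: "finite (monic_polys d :: 'f::{field, finite} poly set)"
  using bij_betw_finite[OF monic_polys_bij[where ?'f = 'f, of d]] by simp

lemma sum_monic_polys:
  "(\<Sum>a\<in>monic_polys d. f (a :: 'f::{field, finite} poly)) = (\<Sum>a\<in>polys_lt d. f (monom 1 d + a))"
  unfolding sum.reindex_bij_betw[OF monic_polys_bij, symmetric] ..

lemma monic_polys_nz: "a \<in> monic_polys d \<Longrightarrow> a \<noteq> 0"
  by (auto simp: monic_polys_def)

lemma sum_polys_lt_add:
  "(\<Sum>a\<in>polys_lt (N + D). f (a :: 'f::{field, finite} poly)) =
   (\<Sum>b\<in>polys_lt N. \<Sum>a\<in>polys_lt D. f (b + monom 1 N * a))"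
proof (induction D arbitrary: f)
  case (Suc D)
  have "(\<Sum>a\<in>polys_lt (N + Suc D). f a) =
      (\<Sum>b\<in>polys_lt N. \<Sum>a\<in>polys_lt D. \<Sum>c\<in>UNIV. f (b + monom 1 N * a + monom c (N + D)))"
    by (simp add: sum_polys_lt_Suc Suc)
  also have "\<dots> = (\<Sum>b\<in>polys_lt N. \<Sum>a\<in>polys_lt (Suc D). f (b + monom 1 N * a))"
    unfolding sum_polys_lt_Suc by (simp add: distrib_left mult_monom add.assoc)
  finally show ?case .
qed simp

text \<open>
  Every non-zero polynomial is a unique constant times a monic one; a sum over \<open>\<F>\<^sub>q\<^sup>*\<close>-invariant terms
  picks up the factor \<open>q - 1 = -1\<close>.
\<close>

lemma sum_polys_lt_nonzero_eq_monic:
  fixes f :: "'f::{field, finite} poly \<Rightarrow> 'c::comm_ring_1"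
  assumes inv: "\<And>c a. c \<noteq> 0 \<Longrightarrow> a \<noteq> 0 \<Longrightarrow> f (smult c a) = f a"
    and q0: "of_nat CARD('f) = (0 :: 'c)"
  shows "(\<Sum>a\<in>polys_lt D - {0}. f a) = - (\<Sum>d<D. \<Sum>a\<in>monic_polys d. f a)"
proof -
  let ?U = "UNIV - {0 :: 'f}" and ?M = "\<Union>d<D. monic_polys d :: 'f poly set"
  have bij: "bij_betw (\<lambda>(c, a). smult c a) (?U \<times> ?M) (polys_lt D - {0})"
  proof (rule bij_betw_byWitness[where f' = "\<lambda>a. (lead_coeff a, smult (inverse (lead_coeff a)) a)"])
    show "(\<lambda>(c, a). smult c a) ` (?U \<times> ?M) \<subseteq> polys_lt D - {0}"
      by (auto simp: monic_polys_def intro!: polys_lt_if_degree_less)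
    show "(\<lambda>a. (lead_coeff a, smult (inverse (lead_coeff a)) a)) ` (polys_lt D - {0}) \<subseteq> ?U \<times> ?M"
      using degree_less_if_polys_lt by (fastforce simp: monic_polys_def)
  qed (auto simp: monic_polys_def)
  have "(\<Sum>a\<in>polys_lt D - {0}. f a) = (\<Sum>z\<in>?U \<times> ?M. case z of (c, a) \<Rightarrow> f (smult c a))"
    unfolding sum.reindex_bij_betw[OF bij, symmetric] by (rule sum.cong) auto
  also have "\<dots> = (\<Sum>z\<in>?U \<times> ?M. case z of (c, a) \<Rightarrow> f a)"
    using monic_polys_nz by (intro sum.cong) (auto intro!: inv)
  also have "\<dots> = (\<Sum>c\<in>?U. \<Sum>a\<in>?M. f a)"
    unfolding sum.cartesian_product ..
  also have "\<dots> = of_nat (card ?U) * (\<Sum>a\<in>?M. f a)"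
    by simp
  also have "of_nat (card ?U) = (-1 :: 'c)"
    using q0 by (simp add: card_Diff_subset of_nat_diff Suc_leI)
  also have "(\<Sum>a\<in>?M. f a) = (\<Sum>d<D. \<Sum>a\<in>monic_polys d. f a)"
    by (rule sum.UNION_disjoint) (simp_all, auto simp: monic_polys_def)
  finally show ?thesis by simp
qed

section \<open>Digit expansions\<close>

text \<open>
  A list of exponents encodes a factorisation \<open>x\<^bsup>k\<^esup> = \<Prod> x\<^bsup>q^e\<^esup>\<close> with \<open>k = wt q es\<close> into factors that are
  \<open>\<F>\<^sub>q\<close>-linear in \<open>x\<close>; what matters later is the number of the factors.
\<close>

definition wt :: "nat \<Rightarrow> nat list \<Rightarrow> nat" where
  "wt q es = (\<Sum>e\<leftarrow>es. q ^ e)"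

lemma wt_simps [simp]:
  "wt q [] = 0" "wt q (e # es) = q ^ e + wt q es" "wt q (es @ fs) = wt q es + wt q fs"
  "wt q (replicate n e) = n * q ^ e"
  by (simp_all add: wt_def sum_list_replicate)

lemma wt_map_Suc: "wt q (map Suc es) = q * wt q es"
  by (induction es) (simp_all add: algebra_simps)

lemma digit_sum_Suc_le:
  fixes q :: nat
  assumes "2 \<le> q" "k < q ^ n"
  shows "digit_sum q k = (\<Sum>i<n. k div q ^ i mod q)"
proof -
  have z: "k div q ^ i mod q = 0" if "k < q ^ i" for i
    using that by simp
  have big: "k < q ^ i" if "n \<le> i" for i
    by (rule order.strict_trans2[OF assms(2)], rule power_increasing) (use that assms in auto)
  have big': "k < q ^ i" if "k \<le> i" for i
  proof -
    have "k < 2 ^ k" by (rule less_exp)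
    also have "\<dots> \<le> 2 ^ i" using that by (intro power_increasing) auto
    also have "\<dots> \<le> q ^ i" using assms by (intro power_mono) auto
    finally show ?thesis .
  qed
  have "digit_sum q k = (\<Sum>i<Suc k + n. k div q ^ i mod q)"
    unfolding digit_sum_def by (rule sum.mono_neutral_left) (auto intro!: z big')
  also have "\<dots> = (\<Sum>i<n. k div q ^ i mod q)"
    by (rule sum.mono_neutral_right) (auto intro!: z big)
  finally show ?thesis .
qed

lemma ex_digits_lt:
  fixes q :: nat
  assumes "2 \<le> q" "k < q ^ n"
  shows "\<exists>es. wt q es = k \<and> length es = (\<Sum>i<n. k div q ^ i mod q)"
  using assms(2)
proof (induction n arbitrary: k)
  case (Suc n)
  have "k div q < q ^ n"
    using Suc.prems assms(1) by (simp add: less_mult_imp_div_less mult.commute)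
  from Suc.IH[OF this] obtain es where
    es: "wt q es = k div q" "length es = (\<Sum>i<n. k div q div q ^ i mod q)" by blast
  have "wt q (replicate (k mod q) 0 @ map Suc es) = k"
    by (simp add: wt_map_Suc es)
  moreover have "length (replicate (k mod q) 0 @ map Suc es) = (\<Sum>i<Suc n. k div q ^ i mod q)"
    unfolding sum.lessThan_Suc_shift by (simp add: es div_mult2_eq)
  ultimately show ?case by blast
qed (auto intro: exI[of _ "[]"])

lemma ex_digits:
  fixes q :: nat
  assumes "2 \<le> q"
  shows "\<exists>es. wt q es = k \<and> length es = digit_sum q k"
proof -
  have "k < 2 ^ k" by (rule less_exp)
  also have "\<dots> \<le> q ^ k" using assms by (intro power_mono) auto
  finally have "k < q ^ k" .
  with ex_digits_lt[OF assms this] digit_sum_Suc_le[OF assms this] show ?thesis by simp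
qed

text \<open>
  Among the numbers with \<open>n\<close> digits only \<open>q\<^bsup>n\<^esup> - 1\<close> has digit sum \<open>n(q - 1)\<close>.
\<close>

lemma ex_digits_short:
  fixes q :: nat
  assumes "2 \<le> q" "Suc k < q ^ n"
  shows "\<exists>es. wt q es = k \<and> length es < n * (q - 1)"
proof -
  have "\<exists>es. wt q es = k \<and> length es \<le> n * (q - 1) \<and> (Suc k < q ^ n \<longrightarrow> length es < n * (q - 1))"
    if "k < q ^ n" for k
    using that
  proof (induction n arbitrary: k)
    case (Suc n)
    have "k div q < q ^ n"
      using Suc.prems assms(1) by (simp add: less_mult_imp_div_less mult.commute)
    from Suc.IH[OF this] obtain es where
      es: "wt q es = k div q" "length es \<le> n * (q - 1)"
        "Suc (k div q) < q ^ n \<longrightarrow> length es < n * (q - 1)" by blast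
    have kq: "k mod q \<le> q - 1" using assms(1) by (simp add: less_Suc_eq_le[symmetric])
    have last: "length es < n * (q - 1) \<or> k mod q < q - 1" if "Suc k < q ^ Suc n"
    proof (rule ccontr)
      assume "\<not> ?thesis"
      then have "k mod q = q - 1" "q ^ n \<le> Suc (k div q)" using kq es(3) by auto
      then have "q * q ^ n \<le> q * (k div q) + q"
        using mult_le_mono2[of "q ^ n" "Suc (k div q)" q] by simp
      also have "\<dots> = Suc k"
        using \<open>k mod q = q - 1\<close> mult_div_mod_eq[of q k] assms(1) by simp
      finally show False using that by simp
    qed
    have "wt q (replicate (k mod q) 0 @ map Suc es) = k"
      by (simp add: wt_map_Suc es)
    moreover have "length (replicate (k mod q) 0 @ map Suc es) \<le> Suc n * (q - 1)"
      using es(2) kq by simp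
    moreover have "length (replicate (k mod q) 0 @ map Suc es) < Suc n * (q - 1)"
      if "Suc k < q ^ Suc n"
      using last[OF that] es(2) kq by auto
    ultimately show ?case by blast
  qed (auto intro: exI[of _ "[]"])
  from this[of k] assms show ?thesis by auto
qed

lemma wt_cong_length:
  fixes q :: nat
  assumes "2 \<le> q"
  shows "[wt q es = length es] (mod (q - 1))"
proof (induction es)
  case (Cons e es)
  have "[q = 1] (mod (q - 1))"
    using assms cong_add_lcancel_0_nat[of 1 "q - 1" "q - 1"] by (simp add: cong_sym cong_def mod_add_self2)
  then have "[q ^ e = 1] (mod (q - 1))"
    using cong_pow[of q 1 "q - 1" e] by simp
  from cong_add[OF this Cons] show ?case by simp
qed simp

text \<open>
  Since \<open>q\<^bsup>M\<^esup> = q\<^bsup>\<delta>\<^esup> + \<Sum>(q - 1)q\<^bsup>j\<^esup>\<close> with \<open>\<delta> \<le> j < M\<close>, each step from \<open>M\<close> to \<open>M + 1\<close> costs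
  \<open>q - 1\<close> further digits.
\<close>

lemma wt_raise:
  fixes q :: nat
  assumes "1 \<le> q" "wt q es = q ^ \<delta> - \<alpha>" "\<alpha> \<le> q ^ \<delta>" "\<delta> \<le> M"
  shows "\<exists>es'. wt q es' = q ^ M - \<alpha> \<and> length es' = length es + (M - \<delta>) * (q - 1)"
  using assms(4)
proof (induction M rule: dec_induct)
  case base
  then show ?case using assms by auto
next
  case (step M)
  then obtain es' where es': "wt q es' = q ^ M - \<alpha>" "length es' = length es + (M - \<delta>) * (q - 1)"
    by blast
  have le: "q ^ \<delta> \<le> q ^ M" using step assms(1) by (intro power_increasing) auto
  have le2: "q ^ M \<le> q * q ^ M" using assms(1) by simp
  have "wt q (replicate (q - 1) M @ es') = q ^ Suc M - \<alpha>"
    using assms(1,3) le le2 by (simp add: es' diff_mult_distrib)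
  moreover have "length (replicate (q - 1) M @ es') = length es + (Suc M - \<delta>) * (q - 1)"
    using step by (simp add: es' Suc_diff_le)
  ultimately show ?case by blast
qed

section \<open>Vanishing of sums of products of affine forms\<close>

context C_infinity_card
begin

definition lin :: "('f poly \<Rightarrow> 'c) \<Rightarrow> bool" where
  "lin l \<longleftrightarrow> (\<forall>a b. l (a + b) = l a + l b) \<and> (\<forall>c a. l (smult c a) = cst c * l a)"

lemma lin_add: "lin l \<Longrightarrow> l (a + b) = l a + l b"
  and lin_smult: "lin l \<Longrightarrow> l (smult c a) = cst c * l a"
  by (auto simp: lin_def)

lemma lin_0 [simp]: "lin l \<Longrightarrow> l 0 = 0"
  using lin_smult[of l 0 0] by simp

lemma lin_sum: "lin l \<Longrightarrow> l (sum f S) = (\<Sum>x\<in>S. l (f x))"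
  by (induction S rule: infinite_finite_induct) (auto simp: lin_add)

lemma lin_monom: "lin l \<Longrightarrow> l (monom c n) = cst c * l (monom 1 n)"
  using lin_smult[of l c "monom 1 n"] by (simp add: smult_monom)

lemma lin_emb: "lin emb"
  by (simp add: lin_def emb_add emb_smult)

lemma lin_coeff: "lin (\<lambda>a. cst (coeff a n))"
  by (simp add: lin_def cst_add cst_mult)

lemma lin_power_card: "lin l \<Longrightarrow> lin (\<lambda>a. l a ^ q ^ e)"
  by (simp add: lin_def frobenius_power_add power_mult_distrib cst_power_card_power)

lemma lin_mult_const: "lin l \<Longrightarrow> lin (\<lambda>a. x * l a)"
  by (simp add: lin_def algebra_simps)

lemma lin_combination: "(\<And>i. i \<in> S \<Longrightarrow> lin (l i)) \<Longrightarrow> lin (\<lambda>a. \<Sum>i\<in>S. x i * l i a)"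
  by (auto simp: lin_def sum.distrib algebra_simps sum_distrib_left)

lemma of_nat_q [simp]: "of_nat q = (0 :: 'c)"
  using of_nat_card_field[where ?'f = 'f] by (simp add: q_def flip: cst_of_nat)

lemma sum_power_cst: "j < q - 1 \<Longrightarrow> (\<Sum>c\<in>UNIV. cst c ^ j) = 0"
  using sum_power_finite_field[of j, where ?'f = 'f] by (simp add: q_def flip: cst_power cst_sum)

text \<open>
  By induction on the dimension.  Expanding the product along the last coordinate \<open>c\<close> produces the
  power sums \<open>\<Sum>c\<^bsup>j\<^esup>\<close>, which vanish for \<open>j < q - 1\<close>.  So at least \<open>q - 1\<close> of the forms are used up for
  this coordinate, and too few are left for the others.
\<close>

lemma sum_prod_affine_eq_0:
  assumes "finite I" "\<And>k. k \<in> I \<Longrightarrow> lin (l k)" "card I < D * (q - 1)"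
  shows "(\<Sum>a\<in>polys_lt D. \<Prod>k\<in>I. w k + l k a) = 0"
  using assms
proof (induction D arbitrary: I)
  case (Suc D)
  define u where "u k = l k (monom 1 D)" for k
  have "(\<Sum>a\<in>polys_lt (Suc D). \<Prod>k\<in>I. w k + l k a) =
      (\<Sum>a\<in>polys_lt D. \<Sum>c\<in>UNIV. \<Prod>k\<in>I. cst c * u k + (w k + l k a))"
    unfolding sum_polys_lt_Suc u_def using Suc.prems
    by (intro sum.cong prod.cong refl) (simp add: lin_add lin_monom[symmetric] algebra_simps)
  also have "\<dots> = (\<Sum>a\<in>polys_lt D. \<Sum>c\<in>UNIV. \<Sum>J\<in>Pow I.
      (\<Prod>k\<in>J. cst c * u k) * (\<Prod>k\<in>I-J. w k + l k a))"
    by (simp add: prod_add Suc.prems)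
  also have "\<dots> = (\<Sum>a\<in>polys_lt D. \<Sum>J\<in>Pow I. \<Sum>c\<in>UNIV.
      (\<Prod>k\<in>J. cst c * u k) * (\<Prod>k\<in>I-J. w k + l k a))"
    by (subst sum.swap) (rule refl)
  also have "\<dots> = (\<Sum>J\<in>Pow I. \<Sum>a\<in>polys_lt D. \<Sum>c\<in>UNIV.
      (\<Prod>k\<in>J. cst c * u k) * (\<Prod>k\<in>I-J. w k + l k a))"
    by (rule sum.swap)
  also have "\<dots> = (\<Sum>J\<in>Pow I. (\<Prod>k\<in>J. u k) * (\<Sum>c\<in>UNIV. cst c ^ card J) *
      (\<Sum>a\<in>polys_lt D. \<Prod>k\<in>I-J. w k + l k a))"
    by (simp add: prod.distrib sum_distrib_left sum_distrib_right mult_ac)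
  also have "\<dots> = 0"
  proof (rule sum.neutral, safe)
    fix J assume J: "J \<subseteq> I"
    show "(\<Prod>k\<in>J. u k) * (\<Sum>c\<in>UNIV. cst c ^ card J) *
      (\<Sum>a\<in>polys_lt D. \<Prod>k\<in>I-J. w k + l k a) = 0"
    proof (cases "card J < q - 1")
      case True
      then show ?thesis by (simp add: sum_power_cst)
    next
      case False
      have "card (I - J) = card I - card J" "card J \<le> card I"
        using J Suc.prems(1) by (auto simp: card_Diff_subset finite_subset card_mono)
      then have "card (I - J) < D * (q - 1)" using False Suc.prems(3) by simp
      then have "(\<Sum>a\<in>polys_lt D. \<Prod>k\<in>I-J. w k + l k a) = 0"
        using Suc.prems by (intro Suc.IH) auto
      then show ?thesis by simp
    qed
  qed
  finally show ?case .
qed simp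

text \<open>
  In the boundary case only the product of all the linear parts survives.  Its size is the product of
  the sizes of the linear parts, however large the constant terms are.
\<close>

lemma sum_prod_affine_eq_linear:
  assumes "finite I" "\<And>k. k \<in> I \<Longrightarrow> lin (l k)" "card I \<le> D * (q - 1)"
  shows "(\<Sum>a\<in>polys_lt D. \<Prod>k\<in>I. w k + l k a) = (\<Sum>a\<in>polys_lt D. \<Prod>k\<in>I. l k a)"
proof -
  have "(\<Sum>a\<in>polys_lt D. \<Prod>k\<in>I. w k + l k a) =
      (\<Sum>a\<in>polys_lt D. \<Sum>J\<in>Pow I. (\<Prod>k\<in>J. w k) * (\<Prod>k\<in>I-J. l k a))"
    by (simp add: prod_add assms)
  also have "\<dots> = (\<Sum>J\<in>Pow I. \<Sum>a\<in>polys_lt D. (\<Prod>k\<in>J. w k) * (\<Prod>k\<in>I-J. l k a))"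
    by (rule sum.swap)
  also have "\<dots> = (\<Sum>J\<in>Pow I. if J = {} then (\<Sum>a\<in>polys_lt D. \<Prod>k\<in>I. l k a) else 0)"
  proof (rule sum.cong[OF refl])
    fix J assume J: "J \<in> Pow I"
    have "(\<Sum>a\<in>polys_lt D. \<Prod>k\<in>I-J. l k a) = 0" if "J \<noteq> {}"
    proof -
      have "card (I - J) < card I" using J that assms(1) by (intro psubset_card_mono) auto
      then show ?thesis
        using sum_prod_affine_eq_0[of "I - J" l D "\<lambda>_. 0"] assms by simp
    qed
    then show "(\<Sum>a\<in>polys_lt D. (\<Prod>k\<in>J. w k) * (\<Prod>k\<in>I-J. l k a)) =
        (if J = {} then (\<Sum>a\<in>polys_lt D. \<Prod>k\<in>I. l k a) else 0)"
      unfolding sum_distrib_left[symmetric] by simp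
  qed
  also have "\<dots> = (\<Sum>a\<in>polys_lt D. \<Prod>k\<in>I. l k a)"
    by (simp add: assms(1))
  finally show ?thesis .
qed

lemma power_wt: "x ^ wt q es = (\<Prod>i<length es. x ^ q ^ (es ! i) :: 'c)"
  by (induction es) (simp_all add: power_add prod.lessThan_Suc_shift del: prod.lessThan_Suc)

lemma prod_affine_power_wt:
  fixes T :: "'i set" and w :: "'i \<Rightarrow> 'c" and l :: "'i \<Rightarrow> 'b \<Rightarrow> 'c" and v :: 'c and g :: "'b \<Rightarrow> 'c"
  assumes "finite T"
  shows "(\<Prod>k\<in>T. w k + l k a) * (v + g a) ^ wt q es =
    (\<Prod>k\<in>T <+> {..<length es}. case_sum w (\<lambda>i. v ^ q ^ (es ! i)) k + case_sum l (\<lambda>i a. g a ^ q ^ (es ! i)) k a)"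
  unfolding power_wt using assms by (simp add: prod.Plus frobenius_power_add o_def)

lemma sum_prod_affine_power_eq_0:
  assumes "finite T" "\<And>k. k \<in> T \<Longrightarrow> lin (l k)" "lin g" "card T + length es < D * (q - 1)"
  shows "(\<Sum>a\<in>polys_lt D. (\<Prod>k\<in>T. w k + l k a) * (v + g a) ^ wt q es) = 0"
  unfolding prod_affine_power_wt[OF assms(1)]
  using assms by (intro sum_prod_affine_eq_0) (auto simp: card_Plus lin_power_card)

lemma sum_prod_affine_power_eq_linear:
  assumes "finite T" "\<And>k. k \<in> T \<Longrightarrow> lin (l k)" "lin g" "card T + length es \<le> D * (q - 1)"
  shows "(\<Sum>a\<in>polys_lt D. (\<Prod>k\<in>T. w k + l k a) * (v + g a) ^ wt q es) =
         (\<Sum>a\<in>polys_lt D. (\<Prod>k\<in>T. l k a) * g a ^ wt q es)"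
proof -
  have "(\<Sum>a\<in>polys_lt D. (\<Prod>k\<in>T. w k + l k a) * (v + g a) ^ wt q es) =
      (\<Sum>a\<in>polys_lt D. \<Prod>k\<in>T <+> {..<length es}. case_sum l (\<lambda>i a. g a ^ q ^ (es ! i)) k a)"
    unfolding prod_affine_power_wt[OF assms(1)]
    using assms by (intro sum_prod_affine_eq_linear) (auto simp: card_Plus lin_power_card)
  also have "\<dots> = (\<Sum>a\<in>polys_lt D. (\<Prod>k\<in>T. l k a) * g a ^ wt q es)"
    using assms(1) by (simp add: prod.Plus power_wt o_def)
  finally show ?thesis .
qed

lemma sum_affine_power_eq_0:
  assumes "lin g" "Suc k < q ^ D"
  shows "(\<Sum>a\<in>polys_lt D. (v + g a) ^ k) = 0"
proof -
  obtain es where es: "wt q es = k" "length es < D * (q - 1)"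
    using ex_digits_short[OF q_ge_2 assms(2)] by blast
  show ?thesis
    using sum_prod_affine_power_eq_0[of "{}" "\<lambda>_ _. 0" g es D "\<lambda>_. 0" v] assms es by simp
qed

end

section \<open>Estimates for the partial sums of the \<open>L\<close>-series\<close>

locale L_setting = C_infinity_card \<iota> q
  for \<iota> :: "'f::{field, finite} fls \<Rightarrow> 'c::{field, complete_space}" and q :: nat +
  fixes \<alpha> s :: nat
  assumes alpha_pos: "0 < \<alpha>" and s_pos: "0 < s" and alpha_cong_s: "[\<alpha> = s] (mod (q - 1))"
begin

definition \<delta> :: nat where "\<delta> = delta q \<alpha> s"

definition ell :: nat where "ell = digit_sum q (q ^ \<delta> - \<alpha>)"

text \<open>
  By \<open>m_eq\<close> the division is exact.
\<close>

definition m :: nat where "m = (s + ell - 1) div (q - 1)"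

lemma delta_ex: "\<exists>d. \<alpha> \<le> q ^ d \<and> 2 \<le> s + digit_sum q (q ^ d - \<alpha>)"
proof -
  have "Suc \<alpha> \<le> 2 ^ Suc \<alpha>" using less_exp[of "Suc \<alpha>"] by simp
  also have "\<dots> \<le> q ^ Suc \<alpha>" using q_ge_2 by (intro power_mono) auto
  finally have lt: "\<alpha> < q ^ Suc \<alpha>" by simp
  obtain es where es: "wt q es = q ^ Suc \<alpha> - \<alpha>" "length es = digit_sum q (q ^ Suc \<alpha> - \<alpha>)"
    using ex_digits[OF q_ge_2] by blast
  then have "es \<noteq> []" using lt by auto
  then have "1 \<le> digit_sum q (q ^ Suc \<alpha> - \<alpha>)" unfolding es(2)[symmetric] by (simp add: Suc_le_eq)
  then show ?thesis using lt s_pos by (intro exI[of _ "Suc \<alpha>"]) simp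
qed

lemma alpha_le: "\<alpha> \<le> q ^ \<delta>" and s_plus_ell_ge_2: "2 \<le> s + ell"
  using LeastI_ex[OF delta_ex] by (simp_all add: \<delta>_def ell_def delta_def)

lemma alpha_le_power: "\<delta> \<le> k \<Longrightarrow> \<alpha> \<le> q ^ k"
  using order.trans[OF alpha_le power_increasing[of \<delta> k q]] by simp

lemma alpha_less_power:
  assumes "s = 1" "\<delta> \<le> k"
  shows "\<alpha> < q ^ k"
proof -
  have "\<alpha> \<noteq> q ^ \<delta>"
  proof
    assume "\<alpha> = q ^ \<delta>"
    then have "ell = 0" by (simp add: ell_def digit_sum_def)
    then show False using s_plus_ell_ge_2 assms by simp
  qed
  moreover have "q ^ \<delta> \<le> q ^ k"
    using assms(2) q_pos by (intro power_increasing) auto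
  ultimately show ?thesis using alpha_le by linarith
qed

lemma power_q_cong: "[q ^ k = 1] (mod (q - 1))"
  using wt_cong_length[OF q_ge_2, of "[k]"] by simp

lemma power_minus_alpha_cong:
  assumes "\<alpha> \<le> q ^ k"
  shows "[s + (q ^ k - \<alpha>) = 1] (mod (q - 1))"
proof -
  have "[s + (q ^ k - \<alpha>) = \<alpha> + (q ^ k - \<alpha>)] (mod (q - 1))"
    using alpha_cong_s by (intro cong_add) (simp_all add: cong_sym)
  also have "\<alpha> + (q ^ k - \<alpha>) = q ^ k" using assms by simp
  finally show ?thesis using power_q_cong cong_trans by blast
qed

lemma dvd_minus_1_if_cong:
  fixes k n :: nat
  assumes "[k = 1] (mod n)" "1 \<le> k"
  shows "n dvd k - 1"
  using assms by (metis cong_altdef_nat cong_sym)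

lemma m_eq: "m * (q - 1) + 1 = s + ell"
proof -
  obtain es where es: "wt q es = q ^ \<delta> - \<alpha>" "length es = ell"
    using ex_digits[OF q_ge_2] unfolding ell_def by blast
  have "[ell = q ^ \<delta> - \<alpha>] (mod (q - 1))"
    using wt_cong_length[OF q_ge_2, of es] by (simp add: es cong_sym)
  then have "[s + ell = s + (q ^ \<delta> - \<alpha>)] (mod (q - 1))"
    by (intro cong_add) simp_all
  then have "[s + ell = 1] (mod (q - 1))"
    using power_minus_alpha_cong[OF alpha_le] cong_trans by blast
  then have "q - 1 dvd s + ell - 1"
    using s_pos by (intro dvd_minus_1_if_cong) auto
  then show ?thesis using s_pos by (simp add: m_def)
qed

lemma m_pos: "1 \<le> m"
  using m_eq s_plus_ell_ge_2 by (cases m) auto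

lemma ex_digits_raised:
  assumes "\<delta> \<le> M"
  shows "\<exists>es. wt q es = q ^ M - \<alpha> \<and> length es = ell + (M - \<delta>) * (q - 1)"
proof -
  obtain es where "wt q es = q ^ \<delta> - \<alpha>" "length es = ell"
    using ex_digits[OF q_ge_2] unfolding ell_def by blast
  with wt_raise[of q es \<delta> \<alpha> M] assms alpha_le q_pos show ?thesis by auto
qed

lemma nrm_inverse_emb_power_le: "a \<noteq> 0 \<Longrightarrow> nrm (inverse (emb a ^ \<alpha>)) \<le> 1"
  by (simp add: nrm_inverse nrm_power nrm_emb flip: power_inverse) (simp add: power_le_one power_inverse)

text \<open>
  With \<open>y = a/\<theta>\<^bsup>d\<^esup> = 1 + u\<close> and \<open>|u| < 1\<close>, the power \<open>y\<^bsup>-\<alpha>\<^esup>\<close> differs from \<open>y\<^bsup>q^M-\<alpha>\<^esup>\<close> by a term of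
  size \<open>|u|\<^bsup>q^M\<^esup>\<close>, and \<open>y\<^bsup>q^M-\<alpha>\<^esup>\<close> is a product of \<open>ell + (M - \<delta>)(q - 1)\<close> affine forms in the lower
  coefficients of \<open>a\<close>.  If there are not too many forms in all, only their linear parts contribute, and
  those coming from \<open>y\<close> make up \<open>u\<^bsup>q^M-\<alpha>\<^esup>\<close>.
\<close>

lemma sum_monic_bound:
  assumes "finite T" and lin: "\<And>k. k \<in> T \<Longrightarrow> lin (f k)"
    and bd: "\<And>k a. k \<in> T \<Longrightarrow> nrm (f k a) \<le> C k"
    and M: "\<delta> \<le> M" "card T + ell + (M - \<delta>) * (q - 1) \<le> d * (q - 1)"
  shows "nrm (\<Sum>a\<in>monic_polys d. (\<Prod>k\<in>T. f k a) * inverse (emb a ^ \<alpha>))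
    \<le> (\<Prod>k\<in>T. C k) * 2 ^ \<alpha> / 2 ^ q ^ M"
proof -
  obtain es where es: "wt q es = q ^ M - \<alpha>" "length es = ell + (M - \<delta>) * (q - 1)"
    using ex_digits_raised[OF M(1)] by blast
  have aM: "\<alpha> \<le> q ^ M" by (rule alpha_le_power[OF M(1)])
  define u where "u a = inverse (\<theta> ^ d) * emb a" for a
  define y where "y a = 1 + u a" for a
  define w where "w k = f k (monom 1 d)" for k
  have linu: "lin u" unfolding u_def by (intro lin_mult_const lin_emb)
  have C0: "0 \<le> C k" if "k \<in> T" for k using bd[OF that, of 0] nrm_ge_0 order.trans by blast
  have PC0: "0 \<le> (\<Prod>k\<in>T. C k)" by (rule prod_nonneg) (use C0 in auto)
  have f_le: "nrm (\<Prod>k\<in>T. f k a) \<le> (\<Prod>k\<in>T. C k)" for a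
    unfolding nrm_prod by (rule prod_mono) (auto intro: bd)
  have u_le: "nrm (u a) \<le> 1 / 2" if "a \<in> polys_lt d" for a
  proof (cases "a = 0")
    case False
    then have "Suc (degree a) \<le> d" using degree_less_if_polys_lt[OF that] by simp
    then have "(2 :: real) ^ Suc (degree a) \<le> 2 ^ d" by (intro power_increasing) auto
    then show ?thesis
      unfolding u_def nrm_mult nrm_inverse nrm_power nrm_emb[OF False] nrm_theta
      by (simp add: field_simps)
  qed (simp add: u_def)
  have y_nrm: "nrm (y a) = 1" if "a \<in> polys_lt d" for a
    using nrm_add_eq[of "u a" 1] u_le[OF that] by (simp add: y_def)
  have y_nz: "y a \<noteq> 0" if "a \<in> polys_lt d" for a
    using y_nrm[OF that] by force
  have emb_eq: "emb (monom 1 d + a) = \<theta> ^ d * y a" for a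
    by (simp add: y_def u_def emb_add emb_monom algebra_simps)
  have f_eq: "f k (monom 1 d + a) = w k + f k a" if "k \<in> T" for k a
    by (simp add: w_def lin_add[OF lin[OF that]])
  define R where "R a = inverse (y a ^ \<alpha>) - y a ^ (q ^ M - \<alpha>)" for a
  have R_le: "nrm (R a) \<le> 1 / 2 ^ q ^ M" if a: "a \<in> polys_lt d" for a
  proof -
    have "y a ^ (q ^ M - \<alpha>) * y a ^ \<alpha> = y a ^ q ^ M" using aM by (simp flip: power_add)
    also have "\<dots> = 1 + u a ^ q ^ M" by (simp add: y_def frobenius_power_add)
    finally have "R a * y a ^ \<alpha> = - (u a ^ q ^ M)"
      using y_nz[OF a] by (simp add: R_def left_diff_distrib)
    then have "nrm (R a * y a ^ \<alpha>) = nrm (u a) ^ q ^ M" by (simp add: nrm_power)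
    then have "nrm (R a) = nrm (u a) ^ q ^ M" by (simp add: nrm_mult nrm_power y_nrm[OF a])
    also have "\<dots> \<le> (1 / 2) ^ q ^ M" using u_le[OF a] by (intro power_mono) auto
    finally show ?thesis by (simp add: power_one_over)
  qed
  have main: "nrm (\<Sum>a\<in>polys_lt d. (\<Prod>k\<in>T. w k + f k a) * y a ^ (q ^ M - \<alpha>))
      \<le> (\<Prod>k\<in>T. C k) * 2 ^ \<alpha> / 2 ^ q ^ M"
  proof -
    have "(\<Sum>a\<in>polys_lt d. (\<Prod>k\<in>T. w k + f k a) * y a ^ (q ^ M - \<alpha>)) =
        (\<Sum>a\<in>polys_lt d. (\<Prod>k\<in>T. f k a) * u a ^ (q ^ M - \<alpha>))"
      unfolding y_def es(1)[symmetric]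
      by (rule sum_prod_affine_power_eq_linear) (use assms linu es in auto)
    also have "nrm \<dots> \<le> (\<Prod>k\<in>T. C k) * 2 ^ \<alpha> / 2 ^ q ^ M"
    proof (rule nrm_sum_le)
      fix a :: "'f poly" assume a: "a \<in> polys_lt d"
      have "nrm (u a) ^ (q ^ M - \<alpha>) \<le> (1 / 2) ^ (q ^ M - \<alpha>)"
        using u_le[OF a] by (intro power_mono) auto
      also have "\<dots> = 2 ^ \<alpha> / 2 ^ q ^ M" using aM by (simp add: power_diff power_one_over)
      finally have "nrm (\<Prod>k\<in>T. f k a) * nrm (u a) ^ (q ^ M - \<alpha>) \<le> (\<Prod>k\<in>T. C k) * (2 ^ \<alpha> / 2 ^ q ^ M)"
        using f_le PC0 by (intro mult_mono) auto
      then show "nrm ((\<Prod>k\<in>T. f k a) * u a ^ (q ^ M - \<alpha>)) \<le> (\<Prod>k\<in>T. C k) * 2 ^ \<alpha> / 2 ^ q ^ M"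
        by (simp add: nrm_mult nrm_power)
    qed (use PC0 in auto)
    finally show ?thesis .
  qed
  have rest: "nrm (\<Sum>a\<in>polys_lt d. (\<Prod>k\<in>T. w k + f k a) * R a)
      \<le> (\<Prod>k\<in>T. C k) * 2 ^ \<alpha> / 2 ^ q ^ M"
  proof (rule nrm_sum_le)
    fix a :: "'f poly" assume a: "a \<in> polys_lt d"
    have "(\<Prod>k\<in>T. w k + f k a) = (\<Prod>k\<in>T. f k (monom 1 d + a))"
      by (rule prod.cong) (simp_all add: f_eq)
    moreover have "nrm (R a) \<le> 2 ^ \<alpha> / 2 ^ q ^ M"
      by (rule order.trans[OF R_le[OF a]]) (intro divide_right_mono, auto)
    ultimately have "nrm (\<Prod>k\<in>T. w k + f k a) * nrm (R a) \<le> (\<Prod>k\<in>T. C k) * (2 ^ \<alpha> / 2 ^ q ^ M)"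
      using f_le PC0 by (intro mult_mono) auto
    then show "nrm ((\<Prod>k\<in>T. w k + f k a) * R a) \<le> (\<Prod>k\<in>T. C k) * 2 ^ \<alpha> / 2 ^ q ^ M"
      by (simp add: nrm_mult)
  qed (use PC0 in auto)
  have "(\<Sum>a\<in>monic_polys d. (\<Prod>k\<in>T. f k a) * inverse (emb a ^ \<alpha>)) =
      (\<Sum>a\<in>polys_lt d. inverse (\<theta> ^ d) ^ \<alpha> * ((\<Prod>k\<in>T. w k + f k a) * (y a ^ (q ^ M - \<alpha>) + R a)))"
    unfolding sum_monic_polys
    by (rule sum.cong) (simp_all add: f_eq emb_eq R_def power_mult_distrib power_inverse)
  also have "\<dots> = inverse (\<theta> ^ d) ^ \<alpha> *
      ((\<Sum>a\<in>polys_lt d. (\<Prod>k\<in>T. w k + f k a) * y a ^ (q ^ M - \<alpha>)) +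
       (\<Sum>a\<in>polys_lt d. (\<Prod>k\<in>T. w k + f k a) * R a))"
    by (simp add: sum_distrib_left[symmetric] distrib_left sum.distrib)
  also have "nrm \<dots> \<le> 1 * ((\<Prod>k\<in>T. C k) * 2 ^ \<alpha> / 2 ^ q ^ M)"
    unfolding nrm_mult
  proof (rule mult_mono)
    have "inverse ((2 :: real) ^ d) \<le> 1" by (simp add: inverse_le_1_iff)
    then show "nrm (inverse (\<theta> ^ d) ^ \<alpha>) \<le> 1"
      unfolding nrm_power nrm_inverse nrm_theta by (intro power_le_one) auto
  qed (use nrm_add_le[OF main rest] in auto)
  finally show ?thesis by simp
qed

text \<open>
  The partial sum up to degree \<open>D\<close> of the \<open>L\<close>-series as a polynomial in one variable, the characters
  belonging to the other variables being replaced by arbitrary functions \<open>l k\<close> of \<open>a\<close>.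
\<close>

definition partial_L :: "('i \<Rightarrow> 'f poly \<Rightarrow> 'c) \<Rightarrow> 'i set \<Rightarrow> nat \<Rightarrow> 'c poly" where
  "partial_L l I D = (\<Sum>d<D. \<Sum>a\<in>monic_polys d.
     smult ((\<Prod>k\<in>I. l k a) * inverse (emb a ^ \<alpha>)) (map_poly cst a))"

lemma coeff_partial_L:
  "coeff (partial_L l I D) n =
    (\<Sum>d<D. \<Sum>a\<in>monic_polys d. cst (coeff a n) * (\<Prod>k\<in>I. l k a) * inverse (emb a ^ \<alpha>))"
  by (simp add: partial_L_def coeff_sum coeff_map_poly mult_ac)

lemma nrm_coeff_partial_L_le:
  assumes bd: "\<And>k a. k \<in> I \<Longrightarrow> nrm (l k a) \<le> C k"
  shows "nrm (coeff (partial_L l I D) n) \<le> (\<Prod>k\<in>I. C k)"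
proof -
  have "0 \<le> nrm (l k 0)" for k by simp
  then have C0: "0 \<le> C k" if "k \<in> I" for k using bd[OF that, of 0] order.trans by blast
  have PC0: "0 \<le> (\<Prod>k\<in>I. C k)" by (rule prod_nonneg) (use C0 in auto)
  show ?thesis
    unfolding coeff_partial_L
  proof (intro nrm_sum_le PC0)
    fix d a assume "a \<in> (monic_polys d :: 'f poly set)"
    then have a: "a \<noteq> 0" by (rule monic_polys_nz)
    have "nrm (cst (coeff a n)) * nrm (\<Prod>k\<in>I. l k a) * nrm (inverse (emb a ^ \<alpha>)) \<le> 1 * (\<Prod>k\<in>I. C k) * 1"
      using PC0 nrm_cst nrm_inverse_emb_power_le[OF a]
      by (intro mult_mono) (auto simp: nrm_prod intro!: prod_mono bd prod_nonneg)
    then show "nrm (cst (coeff a n) * (\<Prod>k\<in>I. l k a) * inverse (emb a ^ \<alpha>)) \<le> (\<Prod>k\<in>I. C k)"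
      by (simp add: nrm_mult)
  qed
qed

text \<open>
  In degree \<open>d = n\<close> the coefficient of \<open>t\<^bsup>n\<^esup>\<close> in \<open>a(t)\<close> is \<open>1\<close>, so that only \<open>s - 1\<close> forms besides
  \<open>a\<^bsup>-\<alpha>\<^esup>\<close> occur; this makes \<open>M = \<delta> + n - m\<close> admissible in \<open>sum_monic_bound\<close>.  In the degrees \<open>d > n\<close>
  there is one form more, which the larger dimension compensates.
\<close>

lemma nrm_coeff_partial_L_decay:
  assumes I: "finite I" "card I = s - 1" and lin: "\<And>k. k \<in> I \<Longrightarrow> lin (l k)"
    and bd: "\<And>k a. k \<in> I \<Longrightarrow> nrm (l k a) \<le> C k"
  shows "nrm (coeff (partial_L l I D) (m + j)) \<le> (\<Prod>k\<in>I. C k) * 2 ^ \<alpha> / 2 ^ q ^ (\<delta> + j)"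
    (is "_ \<le> ?B")
proof -
  have C0: "0 \<le> C k" if "k \<in> I" for k using bd[OF that, of 0] nrm_ge_0 order.trans by blast
  have PC0: "0 \<le> (\<Prod>k\<in>I. C k)" by (rule prod_nonneg) (use C0 in auto)
  let ?n = "m + j"
  show ?thesis
    unfolding coeff_partial_L
  proof (rule nrm_sum_le)
    fix d
    consider "d < ?n" | "d = ?n" | "?n < d" by linarith
    then show "nrm (\<Sum>a\<in>monic_polys d. cst (coeff a ?n) * (\<Prod>k\<in>I. l k a) * inverse (emb a ^ \<alpha>)) \<le> ?B"
    proof cases
      case 1
      then have "(\<Sum>a\<in>monic_polys d. cst (coeff a ?n) * (\<Prod>k\<in>I. l k a) * inverse (emb a ^ \<alpha>)) = 0"
        by (intro sum.neutral) (auto simp: monic_polys_def coeff_eq_0)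
      then show ?thesis using PC0 by simp
    next
      case 2
      then have "(\<Sum>a\<in>monic_polys d. cst (coeff a ?n) * (\<Prod>k\<in>I. l k a) * inverse (emb a ^ \<alpha>)) =
          (\<Sum>a\<in>monic_polys d. (\<Prod>k\<in>I. l k a) * inverse (emb a ^ \<alpha>))"
        by (intro sum.cong) (auto simp: monic_polys_def)
      moreover have "card I + ell + (\<delta> + j - \<delta>) * (q - 1) \<le> d * (q - 1)"
        using m_eq s_pos I(2) 2 by (simp add: distrib_right)
      ultimately show ?thesis
        using sum_monic_bound[of I l C "\<delta> + j" d] I lin bd by simp
    next
      case 3
      then obtain i where i: "d = Suc (?n + i)" using less_iff_Suc_add by auto
      \<comment> \<open>the additional form \<open>coeff a n\<close> is indexed by \<open>None\<close>\<close>
      define f where "f = case_option (\<lambda>a. cst (coeff a ?n)) l"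
      define C' where "C' = case_option 1 C"
      let ?T = "insert None (Some ` I)"
      have prods: "(\<Prod>k\<in>?T. f k a) = cst (coeff a ?n) * (\<Prod>k\<in>I. l k a)" for a
        using I(1) by (simp add: f_def prod.reindex)
      have prodC: "(\<Prod>k\<in>?T. C' k) = (\<Prod>k\<in>I. C k)"
        using I(1) by (simp add: C'_def prod.reindex)
      have card: "card ?T = s"
        using I s_pos by (simp add: card_image)
      have "nrm (\<Sum>a\<in>monic_polys d. (\<Prod>k\<in>?T. f k a) * inverse (emb a ^ \<alpha>))
          \<le> (\<Prod>k\<in>?T. C' k) * 2 ^ \<alpha> / 2 ^ q ^ (\<delta> + j + i)"
      proof (rule sum_monic_bound)
        define q' where "q' = q - 1"
        have "1 \<le> q'" using q_ge_2 by (simp add: q'_def)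
        then have "m * q' + 1 + (j + i) * q' \<le> Suc (m + j + i) * q'"
          by (simp add: algebra_simps)
        then have "m * (q - 1) + 1 + (j + i) * (q - 1) \<le> Suc (m + j + i) * (q - 1)"
          unfolding q'_def .
        then show "card ?T + ell + (\<delta> + j + i - \<delta>) * (q - 1) \<le> d * (q - 1)"
          using m_eq by (simp add: card i add_ac)
      qed (use I lin bd nrm_cst lin_coeff in \<open>auto simp: f_def C'_def\<close>)
      also have "\<dots> \<le> ?B"
        unfolding prodC using PC0 q_pos
        by (intro divide_left_mono mult_nonneg_nonneg mult_pos_pos power_increasing) (auto simp: Suc_le_eq)
      finally show ?thesis by (simp add: prods)
    qed
  qed (use PC0 in auto)
qed

lemma poly_map_cst_theta_power: "poly (map_poly cst a) (\<theta> ^ q ^ k) = emb a ^ q ^ k"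
  by (induction a)
    (simp_all add: map_poly_pCons emb_pCons frobenius_power_add power_mult_distrib cst_power_card_power)

text \<open>
  At \<open>t = \<theta>\<^bsup>q^k\<^esup>\<close> the form \<open>a(t)\<close> becomes \<open>a\<^bsup>q^k\<^esup>\<close>, which absorbs the denominator \<open>a\<^sup>\<alpha>\<close>.
\<close>

lemma partial_L_zero:
  assumes I: "finite I" "card I = s - 1" and lin: "\<And>k. k \<in> I \<Longrightarrow> lin (l k)" and k: "\<delta> \<le> k"
  shows "\<exists>D0. \<forall>D\<ge>D0. poly (partial_L l I D) (\<theta> ^ q ^ k) = 0"
proof -
  have ak: "\<alpha> \<le> q ^ k" by (rule alpha_le_power[OF k])
  obtain es where es: "wt q es = q ^ k - \<alpha>" using ex_digits[OF q_ge_2] by blast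
  define f where "f a = (\<Prod>i\<in>I. l i a) * emb a ^ (q ^ k - \<alpha>)" for a
  have "[card I + (q ^ k - \<alpha>) + 1 = 0 + 1] (mod (q - 1))"
    using power_minus_alpha_cong[OF ak] s_pos by (simp add: I(2))
  then have "[card I + (q ^ k - \<alpha>) = 0] (mod (q - 1))"
    by (simp only: cong_add_rcancel_nat)
  then obtain N where N: "card I + (q ^ k - \<alpha>) = (q - 1) * N"
    by (auto simp: cong_0_iff elim: dvdE)
  have inv: "f (smult c a) = f a" if "c \<noteq> 0" for c a
  proof -
    have "(\<Prod>i\<in>I. l i (smult c a)) = cst c ^ card I * (\<Prod>i\<in>I. l i a)"
      by (simp add: lin_smult[OF lin] prod.distrib)
    then have "f (smult c a) = cst c ^ (card I + (q ^ k - \<alpha>)) * f a"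
      by (simp add: f_def emb_smult power_mult_distrib power_add mult_ac)
    also have "cst c ^ (card I + (q ^ k - \<alpha>)) = 1"
      unfolding N power_mult using finite_field_power_card_minus_1[OF that]
      by (simp add: q_def flip: cst_power)
    finally show ?thesis by simp
  qed
  have f0: "f 0 = 0"
  proof (cases "s = 1")
    case True
    then show ?thesis using alpha_less_power[OF True k] by (simp add: f_def zero_power)
  next
    case False
    then have "I \<noteq> {}" using I s_pos by auto
    then obtain i where "i \<in> I" by blast
    then have "(\<Prod>i\<in>I. l i 0) = 0" using I(1) by (intro prod_zero) (auto simp: lin)
    then show ?thesis by (simp add: f_def)
  qed
  have "poly (partial_L l I D) (\<theta> ^ q ^ k) = 0" if D: "card I + length es < D" for D
  proof -
    have "poly (partial_L l I D) (\<theta> ^ q ^ k) = (\<Sum>d<D. \<Sum>a\<in>monic_polys d. f a)"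
      unfolding partial_L_def poly_sum
    proof (intro sum.cong refl)
      fix d a assume "a \<in> (monic_polys d :: 'f poly set)"
      then have "emb a \<noteq> 0" using monic_polys_nz by auto
      moreover have "emb a ^ q ^ k = emb a ^ (q ^ k - \<alpha>) * emb a ^ \<alpha>"
        using ak by (simp flip: power_add)
      ultimately show "poly (smult ((\<Prod>i\<in>I. l i a) * inverse (emb a ^ \<alpha>)) (map_poly cst a)) (\<theta> ^ q ^ k) = f a"
        by (simp add: poly_map_cst_theta_power f_def)
    qed
    also have "\<dots> = - (\<Sum>a\<in>polys_lt D - {0}. f a)"
      using sum_polys_lt_nonzero_eq_monic[of f D] inv of_nat_q by (simp add: q_def)
    also have "(\<Sum>a\<in>polys_lt D - {0}. f a) = (\<Sum>a\<in>polys_lt D. f a)"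
      by (simp add: sum_diff1 f0)
    also have "\<dots> = (\<Sum>a\<in>polys_lt D. (\<Prod>i\<in>I. 0 + l i a) * (0 + emb a) ^ wt q es)"
      by (simp add: f_def es)
    also have "\<dots> = 0"
    proof (rule sum_prod_affine_power_eq_0)
      have "D * 1 \<le> D * (q - 1)" using q_ge_2 by (intro mult_le_mono2) simp
      then show "card I + length es < D * (q - 1)" using D by linarith
    qed (use I lin lin_emb in auto)
    finally show ?thesis by simp
  qed
  then show ?thesis by (intro exI[of _ "Suc (card I + length es)"]) auto
qed

end

section \<open>Division by linear factors\<close>

context C_infinity_card
begin

text \<open>
  The coefficients of the quotient satisfy \<open>h\<^sub>n = c (h\<^sub>n\<^sub>+\<^sub>1 - p\<^sub>n\<^sub>+\<^sub>1)\<close>, and the estimate descends from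
  the degree of \<open>h\<close>.
\<close>

lemma divide_linear_factor:
  fixes p :: "'c poly"
  assumes c: "poly p c = 0" "c \<noteq> 0"
    and p: "\<And>n. n1 \<le> n \<Longrightarrow> nrm c * nrm (coeff p (Suc n)) \<le> B n"
    and B: "\<And>n. n1 \<le> n \<Longrightarrow> nrm c * B (Suc n) \<le> B n" "\<And>n. 0 \<le> B n"
  shows "\<exists>h. p = [:1, - inverse c:] * h \<and> (\<forall>n\<ge>n1. nrm (coeff h n) \<le> B n)"
proof -
  obtain k where "p = [:- c, 1:] * k" using c(1) by (auto simp: poly_eq_0_iff_dvd)
  moreover have "[:1, - inverse c:] * smult (- c) k = smult (- c) [:1, - inverse c:] * k"
    by (simp only: mult_smult_left mult_smult_right)
  ultimately have p_eq: "p = [:1, - inverse c:] * smult (- c) k" using c(2) by simp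
  define h where "h = smult (- c) k"
  have h: "coeff h n = c * (coeff h (Suc n) - coeff p (Suc n))" for n
    using c(2) unfolding p_eq h_def[symmetric] by (simp add: field_simps)
  have "nrm (coeff h n) \<le> B n" if "n1 \<le> n" "degree h < n + j" for n j
    using that
  proof (induction j arbitrary: n)
    case 0
    then show ?case using B(2) by (simp add: coeff_eq_0)
  next
    case (Suc j)
    have "nrm (coeff h (Suc n)) \<le> B (Suc n)" using Suc by auto
    then have "nrm (c * coeff h (Suc n)) \<le> B n"
      unfolding nrm_mult using B(1)[OF Suc.prems(1)]
      by (meson mult_left_mono nrm_ge_0 order.trans)
    moreover have "nrm (c * coeff p (Suc n)) \<le> B n"
      unfolding nrm_mult by (rule p[OF Suc.prems(1)])
    ultimately have "nrm (c * coeff h (Suc n) - c * coeff p (Suc n)) \<le> B n"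
      by (rule nrm_diff_le)
    then show ?case by (subst h) (simp only: right_diff_distrib)
  qed
  from this[of _ "Suc (degree h)"] have "\<forall>n\<ge>n1. nrm (coeff h n) \<le> B n" by auto
  with p_eq show ?thesis unfolding h_def by blast
qed

text \<open>
  Division by the factor with the zero \<open>c\<close> replaces the bound at \<open>n\<close> by \<open>|c|\<close> times the bound at
  \<open>n + 1\<close>.  The loss is \<open>2\<close> to the power \<open>\<Sum> q\<^bsup>\<delta>+i\<^esup>\<close>, \<open>i < J\<close>, which is small compared to the gain
  \<open>q\<^bsup>\<delta>+J+j\<^esup>\<close> in the exponent.
\<close>

lemma divide_linear_factors:
  fixes p :: "'c poly"
  assumes p: "\<And>j. nrm (coeff p (m + j)) \<le> C / 2 ^ q ^ (\<delta> + j)"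
    and z: "\<And>i. i < J \<Longrightarrow> poly p (\<theta> ^ q ^ (\<delta> + i)) = 0"
  shows "\<exists>h. p = (\<Prod>i<J. [:1, - inverse (\<theta> ^ q ^ (\<delta> + i)):]) * h \<and>
    (\<forall>j. nrm (coeff h (m + j)) \<le> C * 2 ^ (\<Sum>i<J. q ^ (\<delta> + i)) / 2 ^ q ^ (\<delta> + J + j))"
  using z
proof (induction J)
  case (Suc J)
  have "0 \<le> C / 2 ^ q ^ (\<delta> + 0)" by (rule order.trans[OF nrm_ge_0 p])
  then have C: "0 \<le> C" by (metis divide_nonpos_pos divide_neg_pos not_le zero_less_numeral zero_less_power)
  obtain h where h: "p = (\<Prod>i<J. [:1, - inverse (\<theta> ^ q ^ (\<delta> + i)):]) * h"
    and hB: "\<And>j. nrm (coeff h (m + j)) \<le> C * 2 ^ (\<Sum>i<J. q ^ (\<delta> + i)) / 2 ^ q ^ (\<delta> + J + j)"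
    using Suc by auto
  define c where "c = \<theta> ^ q ^ (\<delta> + J)"
  have nc: "nrm c = 2 ^ q ^ (\<delta> + J)" by (simp add: c_def nrm_power)
  have "1 - inverse (\<theta> ^ q ^ (\<delta> + i)) * c \<noteq> 0" if "i < J" for i
  proof
    assume "1 - inverse (\<theta> ^ q ^ (\<delta> + i)) * c = 0"
    then have "\<theta> ^ q ^ (\<delta> + i) = c" by (simp add: field_simps)
    then have "(2 :: real) ^ q ^ (\<delta> + i) = 2 ^ q ^ (\<delta> + J)"
      using nc by (metis nrm_power nrm_theta)
    then have "q ^ (\<delta> + i) = q ^ (\<delta> + J)" by simp
    then have "\<delta> + i = \<delta> + J" using q_ge_2 by (intro power_inject_exp[THEN iffD1]) auto
    then show False using that by simp
  qed
  then have "poly h c = 0"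
    using Suc.prems[of J] unfolding h c_def[symmetric] by (simp add: poly_prod mult.commute)
  define S where "S = (\<Sum>i<J. q ^ (\<delta> + i))"
  define B where "B n = C * 2 ^ (S + q ^ (\<delta> + J)) / 2 ^ q ^ (Suc (\<delta> + J + (n - m)))" for n
  have "\<exists>g. h = [:1, - inverse c:] * g \<and> (\<forall>n\<ge>m. nrm (coeff g n) \<le> B n)"
  proof (rule divide_linear_factor)
    fix n assume n: "m \<le> n"
    then have "nrm c * nrm (coeff h (Suc n)) \<le> 2 ^ q ^ (\<delta> + J) * (C * 2 ^ S / 2 ^ q ^ (\<delta> + J + (Suc n - m)))"
      using hB[of "Suc n - m"] by (intro mult_mono) (auto simp: nc S_def)
    also have "\<dots> = B n" using n by (simp add: B_def power_add Suc_diff_le mult_ac)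
    finally show "nrm c * nrm (coeff h (Suc n)) \<le> B n" .
    let ?x = "Suc (\<delta> + J + (n - m))"
    have "q ^ (\<delta> + J) \<le> q ^ ?x" using q_pos by (intro power_increasing) auto
    then have "q ^ (\<delta> + J) + q ^ ?x \<le> 2 * q ^ ?x" by simp
    also have "\<dots> \<le> q ^ Suc ?x" using q_ge_2 by simp
    finally have "(2 :: real) ^ (q ^ (\<delta> + J) + q ^ ?x) \<le> 2 ^ q ^ Suc ?x"
      by (intro power_increasing) auto
    then have "2 ^ q ^ (\<delta> + J) / 2 ^ q ^ Suc ?x \<le> (1 :: real) / 2 ^ q ^ ?x"
      by (simp add: power_add divide_simps)
    then have "(C * 2 ^ (S + q ^ (\<delta> + J))) * (2 ^ q ^ (\<delta> + J) / 2 ^ q ^ Suc ?x) \<le>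
        (C * 2 ^ (S + q ^ (\<delta> + J))) * (1 / 2 ^ q ^ ?x)"
      using C by (intro mult_left_mono) auto
    then show "nrm c * B (Suc n) \<le> B n"
      using n by (simp add: B_def nc Suc_diff_le mult_ac)
  qed (use C \<open>poly h c = 0\<close> in \<open>auto simp: B_def c_def\<close>)
  then obtain g where g: "h = [:1, - inverse c:] * g" "\<And>n. m \<le> n \<Longrightarrow> nrm (coeff g n) \<le> B n"
    by blast
  show ?case
  proof (intro exI conjI allI)
    show "p = (\<Prod>i<Suc J. [:1, - inverse (\<theta> ^ q ^ (\<delta> + i)):]) * g"
      by (subst h) (simp only: prod.lessThan_Suc g(1) c_def mult.assoc)
    show "nrm (coeff g (m + j)) \<le> C * 2 ^ (\<Sum>i<Suc J. q ^ (\<delta> + i)) / 2 ^ q ^ (\<delta> + Suc J + j)" for j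
      using g(2)[of "m + j"] by (simp add: B_def S_def)
  qed
qed (use p in auto)

end

section \<open>Products of univariate series in separate variables\<close>

lemma mfps_coeff_mult_of_fps:
  fixes F :: "'a::comm_ring_1 mfps"
  shows "mfps_coeff (F * mfps_of_fps i f) x =
    (\<Sum>k\<le>Poly_Mapping.lookup x i. mfps_coeff F (x - Poly_Mapping.single i k) * fps_nth f k)"
proof -
  let ?g = "\<lambda>k. (x - Poly_Mapping.single i k, Poly_Mapping.single i k)"
  let ?K = "{..Poly_Mapping.lookup x i}"
  have add: "x - Poly_Mapping.single i k + Poly_Mapping.single i k = x" if "k \<in> ?K" for k
    using that by (intro poly_mapping_eqI) (auto simp: lookup_add lookup_minus lookup_single when_def)
  have inj: "inj_on ?g ?K"
    by (auto simp: inj_on_def dest: arg_cong[where f = "\<lambda>y. Poly_Mapping.lookup y i"])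
  have "mfps_coeff (F * mfps_of_fps i f) x =
      (\<Sum>(y, z)\<in>?g ` ?K. mfps_coeff F y * mfps_coeff (mfps_of_fps i f) z)"
    unfolding mfps_coeff_mult
  proof (rule sum.mono_neutral_right)
    show "?g ` ?K \<subseteq> splittings x" by (auto simp: splittings_def add)
    show "\<forall>p\<in>splittings x - ?g ` ?K. (case p of (y, z) \<Rightarrow> mfps_coeff F y * mfps_coeff (mfps_of_fps i f) z) = 0"
    proof safe
      fix y z assume yz: "(y, z) \<in> splittings x" "(y, z) \<notin> ?g ` ?K"
      have "\<not> Poly_Mapping.keys z \<subseteq> {i}"
      proof
        assume "Poly_Mapping.keys z \<subseteq> {i}"
        then have z: "z = Poly_Mapping.single i (Poly_Mapping.lookup z i)"
          by (intro poly_mapping_eqI) (auto simp: lookup_single when_def in_keys_iff)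
        have "x = y + z" using yz by (simp add: splittings_def)
        then have "Poly_Mapping.lookup z i \<in> ?K" "y = x - z"
          by (simp_all add: lookup_add)
        moreover from this z have "(y, z) = ?g (Poly_Mapping.lookup z i)"
          by (simp only: z[symmetric])
        ultimately have "(y, z) \<in> ?g ` ?K" by (intro image_eqI)
        then show False using yz by simp
      qed
      then show "mfps_coeff F y * mfps_coeff (mfps_of_fps i f) z = 0"
        by (simp add: mfps_of_fps_def)
    qed
  qed simp
  also have "\<dots> = (\<Sum>k\<le>Poly_Mapping.lookup x i. mfps_coeff F (x - Poly_Mapping.single i k) * fps_nth f k)"
    unfolding sum.reindex[OF inj] o_def by (intro sum.cong refl) (simp add: mfps_of_fps_def)
  finally show ?thesis .
qed

lemma mfps_coeff_of_fps:
  "mfps_coeff (mfps_of_fps i f) x =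
    (if Poly_Mapping.keys x \<subseteq> {i} then fps_nth f (Poly_Mapping.lookup x i) else 0)"
  by (simp add: mfps_of_fps_def)

lemma keys_minus_single_subset_iff:
  fixes x :: "'a \<Rightarrow>\<^sub>0 nat"
  assumes "i \<in> I"
  shows "Poly_Mapping.keys (x - Poly_Mapping.single i k) \<subseteq> I \<longleftrightarrow> Poly_Mapping.keys x \<subseteq> I"
proof -
  have "Poly_Mapping.keys (x - Poly_Mapping.single i k) - {i} = Poly_Mapping.keys x - {i}"
    by (auto simp: in_keys_iff lookup_minus lookup_single when_def split: if_splits)
  then show ?thesis using assms by blast
qed

lemma mfps_of_fps_mult:
  "mfps_of_fps i (f * g) = mfps_of_fps i f * mfps_of_fps i (g :: 'a::comm_ring_1 fps)"
proof (rule mfps_eqI)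
  fix x
  show "mfps_coeff (mfps_of_fps i (f * g)) x = mfps_coeff (mfps_of_fps i f * mfps_of_fps i g) x"
  proof (cases "Poly_Mapping.keys x \<subseteq> {i}")
    case True
    have "fps_nth (f * g) n = (\<Sum>k\<le>n. fps_nth f (n - k) * fps_nth g k)" for n
      unfolding mult.commute[of f] fps_mult_nth by (simp add: mult.commute atLeast0AtMost)
    with True show ?thesis
      by (simp add: mfps_coeff_mult_of_fps mfps_coeff_of_fps keys_minus_single_subset_iff lookup_minus)
  qed (simp add: mfps_coeff_mult_of_fps mfps_coeff_of_fps keys_minus_single_subset_iff)
qed

lemma mfps_of_fps_const: "mfps_of_fps i (fps_const c) = mfps_const c"
proof (rule mfps_eqI)
  fix x :: "nat \<Rightarrow>\<^sub>0 nat"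
  have "x = 0" if "Poly_Mapping.keys x \<subseteq> {i}" "Poly_Mapping.lookup x i = 0"
    using that by (intro poly_mapping_eqI) (auto simp: in_keys_iff)
  then show "mfps_coeff (mfps_of_fps i (fps_const c)) x = mfps_coeff (mfps_const c) x"
    by (auto simp: mfps_coeff_of_fps mfps_const_def)
qed

lemma mfps_of_fps_1: "mfps_of_fps i 1 = (1 :: 'a::comm_ring_1 mfps)"
proof -
  have "mfps_of_fps i (fps_const 1) = (1 :: 'a mfps)"
    unfolding mfps_of_fps_const by (rule mfps_eqI) (simp add: mfps_const_def)
  then show ?thesis by simp
qed

lemma mfps_of_fps_X: "mfps_of_fps i fps_X = (mfps_var i :: 'a::comm_ring_1 mfps)"
proof (rule mfps_eqI)
  fix x :: "nat \<Rightarrow>\<^sub>0 nat"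
  have "x = Poly_Mapping.single i 1" if "Poly_Mapping.keys x \<subseteq> {i}" "Poly_Mapping.lookup x i = Suc 0"
    using that by (intro poly_mapping_eqI) (auto simp: in_keys_iff lookup_single when_def)
  then show "mfps_coeff (mfps_of_fps i fps_X) x = mfps_coeff (mfps_var i :: 'a mfps) x"
    by (cases "x = Poly_Mapping.single i 1") (simp_all add: mfps_coeff_of_fps mfps_var_def fps_X_def, blast)
qed

lemma mfps_of_fps_add: "mfps_of_fps i (f + g) = mfps_of_fps i f + mfps_of_fps i (g :: 'a::comm_ring_1 fps)"
  and mfps_of_fps_diff: "mfps_of_fps i (f - g) = mfps_of_fps i f - mfps_of_fps i g"
  by (rule mfps_eqI, simp add: mfps_coeff_of_fps)+

lemma mfps_of_fps_prod:
  "mfps_of_fps i (prod f S) = (\<Prod>x\<in>S. mfps_of_fps i (f x :: 'a::comm_ring_1 fps))"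
  by (induction S rule: infinite_finite_induct) (simp_all add: mfps_of_fps_1 mfps_of_fps_mult)

lemma mfps_coeff_prod_of_fps:
  assumes "finite I"
  shows "mfps_coeff (\<Prod>i\<in>I. mfps_of_fps i (f i :: 'a::comm_ring_1 fps)) x =
    (if Poly_Mapping.keys x \<subseteq> I then \<Prod>i\<in>I. fps_nth (f i) (Poly_Mapping.lookup x i) else 0)"
  using assms
proof (induction I arbitrary: x rule: finite_induct)
  case (insert i I)
  let ?n = "Poly_Mapping.lookup x i"
  have keys: "Poly_Mapping.keys (x - Poly_Mapping.single i k) \<subseteq> I \<longleftrightarrow>
      Poly_Mapping.keys x \<subseteq> insert i I \<and> k = ?n" if "k \<le> ?n" for k
  proof -
    have "i \<in> Poly_Mapping.keys (x - Poly_Mapping.single i k) \<longleftrightarrow> k \<noteq> ?n"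
      using that by (auto simp: in_keys_iff lookup_minus)
    then show ?thesis
      using keys_minus_single_subset_iff[of i "insert i I" x k] insert.hyps by blast
  qed
  have look: "Poly_Mapping.lookup (x - Poly_Mapping.single i k) j = Poly_Mapping.lookup x j"
    if "j \<in> I" for j k
    using that insert.hyps by (auto simp: lookup_minus lookup_single when_def)
  have "mfps_coeff (\<Prod>i\<in>insert i I. mfps_of_fps i (f i)) x =
      (\<Sum>k\<le>?n. mfps_coeff (\<Prod>i\<in>I. mfps_of_fps i (f i)) (x - Poly_Mapping.single i k) * fps_nth (f i) k)"
    using insert.hyps by (simp add: mult.commute[of "mfps_of_fps i (f i)"] mfps_coeff_mult_of_fps)
  also have "\<dots> = (\<Sum>k\<le>?n. if k = ?n then if Poly_Mapping.keys x \<subseteq> insert i I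
      then (\<Prod>j\<in>I. fps_nth (f j) (Poly_Mapping.lookup x j)) * fps_nth (f i) ?n else 0 else 0)"
    by (intro sum.cong refl) (auto simp: insert.IH keys look)
  also have "\<dots> = (if Poly_Mapping.keys x \<subseteq> insert i I
      then \<Prod>j\<in>insert i I. fps_nth (f j) (Poly_Mapping.lookup x j) else 0)"
    using insert.hyps by (simp add: mult.commute)
  finally show ?case .
qed simp

lemma mfps_coeff_mult_const:
  "mfps_coeff (F * mfps_const c) x = mfps_coeff F x * (c :: 'a::comm_ring_1)"
proof -
  have "mfps_coeff (F * mfps_of_fps 0 (fps_const c)) x =
      (\<Sum>k\<le>Poly_Mapping.lookup x 0. if k = 0 then mfps_coeff F x * c else 0)"
    unfolding mfps_coeff_mult_of_fps by (intro sum.cong refl) auto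
  then show ?thesis by (simp add: mfps_of_fps_const)
qed

lemma mfps_coeff_const_mult:
  "mfps_coeff (mfps_const c * F) x = c * mfps_coeff F (x :: nat \<Rightarrow>\<^sub>0 nat)" for c :: "'a::comm_ring_1"
  by (simp add: mult.commute[of "mfps_const c"] mfps_coeff_mult_const mult.commute)

lemma mfps_coeff_sum: "mfps_coeff (sum F S) x = (\<Sum>i\<in>S. mfps_coeff (F i) x)"
  for F :: "'i \<Rightarrow> 'a::comm_ring_1 mfps"
  by (induction S rule: infinite_finite_induct) auto

lemma chi_eq_mfps_of_fps: "chi i a = mfps_of_fps i (fps_of_poly (a :: 'f::field poly))"
proof (induction a)
  case (pCons c a)
  have "chi i (pCons c a) = mfps_const c + mfps_var i * chi i a"
    by (simp add: chi_def map_poly_pCons mfps_const_def zero_mfps_def)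
  also have "\<dots> = mfps_of_fps i (fps_const c + fps_X * fps_of_poly a)"
    by (simp add: pCons mfps_of_fps_add mfps_of_fps_const mfps_of_fps_mult mfps_of_fps_X)
  also have "fps_const c + fps_X * fps_of_poly a = fps_of_poly (pCons c a)"
    by (simp add: fps_of_poly_pCons)
  finally show ?case .
qed (simp add: chi_def mfps_eqI mfps_coeff_of_fps)

section \<open>Completeness of \<open>K\<^sub>\<infinity>\<close>\<close>

lemma fls_dist_le_iff:
  fixes f :: "'f::group_add fls"
  shows "dist f 0 \<le> inverse (2 ^ N) \<longleftrightarrow> (\<forall>k<int N. fls_nth f k = 0)"
proof (cases "f = 0")
  case False
  have "dist f 0 \<le> inverse (2 ^ N) \<longleftrightarrow> int N \<le> fls_subdegree f"
  proof (cases "0 \<le> fls_subdegree f")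
    case True
    then have "dist f 0 = inverse (2 ^ nat (fls_subdegree f))"
      using False by (simp add: dist_fls_def)
    then have "dist f 0 \<le> inverse (2 ^ N) \<longleftrightarrow> (2 :: real) ^ N \<le> 2 ^ nat (fls_subdegree f)"
      by (simp only: inverse_le_iff_le zero_less_power zero_less_numeral)
    also have "\<dots> \<longleftrightarrow> N \<le> nat (fls_subdegree f)" by (rule power_increasing_iff) simp
    finally show ?thesis using True by linarith
  next
    case neg: False
    have "inverse (2 ^ N) \<le> (1 :: real)" by (simp add: inverse_le_1_iff)
    also have "1 < (2 :: real) ^ nat (- fls_subdegree f)"
      using neg by (intro one_less_power) auto
    also have "\<dots> = dist f 0" using neg False by (simp add: dist_fls_def)
    finally show ?thesis using neg by simp
  qed
  also have "\<dots> \<longleftrightarrow> (\<forall>k<int N. fls_nth f k = 0)"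
    using False fls_subdegree_geI[of f "int N"] fls_eq0_below_subdegree[of _ f]
    by (meson order.strict_trans2)
  finally show ?thesis .
qed simp

lemma fls_dist_conv: "dist f g = dist (f - g) (0 :: 'f::group_add fls)"
  by (simp add: dist_fls_def)

text \<open>
  Each coefficient of the partial sums is eventually constant.
\<close>

lemma fls_sums_of_decay:
  fixes f :: "nat \<Rightarrow> 'f::field fls"
  assumes "\<And>d. dist (f d) 0 \<le> inverse (2 ^ d)"
  obtains S where "f sums S"
proof -
  have z: "fls_nth (f d) k = 0" if "k < int d" for d k
    using assms[of d] that by (simp add: fls_dist_le_iff)
  define S where "S = fps_to_fls (Abs_fps (\<lambda>k. \<Sum>d\<le>k. fls_nth (f d) (int k)))"
  have "dist (sum f {..<N}) S \<le> inverse (2 ^ N)" for N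
    unfolding fls_dist_conv[of "sum f {..<N}"] fls_dist_le_iff
  proof safe
    fix k assume k: "k < int N"
    show "fls_nth (sum f {..<N} - S) k = 0"
    proof (cases "0 \<le> k")
      case True
      then have "{..nat k} \<subseteq> {..<N}" using k by auto
      then have "(\<Sum>d<N. fls_nth (f d) k) = (\<Sum>d\<le>nat k. fls_nth (f d) k)"
        by (rule sum.mono_neutral_right[rotated]) (auto intro!: z)
      then show ?thesis using True by (simp add: S_def fls_nth_sum)
    next
      case False
      then have "(\<Sum>d<N. fls_nth (f d) k) = 0" by (intro sum.neutral) (auto intro!: z)
      then show ?thesis using False by (simp add: S_def fls_nth_sum)
    qed
  qed
  note le = this
  have lim: "(\<lambda>N. inverse (2 ^ N) :: real) \<longlonglongrightarrow> 0"
    by (rule LIMSEQ_inverse_realpow_zero) simp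
  have "(\<lambda>N. dist (sum f {..<N}) S) \<longlonglongrightarrow> 0"
    by (rule tendsto_sandwich[OF _ _ tendsto_const lim]) (simp_all add: le)
  then have "(\<lambda>N. sum f {..<N}) \<longlonglongrightarrow> S" by (subst tendsto_dist_iff)
  with that show ?thesis by (simp add: sums_def)
qed

section \<open>The function \<open>\<omega>\<close>\<close>

locale V_setting = L_setting \<iota> q \<alpha> s
  for \<iota> :: "'f::{field, finite} fls \<Rightarrow> 'c::{field, complete_space}" and q \<alpha> s :: nat +
  fixes r :: 'c
  assumes r_power: "r ^ (q - 1) = - \<theta>"
begin

lemma r_nz [simp]: "r \<noteq> 0"
  using r_power q_ge_2 by (metis neg_equal_0_iff_equal theta_nz zero_power zero_less_diff less_le_trans one_less_numeral_iff semiring_norm(76))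

definition lin_factor :: "nat \<Rightarrow> 'c fps" where
  "lin_factor i = 1 - fps_const (inverse (\<theta> ^ q ^ i)) * fps_X"

text \<open>
  The partial products of \<open>\<omega>\<close>; the bounds and the limits of their coefficients come from the
  recursion \<open>om_Suc_nth_Suc\<close>.
\<close>

definition om :: "nat \<Rightarrow> 'c fps" where
  "om N = fps_const r * (\<Prod>i<N. inverse (lin_factor i))"

lemma lin_factor_inverse [simp]:
  "lin_factor i * inverse (lin_factor i) = 1" "inverse (lin_factor i) * lin_factor i = 1"
  by (simp_all add: lin_factor_def inverse_mult_eq_1 inverse_mult_eq_1')

lemma om_0 [simp]: "om 0 = fps_const r"
  by (simp add: om_def)

lemma om_step: "om (Suc N) * lin_factor N = om N"
  by (simp add: om_def mult.assoc)

lemma om_Suc_nth_0: "fps_nth (om (Suc N)) 0 = fps_nth (om N) 0"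
  using arg_cong[OF om_step[of N], of "\<lambda>f. fps_nth f 0"] by (simp add: lin_factor_def)

lemma om_Suc_nth_Suc:
  "fps_nth (om (Suc N)) (Suc n) =
    fps_nth (om N) (Suc n) + inverse (\<theta> ^ q ^ N) * fps_nth (om (Suc N)) n"
proof -
  have "om (Suc N) * lin_factor N =
      om (Suc N) - fps_const (inverse (\<theta> ^ q ^ N)) * (fps_X * om (Suc N))"
    by (simp add: lin_factor_def algebra_simps)
  then show ?thesis
    using arg_cong[OF om_step[of N], of "\<lambda>f. fps_nth f (Suc n)"] by (simp add: diff_eq_eq)
qed

lemma om_nth_0: "fps_nth (om N) 0 = r"
  by (induction N) (simp_all add: om_Suc_nth_0)

lemma nrm_inverse_theta_power: "nrm (inverse (\<theta> ^ k)) = 1 / 2 ^ k"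
  by (simp add: nrm_inverse nrm_power divide_inverse)

lemma nrm_om_le: "nrm (fps_nth (om N) n) \<le> nrm r / 2 ^ n"
proof (induction N arbitrary: n)
  case (Suc N)
  show ?case
  proof (induction n)
    case (Suc n)
    have "nrm (inverse (\<theta> ^ q ^ N)) \<le> 1 / 2"
    proof -
      have "(2 :: real) ^ 1 \<le> 2 ^ q ^ N" by (intro power_increasing) auto
      then show ?thesis unfolding nrm_inverse_theta_power by (simp add: field_simps)
    qed
    then have "nrm (inverse (\<theta> ^ q ^ N)) * nrm (fps_nth (om (Suc N)) n) \<le> 1 / 2 * (nrm r / 2 ^ n)"
      using Suc.IH by (intro mult_mono) auto
    then have "nrm (inverse (\<theta> ^ q ^ N) * fps_nth (om (Suc N)) n) \<le> nrm r / 2 ^ Suc n"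
      by (simp add: nrm_mult)
    with \<open>nrm (fps_nth (om N) (Suc n)) \<le> nrm r / 2 ^ Suc n\<close> show ?case
      unfolding om_Suc_nth_Suc by (rule nrm_add_le)
  qed (simp add: om_nth_0)
qed (simp add: fps_const_def)

lemma power_le_self: "N \<le> q ^ N"
proof -
  have "N \<le> 2 ^ N" by (rule less_imp_le[OF less_exp])
  also have "\<dots> \<le> q ^ N" using q_ge_2 by (intro power_mono) auto
  finally show ?thesis .
qed

lemma tendsto_inverse_theta_power: "(\<lambda>N. inverse (\<theta> ^ q ^ N)) \<longlonglongrightarrow> 0"
proof (rule tendsto_0_nrm_le)
  show "nrm (inverse (\<theta> ^ q ^ N)) \<le> (1 / 2) ^ N" for N
    unfolding nrm_inverse_theta_power power_one_over[symmetric]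
    by (rule power_decreasing) (auto simp: power_le_self)
  show "(\<lambda>N. (1 / 2) ^ N :: real) \<longlonglongrightarrow> 0" by (rule LIMSEQ_realpow_zero) auto
qed

lemma om_convergent: "\<exists>L. (\<lambda>N. fps_nth (om N) n) \<longlonglongrightarrow> L"
proof (cases n)
  case 0
  then show ?thesis by (auto simp: om_nth_0)
next
  case (Suc k)
  have "(\<lambda>N. fps_nth (om (Suc N)) (Suc k) - fps_nth (om N) (Suc k)) \<longlonglongrightarrow> 0"
  proof (rule tendsto_0_nrm_le)
    show "nrm (fps_nth (om (Suc N)) (Suc k) - fps_nth (om N) (Suc k)) \<le>
        nrm (inverse (\<theta> ^ q ^ N)) * nrm r" for N
    proof -
      have "nrm r / 2 ^ k \<le> nrm r / 1" by (intro divide_left_mono) auto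
      then have "nrm r / 2 ^ k \<le> nrm r" by simp
      then have "nrm (fps_nth (om (Suc N)) k) \<le> nrm r" using nrm_om_le order.trans by blast
      then show ?thesis by (simp add: om_Suc_nth_Suc nrm_mult mult_left_mono)
    qed
    show "(\<lambda>N. nrm (inverse (\<theta> ^ q ^ N)) * nrm r) \<longlonglongrightarrow> 0"
      using tendsto_inverse_theta_power unfolding tendsto_nrm_0_iff by (rule tendsto_mult_left_zero)
  qed
  then obtain L where "(\<lambda>N. fps_nth (om N) (Suc k)) \<longlonglongrightarrow> L" by (rule convergent_of_steps)
  then show ?thesis unfolding Suc by blast
qed

abbreviation omg :: "'c fps" where "omg \<equiv> omega \<iota> r"

lemma om_tendsto: "(\<lambda>N. fps_nth (om N) n) \<longlonglongrightarrow> fps_nth omg n"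
proof -
  obtain L where L: "(\<lambda>N. fps_nth (om N) n) \<longlonglongrightarrow> L" using om_convergent by blast
  have "om = (\<lambda>N. fps_const r *
      (\<Prod>i<N. inverse (1 - fps_const (inverse (\<theta> ^ (CARD('f) ^ i))) * fps_X)))"
    by (simp add: fun_eq_iff om_def lin_factor_def flip: q_def)
  then have "fps_nth omg n = lim (\<lambda>N. fps_nth (om N) n)"
    by (simp add: omega_def)
  with L show ?thesis by (simp add: limI)
qed

definition P\<^sub>\<delta> :: "'c fps" where "P\<^sub>\<delta> = (\<Prod>j<\<delta>. lin_factor j)"

text \<open>
  Multiplication by \<open>P\<^sub>\<delta>\<close> cancels the first \<open>\<delta>\<close> factors of the product \<open>\<omega>\<close>; the zeros found in
  \<open>partial_L_zero\<close> account for the others.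
\<close>

definition Om :: "'c fps" where "Om = omg * P\<^sub>\<delta>"

definition Om_partial :: "nat \<Rightarrow> 'c fps" where
  "Om_partial J = fps_const r * (\<Prod>i<J. inverse (lin_factor (\<delta> + i)))"

lemma om_times_P: "om (\<delta> + J) * P\<^sub>\<delta> = Om_partial J"
proof (induction J)
  case 0
  have "om \<delta> * P\<^sub>\<delta> = fps_const r * (\<Prod>i<\<delta>. inverse (lin_factor i) * lin_factor i)"
    by (simp only: om_def P\<^sub>\<delta>_def prod.distrib mult.assoc)
  then show ?case by (simp add: Om_partial_def)
next
  case (Suc J)
  have "om (\<delta> + Suc J) * P\<^sub>\<delta> = om (\<delta> + J) * P\<^sub>\<delta> * inverse (lin_factor (\<delta> + J))"
    by (simp add: om_def mult_ac)
  then show ?case by (simp add: Suc) (simp add: Om_partial_def mult_ac)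
qed

lemma fps_mult_nth_tendsto:
  assumes "\<And>n. (\<lambda>N. fps_nth (F N) n) \<longlonglongrightarrow> (fps_nth f n :: 'c)"
  shows "(\<lambda>N. fps_nth (F N * g) n) \<longlonglongrightarrow> fps_nth (f * g) n"
  unfolding fps_mult_nth by (intro tendsto_c_sum tendsto_c_mult assms tendsto_const)

lemma Om_partial_tendsto: "(\<lambda>J. fps_nth (Om_partial J) n) \<longlonglongrightarrow> fps_nth Om n"
proof -
  have "(\<lambda>N. fps_nth (om N * P\<^sub>\<delta>) n) \<longlonglongrightarrow> fps_nth Om n"
    unfolding Om_def by (intro fps_mult_nth_tendsto om_tendsto)
  from LIMSEQ_ignore_initial_segment[OF this, of \<delta>] show ?thesis
    by (simp add: om_times_P add.commute[of _ \<delta>])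
qed

section \<open>Vanishing of the high coefficients\<close>

text \<open>
  The vanishing argument needs \<open>(q - 1)q\<^bsup>n-m\<^esup> \<ge> 2\<close>.
\<close>

definition deg_bound :: nat where "deg_bound = (if q = 2 then Suc m else m)"

lemma two_times_geometric_le:
  assumes "q = 2 \<longrightarrow> 1 \<le> j"
  shows "2 * (\<Sum>i<J. q ^ i) \<le> q ^ (J + j)"
proof -
  obtain p where p: "q = Suc p" using q_pos by (cases q) auto
  have "p * (\<Sum>i<J. q ^ i) + 1 = q ^ J"
    by (induction J) (simp_all add: p algebra_simps)
  then have eq: "(q - 1) * (\<Sum>i<J. q ^ i) = q ^ J - 1" using p by (metis add_diff_cancel_right' diff_Suc_1)
  show ?thesis
  proof (cases "q = 2")
    case True
    then have "2 * (\<Sum>i<J. q ^ i) \<le> q * q ^ J" using eq by simp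
    also have "\<dots> = q ^ (J + 1)" by simp
    also have "\<dots> \<le> q ^ (J + j)" using assms True by (intro power_increasing) auto
    finally show ?thesis .
  next
    case False
    then have "2 * (\<Sum>i<J. q ^ i) \<le> (q - 1) * (\<Sum>i<J. q ^ i)"
      using q_ge_2 by (intro mult_le_mono1) auto
    also have "\<dots> \<le> q ^ J" by (subst eq) simp
    also have "\<dots> \<le> q ^ (J + j)" by (intro power_increasing) auto
    finally show ?thesis .
  qed
qed

text \<open>
  The comparison of gain and loss after \<open>J\<close> divisions: the exponent \<open>\<Sum> q\<^bsup>\<delta>+i\<^esup>\<close> is at most half of
  \<open>q\<^bsup>\<delta>+J+j\<^esup>\<close>.
\<close>

lemma geometric_decay:
  assumes "q = 2 \<longrightarrow> 1 \<le> j"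
  shows "2 ^ (\<Sum>i<J. q ^ (\<delta> + i)) / 2 ^ q ^ (\<delta> + J + j) \<le> (1 / 2 :: real) ^ J"
proof -
  have S: "(\<Sum>i<J. q ^ (\<delta> + i)) = q ^ \<delta> * (\<Sum>i<J. q ^ i)"
    by (simp add: power_add sum_distrib_left)
  have "J = (\<Sum>i<J. 1)" by simp
  also have "\<dots> \<le> (\<Sum>i<J. q ^ (\<delta> + i))" by (rule sum_mono) (simp add: Suc_le_eq)
  finally have "(\<Sum>i<J. q ^ (\<delta> + i)) + J \<le> 2 * (\<Sum>i<J. q ^ (\<delta> + i))" by simp
  also have "\<dots> \<le> q ^ \<delta> * q ^ (J + j)"
    unfolding S mult.left_commute[of 2] by (intro mult_le_mono2 two_times_geometric_le assms)
  also have "\<dots> = q ^ (\<delta> + J + j)" by (simp add: power_add)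
  finally have "(2 :: real) ^ ((\<Sum>i<J. q ^ (\<delta> + i)) + J) \<le> 2 ^ q ^ (\<delta> + J + j)"
    by (intro power_increasing) auto
  then show ?thesis by (simp add: power_add divide_simps)
qed

text \<open>
  After multiplication by \<open>J\<close> factors of \<open>\<Omega>\<close> the coefficient is bounded by a constant times
  \<open>2\<^bsup>-J\<^esup>\<close> for all large \<open>D\<close>, since by then the \<open>J\<close> zeros are present.  The remaining factors of \<open>\<Omega>\<close>
  change it by an amount that is small uniformly in \<open>D\<close>.
\<close>

lemma partial_L_times_Om_tendsto_0:
  assumes I: "finite I" "card I = s - 1" and lin: "\<And>k. k \<in> I \<Longrightarrow> lin (l k)"
    and bd: "\<And>k a. k \<in> I \<Longrightarrow> nrm (l k a) \<le> C k"
    and n: "deg_bound \<le> n"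
  shows "(\<lambda>D. fps_nth (fps_of_poly (partial_L l I D) * Om) n) \<longlonglongrightarrow> 0"
proof -
  define B where "B = (\<Prod>k\<in>I. C k)"
  have "0 \<le> nrm (l k 0)" for k by simp
  then have "0 \<le> C k" if "k \<in> I" for k using bd[OF that, of 0] order.trans by blast
  then have B0: "0 \<le> B" unfolding B_def by (intro prod_nonneg) auto
  define j where "j = n - m"
  have j: "n = m + j" "q = 2 \<longrightarrow> 1 \<le> j"
    using n by (auto simp: deg_bound_def j_def split: if_splits)
  have small: "\<exists>D0. \<forall>D\<ge>D0. nrm (fps_nth (fps_of_poly (partial_L l I D) * Om_partial J) n)
      \<le> nrm r * (B * 2 ^ \<alpha>) * (1 / 2) ^ J" for J
  proof -
    have "\<forall>i<J. \<exists>D0. \<forall>D\<ge>D0. poly (partial_L l I D) (\<theta> ^ q ^ (\<delta> + i)) = 0"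
      using partial_L_zero[OF I lin] by simp
    then obtain D0 where D0: "\<And>i D. i < J \<Longrightarrow> D0 i \<le> D \<Longrightarrow> poly (partial_L l I D) (\<theta> ^ q ^ (\<delta> + i)) = 0"
      by metis
    have "nrm (fps_nth (fps_of_poly (partial_L l I D) * Om_partial J) n)
      \<le> nrm r * (B * 2 ^ \<alpha>) * (1 / 2) ^ J" if D: "sum D0 {..<J} \<le> D" for D
    proof -
      have "D0 i \<le> D" if "i < J" for i
        using member_le_sum[of i "{..<J}" D0] that D by simp
      then have z: "poly (partial_L l I D) (\<theta> ^ q ^ (\<delta> + i)) = 0" if "i < J" for i
        using D0 that by blast
      have dec: "nrm (coeff (partial_L l I D) (m + j)) \<le> B * 2 ^ \<alpha> / 2 ^ q ^ (\<delta> + j)" for j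
        unfolding B_def by (rule nrm_coeff_partial_L_decay[OF I lin bd])
      obtain h where h: "partial_L l I D = (\<Prod>i<J. [:1, - inverse (\<theta> ^ q ^ (\<delta> + i)):]) * h"
        and hB: "\<forall>j. nrm (coeff h (m + j)) \<le> B * 2 ^ \<alpha> * 2 ^ (\<Sum>i<J. q ^ (\<delta> + i)) / 2 ^ q ^ (\<delta> + J + j)"
        using divide_linear_factors[where J = J, OF dec z, simplified] by (elim exE conjE) simp
      have lf: "fps_of_poly [:1, - inverse (\<theta> ^ q ^ i):] = lin_factor i" for i
        by (simp add: lin_factor_def fps_of_poly_pCons mult.commute flip: fps_const_neg)
      have "fps_of_poly (partial_L l I D) * Om_partial J =
          fps_const r * ((\<Prod>i<J. lin_factor (\<delta> + i) * inverse (lin_factor (\<delta> + i))) * fps_of_poly h)"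
        unfolding h by (simp only: fps_of_poly_mult fps_of_poly_prod lf Om_partial_def prod.distrib mult_ac)
      then have "nrm (fps_nth (fps_of_poly (partial_L l I D) * Om_partial J) n) = nrm r * nrm (coeff h n)"
        by (simp add: nrm_mult)
      also have "\<dots> \<le> nrm r * (B * 2 ^ \<alpha> * (2 ^ (\<Sum>i<J. q ^ (\<delta> + i)) / 2 ^ q ^ (\<delta> + J + j)))"
        using hB[rule_format, of j] by (intro mult_left_mono) (simp_all add: j)
      also have "\<dots> \<le> nrm r * (B * 2 ^ \<alpha> * (1 / 2) ^ J)"
        using geometric_decay[OF j(2)] B0 by (intro mult_left_mono) auto
      finally show ?thesis by (simp add: mult_ac)
    qed
    then show ?thesis by blast
  qed
  show ?thesis
    unfolding tendsto_nrm_0_iff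
  proof (rule LIMSEQ_I)
    fix e :: real assume e: "0 < e"
    have "(\<lambda>J. nrm r * (B * 2 ^ \<alpha>) * (1 / 2) ^ J) \<longlonglongrightarrow> 0"
      by (intro tendsto_mult_right_zero LIMSEQ_realpow_zero) auto
    then have ev1: "\<forall>\<^sub>F J in sequentially. nrm r * (B * 2 ^ \<alpha>) * (1 / 2) ^ J < e"
      using e by (intro order_tendstoD) auto
    \<comment> \<open>the \<open>1\<close> allows for \<open>B = 0\<close>\<close>
  define e' where "e' = e / (B + 1)"
    have e': "0 < e'" "B * e' < e" using e B0 by (auto simp: e'_def field_simps)
    have ev2: "\<forall>\<^sub>F J in sequentially. \<forall>k\<in>{..n}. nrm (fps_nth (Om_partial J) k - fps_nth Om k) < e'"
      by (intro eventually_ball_finite ballI finite_atMost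
          order_tendstoD(2)[OF Om_partial_tendsto[unfolded tendsto_iff_nrm] e'(1)])
    obtain J where J: "nrm r * (B * 2 ^ \<alpha>) * (1 / 2) ^ J < e"
      "\<And>k. k \<le> n \<Longrightarrow> nrm (fps_nth (Om_partial J) k - fps_nth Om k) < e'"
      using eventually_happens[OF eventually_conj[OF ev1 ev2]] by auto
    obtain D0 where D0: "\<And>D. D0 \<le> D \<Longrightarrow> nrm (fps_nth (fps_of_poly (partial_L l I D) * Om_partial J) n)
      \<le> nrm r * (B * 2 ^ \<alpha>) * (1 / 2) ^ J" using small[of J] by blast
    have "nrm (fps_nth (fps_of_poly (partial_L l I D) * Om) n) < e" if D: "D0 \<le> D" for D
    proof -
      let ?F = "fps_of_poly (partial_L l I D)"
      define b where "b = max (nrm r * (B * 2 ^ \<alpha>) * (1 / 2) ^ J) (B * e')"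
      have "nrm (fps_nth (?F * (Om_partial J - Om)) n) \<le> B * e'"
        unfolding fps_mult_nth
      proof (rule nrm_sum_le)
        fix k assume "k \<in> {0..n}"
        then have "nrm (fps_nth (Om_partial J - Om) (n - k)) \<le> e'"
          using J(2)[of "n - k"] by simp
        moreover have "nrm (fps_nth ?F k) \<le> B"
          using nrm_coeff_partial_L_le[OF bd] by (simp add: B_def)
        ultimately show "nrm (fps_nth ?F k * fps_nth (Om_partial J - Om) (n - k)) \<le> B * e'"
          unfolding nrm_mult using B0 by (intro mult_mono) auto
      qed (use B0 e' in auto)
      then have "nrm (fps_nth (?F * Om_partial J) n - fps_nth (?F * (Om_partial J - Om)) n) \<le> b"
        using D0[OF D] by (intro nrm_diff_le) (auto simp: b_def)
      also have "fps_nth (?F * Om_partial J) n - fps_nth (?F * (Om_partial J - Om)) n = fps_nth (?F * Om) n"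
        by (simp add: right_diff_distrib)
      finally show ?thesis using J(1) e'(2) by (simp add: b_def)
    qed
    then show "\<exists>no. \<forall>D\<ge>no. norm (nrm (fps_nth (fps_of_poly (partial_L l I D) * Om) n) - 0) < e"
      by auto
  qed
qed

section \<open>The coefficients of \<open>V\<close>\<close>

definition wform :: "nat \<Rightarrow> 'f poly \<Rightarrow> 'c" where
  "wform n a = fps_nth (fps_of_poly (map_poly cst a) * Om) n"

lemma wform_eq: "wform n a = (\<Sum>i=0..n. fps_nth Om (n - i) * cst (coeff a i))"
  by (simp add: wform_def fps_mult_nth coeff_map_poly mult.commute)

lemma lin_wform: "lin (wform n)"
proof -
  have "wform n = (\<lambda>a. \<Sum>i=0..n. fps_nth Om (n - i) * cst (coeff a i))"
    by (rule ext) (rule wform_eq)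
  then show ?thesis using lin_combination[of "{0..n}" "\<lambda>i a. cst (coeff a i)"] lin_coeff by simp
qed

lemma wform_bounded: "\<exists>B. \<forall>a. nrm (wform n a) \<le> B"
proof (intro exI allI)
  fix a :: "'f poly"
  show "nrm (wform n a) \<le> (\<Sum>i=0..n. nrm (fps_nth Om (n - i)))"
    unfolding wform_eq
  proof (rule nrm_sum_le)
    fix i assume i: "i \<in> {0..n}"
    have "nrm (fps_nth Om (n - i) * cst (coeff a i)) \<le> nrm (fps_nth Om (n - i)) * 1"
      unfolding nrm_mult using nrm_cst by (intro mult_left_mono) auto
    also have "\<dots> \<le> (\<Sum>i=0..n. nrm (fps_nth Om (n - i)))"
      using member_le_sum[of i "{0..n}" "\<lambda>i. nrm (fps_nth Om (n - i))"] i by simp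
    finally show "nrm (fps_nth Om (n - i) * cst (coeff a i)) \<le> (\<Sum>i=0..n. nrm (fps_nth Om (n - i)))" .
  qed (simp add: sum_nonneg)
qed

definition V_sum :: "(nat \<Rightarrow>\<^sub>0 nat) \<Rightarrow> nat \<Rightarrow> 'c" where
  "V_sum x D = (\<Sum>d<D. \<Sum>a\<in>monic_polys d.
     inverse (emb a ^ \<alpha>) * (\<Prod>i=1..s. wform (Poly_Mapping.lookup x i) a))"

abbreviation per :: 'c where "per \<equiv> pi_tilde \<iota> r"

lemma L_series_coeff_tendsto:
  "(\<lambda>D. \<Sum>d<D. \<Sum>a\<in>monic_polys d. inverse (emb a ^ \<alpha>) *
      mfps_coeff (\<Prod>i=1..s. mfps_of_fps i (fps_of_poly (map_poly cst a))) x)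
    \<longlonglongrightarrow> \<iota> (mfps_coeff (L_series s \<alpha>) x)"
proof -
  define c where "c a = (if Poly_Mapping.keys x \<subseteq> {1..s}
    then \<Prod>i=1..s. coeff a (Poly_Mapping.lookup x i) else 0)" for a :: "'f poly"
  define f where "f d = (\<Sum>a\<in>monic_polys d. fls_const (c a) * inverse (A_to_Kinf a ^ \<alpha>))" for d
  have chi: "mfps_coeff (map_mfps fls_const (\<Prod>i=1..s. chi i a)) x = fls_const (c a)" for a :: "'f poly"
    by (simp add: map_mfps_def chi_eq_mfps_of_fps mfps_coeff_prod_of_fps c_def)
  have Lf: "mfps_coeff (L_series s \<alpha>) x = suminf f"
    by (simp add: L_series_def mfps_coeff_sum mfps_coeff_mult_const chi del: One_nat_def flip: f_def)
  have \<iota>f: "\<iota> (f d) = (\<Sum>a\<in>monic_polys d. cst (c a) * inverse (emb a ^ \<alpha>))" for d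
    by (simp add: f_def hom_sum hom_mult hom_inverse hom_power cst_def emb_def)
  have "dist (f d) 0 \<le> inverse (2 ^ d)" for d
  proof -
    have "nrm (\<iota> (f d)) \<le> inverse (2 ^ d)"
      unfolding \<iota>f
    proof (rule nrm_sum_le)
      fix a assume a: "a \<in> (monic_polys d :: 'f poly set)"
      have "nrm (inverse (emb a ^ \<alpha>)) = inverse ((2 ^ d) ^ \<alpha>)"
        using a monic_polys_nz[OF a] by (simp add: nrm_inverse nrm_power nrm_emb monic_polys_def)
      also have "\<dots> \<le> inverse ((2 ^ d) ^ 1)"
        using alpha_pos by (intro le_imp_inverse_le power_increasing) auto
      finally have "nrm (cst (c a)) * nrm (inverse (emb a ^ \<alpha>)) \<le> 1 * inverse (2 ^ d)"
        using nrm_cst by (intro mult_mono) auto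
      then show "nrm (cst (c a) * inverse (emb a ^ \<alpha>)) \<le> inverse (2 ^ d)" by (simp add: nrm_mult)
    qed simp
    then show ?thesis by (simp add: nrm_hom)
  qed
  then obtain S where S: "f sums S" by (rule fls_sums_of_decay)
  then have "suminf f = S" by (rule sums_unique[symmetric])
  moreover have "(\<lambda>D. \<iota> (sum f {..<D})) \<longlonglongrightarrow> \<iota> S"
    using S unfolding sums_def by (subst tendsto_dist_iff) (simp add: isometry flip: tendsto_dist_iff)
  moreover have "cst (c a) = mfps_coeff (\<Prod>i=1..s. mfps_of_fps i (fps_of_poly (map_poly cst a))) x"
    for a :: "'f poly"
  proof -
    have "cst (\<Prod>i\<in>T. g i) = (\<Prod>i\<in>T. cst (g i))" for T :: "nat set" and g
      by (induction T rule: infinite_finite_induct) (simp_all add: cst_mult)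
    then show ?thesis by (simp add: mfps_coeff_prod_of_fps c_def coeff_map_poly)
  qed
  ultimately show ?thesis
    by (simp add: Lf hom_sum \<iota>f mult.commute)
qed

lemma V_series_eq:
  "V_series \<iota> r \<alpha> s = mfps_const (inverse (per ^ \<alpha>)) *
    (map_mfps \<iota> (L_series s \<alpha>) * (\<Prod>i=1..s. mfps_of_fps i Om))"
proof -
  have "1 - mfps_const (inverse (\<theta> ^ q ^ j)) * mfps_var i = mfps_of_fps i (lin_factor j)" for i j
    by (simp add: lin_factor_def mfps_of_fps_diff mfps_of_fps_1 mfps_of_fps_mult
        mfps_of_fps_const mfps_of_fps_X)
  then show ?thesis
    by (simp add: V_series_def Om_def P\<^sub>\<delta>_def mfps_of_fps_mult mfps_of_fps_prod prod.distrib
        mult.assoc \<delta>_def flip: q_def)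
qed

text \<open>
  The product of \<open>\<chi>\<^sub>t(a)\<close> over the variables and the product of the \<open>\<Omega>(t\<^sub>i)\<close> are multiplied variable by
  variable before the coefficient is taken; the limit over \<open>D\<close> commutes with the finite sum that
  defines a coefficient of a product.
\<close>

lemma V_coeff_tendsto:
  "(\<lambda>D. inverse (per ^ \<alpha>) * (if Poly_Mapping.keys x \<subseteq> {1..s} then V_sum x D else 0))
    \<longlonglongrightarrow> mfps_coeff (V_series \<iota> r \<alpha> s) x"
proof -
  let ?G = "\<Prod>i=1..s. mfps_of_fps i Om"
  define LD where "LD D = (\<Sum>d<D. \<Sum>a\<in>monic_polys d. mfps_const (inverse (emb a ^ \<alpha>)) *
      (\<Prod>i=1..s. mfps_of_fps i (fps_of_poly (map_poly cst a))))" for D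
  have "LD D * ?G = (\<Sum>d<D. \<Sum>a\<in>monic_polys d. mfps_const (inverse (emb a ^ \<alpha>)) *
      (\<Prod>i=1..s. mfps_of_fps i (fps_of_poly (map_poly cst a) * Om)))" for D
    by (simp only: LD_def sum_distrib_right mfps_of_fps_mult prod.distrib mult.assoc)
  then have "mfps_coeff (LD D * ?G) x = (if Poly_Mapping.keys x \<subseteq> {1..s} then V_sum x D else 0)" for D
    by (simp add: mfps_coeff_sum mfps_coeff_const_mult mfps_coeff_prod_of_fps V_sum_def wform_def)
  moreover have "(\<lambda>D. mfps_coeff (LD D * ?G) x) \<longlonglongrightarrow> mfps_coeff (map_mfps \<iota> (L_series s \<alpha>) * ?G) x"
    unfolding mfps_coeff_mult case_prod_unfold
  proof (intro tendsto_c_sum tendsto_c_mult tendsto_const)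
    fix z assume "z \<in> splittings x"
    show "(\<lambda>D. mfps_coeff (LD D) (fst z)) \<longlonglongrightarrow> mfps_coeff (map_mfps \<iota> (L_series s \<alpha>)) (fst z)"
      using L_series_coeff_tendsto[of "fst z"]
      by (simp add: LD_def mfps_coeff_sum mfps_coeff_const_mult map_mfps_def)
  qed
  ultimately show ?thesis
    unfolding V_series_eq mfps_coeff_const_mult
    by (intro tendsto_c_mult tendsto_const) simp
qed

lemma V_coeff_eq_0_keys:
  assumes "\<not> Poly_Mapping.keys x \<subseteq> {1..s}"
  shows "mfps_coeff (V_series \<iota> r \<alpha> s) x = 0"
  using LIMSEQ_unique[OF V_coeff_tendsto[of x]] assms by simp

lemma V_coeff_eq_0_degree:
  assumes i: "i \<in> {1..s}" "deg_bound \<le> Poly_Mapping.lookup x i"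
  shows "mfps_coeff (V_series \<iota> r \<alpha> s) x = 0"
proof -
  let ?n = "Poly_Mapping.lookup x"
  define I where "I = {1..s} - {i}"
  have I: "finite I" "card I = s - 1" using i by (simp_all add: I_def)
  obtain B where B: "\<And>n a. nrm (wform n a) \<le> B n" using wform_bounded by metis
  have "V_sum x = (\<lambda>D. fps_nth (fps_of_poly (partial_L (\<lambda>k. wform (?n k)) I D) * Om) (?n i))"
  proof (rule ext)
    fix D
    have "(\<Prod>k=1..s. wform (?n k) a) = wform (?n i) a * (\<Prod>k\<in>I. wform (?n k) a)" for a
      unfolding I_def using i by (intro prod.remove) auto
    then have "V_sum x D = (\<Sum>d<D. \<Sum>a\<in>monic_polys d.
        (\<Prod>k\<in>I. wform (?n k) a) * inverse (emb a ^ \<alpha>) * wform (?n i) a)"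
      unfolding V_sum_def by (simp add: mult_ac)
    also have "\<dots> = (\<Sum>d<D. \<Sum>a\<in>monic_polys d. fps_nth
        (fps_const ((\<Prod>k\<in>I. wform (?n k) a) * inverse (emb a ^ \<alpha>)) *
          (fps_of_poly (map_poly cst a) * Om)) (?n i))"
      unfolding wform_def[of "?n i"] fps_mult_left_const_nth ..
    also have "\<dots> = fps_nth (fps_of_poly (partial_L (\<lambda>k. wform (?n k)) I D) * Om) (?n i)"
      unfolding partial_L_def fps_of_poly_sum fps_of_poly_smult sum_distrib_right fps_sum_nth mult.assoc ..
    finally show "V_sum x D = fps_nth (fps_of_poly (partial_L (\<lambda>k. wform (?n k)) I D) * Om) (?n i)" .
  qed
  moreover have "(\<lambda>D. fps_nth (fps_of_poly (partial_L (\<lambda>k. wform (?n k)) I D) * Om) (?n i)) \<longlonglongrightarrow> 0"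
    by (rule partial_L_times_Om_tendsto_0[OF I]) (auto intro: B lin_wform i)
  ultimately have "V_sum x \<longlonglongrightarrow> 0" by simp
  then have "(\<lambda>D. inverse (per ^ \<alpha>) * (if Poly_Mapping.keys x \<subseteq> {1..s} then V_sum x D else 0))
      \<longlonglongrightarrow> inverse (per ^ \<alpha>) * 0"
    by (intro tendsto_c_mult tendsto_const) (cases "Poly_Mapping.keys x \<subseteq> {1..s}", simp_all)
  from LIMSEQ_unique[OF V_coeff_tendsto this] show ?thesis by simp
qed

lemma V_coeff_permute:
  assumes "\<sigma> permutes {1..s}"
  shows "mfps_coeff (V_series \<iota> r \<alpha> s) (Poly_Mapping.map_key \<sigma> x) = mfps_coeff (V_series \<iota> r \<alpha> s) x"
proof -
  have inj: "inj \<sigma>" by (rule permutes_inj[OF assms])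
  have look: "Poly_Mapping.lookup (Poly_Mapping.map_key \<sigma> x) i = Poly_Mapping.lookup x (\<sigma> i)" for i
    by (simp add: map_key.rep_eq[OF inj])
  have "V_sum (Poly_Mapping.map_key \<sigma> x) D = V_sum x D" for D
  proof -
    have "(\<Prod>i=1..s. wform (Poly_Mapping.lookup x (\<sigma> i)) a) = (\<Prod>i=1..s. wform (Poly_Mapping.lookup x i) a)" for a
      using prod.permute[OF assms, of "\<lambda>i. wform (Poly_Mapping.lookup x i) a"] by (simp add: o_def)
    then show ?thesis by (simp add: V_sum_def look)
  qed
  moreover have "Poly_Mapping.keys (Poly_Mapping.map_key \<sigma> x) \<subseteq> {1..s} \<longleftrightarrow> Poly_Mapping.keys x \<subseteq> {1..s}"
    unfolding keys_map_key[OF inj] using permutes_in_image[OF assms] permutes_surj[OF assms]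
    by (smt (verit) subset_iff vimageI2 vimage_def mem_Collect_eq surjD)
  ultimately have "(\<lambda>D. inverse (per ^ \<alpha>) * (if Poly_Mapping.keys x \<subseteq> {1..s} then V_sum x D else 0))
      \<longlonglongrightarrow> mfps_coeff (V_series \<iota> r \<alpha> s) (Poly_Mapping.map_key \<sigma> x)"
    using V_coeff_tendsto[of "Poly_Mapping.map_key \<sigma> x"] by (simp del: One_nat_def cong: if_cong)
  from LIMSEQ_unique[OF this V_coeff_tendsto] show ?thesis .
qed

end

section \<open>Additive polynomials vanishing on a finite \<open>\<F>\<^sub>q\<close>-space\<close>

context C_infinity_card
begin

definition apoly :: "(nat \<Rightarrow> 'c) \<Rightarrow> nat \<Rightarrow> 'c \<Rightarrow> 'c" where
  "apoly c D z = (\<Sum>i\<le>D. c i * z ^ q ^ i)"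

lemma apoly_add: "apoly c D (x + y) = apoly c D x + apoly c D y"
  by (simp add: apoly_def frobenius_power_add distrib_left sum.distrib)

lemma apoly_cst_mult: "apoly c D (cst k * x) = cst k * apoly c D x"
  by (simp add: apoly_def power_mult_distrib cst_power_card_power sum_distrib_left mult.left_commute)

lemma apoly_0 [simp]: "apoly c D 0 = 0"
  by (simp add: apoly_def zero_power)

lemma power_q_gt_1: "1 \<le> i \<Longrightarrow> 2 \<le> q ^ i"
  using power_increasing[of 1 i q] q_ge_2 by simp

lemma sum_power_all:
  assumes "lin l" "Suc n < q ^ D"
  shows "(\<Sum>a\<in>polys_lt D. (z + l a) ^ n) = 0"
  using sum_affine_power_eq_0[OF assms] .

lemma of_nat_card_polys_lt: "of_nat (card (polys_lt D :: 'f poly set)) = (if D = 0 then 1 else 0 :: 'c)"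
proof (cases "D = 0")
  case False
  then have "Suc 0 < q ^ D" using power_q_gt_1[of D] by simp
  from sum_power_all[OF lin_emb this, of 0] False show ?thesis by simp
qed simp

lemma sum_nonzero_power:
  assumes "lin l" "0 < n" "Suc n < q ^ D"
  shows "(\<Sum>a\<in>polys_lt D - {0}. l a ^ n) = 0"
  using sum_power_all[OF assms(1,3), of 0] assms(1,2) by (simp add: sum_diff1 zero_power)

lemma sum_nonzero_1:
  assumes "0 < D"
  shows "(\<Sum>a\<in>polys_lt D - {0 :: 'f poly}. 1 :: 'c) = - 1"
proof -
  have "(\<Sum>a\<in>(polys_lt D :: 'f poly set). 1 :: 'c) = 1 + (\<Sum>a\<in>polys_lt D - {0 :: 'f poly}. 1)"
    by (rule sum.remove[of _ _ "\<lambda>_. 1"]) auto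
  moreover have "(\<Sum>a\<in>(polys_lt D :: 'f poly set). 1 :: 'c) = 0"
    using of_nat_card_polys_lt[of D] assms by simp
  ultimately show ?thesis by (simp only: eq_neg_iff_add_eq_0 add.commute)
qed

lemma wt_top: "wt q (concat (map (\<lambda>i. replicate (q - 1) i) [0..<D])) = q ^ D - 1
  \<and> length (concat (map (\<lambda>i. replicate (q - 1) i) [0..<D])) = D * (q - 1)"
proof (induction D)
  case (Suc D)
  have "1 \<le> q ^ D" "q ^ D \<le> q * q ^ D" by simp_all
  with Suc show ?case by (simp add: diff_mult_distrib)
qed simp

text \<open>
  For \<open>E(z) = \<Sum>c\<^sub>i z\<^bsup>q^i\<^esup>\<close> vanishing on a space \<open>\<Lambda> = l(A\<^bsub><D\<^esub>)\<close>, sum the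
  identity \<open>E(z)(z + \<lambda>)\<^bsup>-k\<^esup> = E(z + \<lambda>)(z + \<lambda>)\<^bsup>-k\<^esup>\<close> over \<open>\<lambda> \<in> \<Lambda>\<close>.
\<close>

context
  fixes l :: "'f poly \<Rightarrow> 'c" and D :: nat and c :: "nat \<Rightarrow> 'c"
  assumes l: "lin l"
    and kills: "\<And>a. a \<in> polys_lt D \<Longrightarrow> apoly c D (l a) = 0"
begin

lemma sum_inverse_power_times_apoly:
  "apoly c D z * (\<Sum>a\<in>polys_lt D. inverse ((z + l a) ^ k)) =
    (\<Sum>i\<le>D. c i * (\<Sum>a\<in>polys_lt D. (z + l a) ^ q ^ i * inverse ((z + l a) ^ k)))"
proof -
  have "apoly c D z * (\<Sum>a\<in>polys_lt D. inverse ((z + l a) ^ k)) =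
      (\<Sum>a\<in>polys_lt D. apoly c D (z + l a) * inverse ((z + l a) ^ k))"
    by (simp add: sum_distrib_left apoly_add kills)
  also have "\<dots> = (\<Sum>a\<in>polys_lt D. \<Sum>i\<le>D. c i * ((z + l a) ^ q ^ i * inverse ((z + l a) ^ k)))"
    by (simp add: apoly_def sum_distrib_right mult.assoc)
  also have "\<dots> = (\<Sum>i\<le>D. \<Sum>a\<in>polys_lt D. c i * ((z + l a) ^ q ^ i * inverse ((z + l a) ^ k)))"
    by (rule sum.swap)
  finally show ?thesis by (simp add: sum_distrib_left)
qed

text \<open>
  All the intermediate power sums in \<open>\<Sum> E(\<lambda>)/\<lambda> = 0\<close> vanish.
\<close>

lemma lead_coeff_apoly:
  assumes inj: "\<And>a. a \<in> polys_lt D \<Longrightarrow> l a = 0 \<Longrightarrow> a = 0" and c0: "c 0 = 1"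
  shows "c D * (\<Sum>a\<in>polys_lt D. l a ^ (q ^ D - 1)) = 1"
proof (cases "D = 0")
  case True
  then show ?thesis using c0 by simp
next
  case False
  have "0 = (\<Sum>a\<in>polys_lt D - {0}. apoly c D (l a) * inverse (l a))"
    by (simp add: kills)
  also have "\<dots> = (\<Sum>a\<in>polys_lt D - {0}. \<Sum>i\<le>D. c i * l a ^ (q ^ i - 1))"
  proof (intro sum.cong refl)
    fix a assume "a \<in> polys_lt D - {0 :: 'f poly}"
    then have nz: "l a \<noteq> 0" using inj by blast
    have "l a ^ q ^ i * inverse (l a) = l a ^ (q ^ i - 1)" for i
      using nz power_Suc2[of "l a" "q ^ i - 1"] by (simp add: Suc_le_eq)
    then show "apoly c D (l a) * inverse (l a) = (\<Sum>i\<le>D. c i * l a ^ (q ^ i - 1))"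
      by (simp add: apoly_def sum_distrib_right mult.assoc)
  qed
  also have "\<dots> = (\<Sum>i\<le>D. c i * (\<Sum>a\<in>polys_lt D - {0}. l a ^ (q ^ i - 1)))"
    by (subst sum.swap) (simp add: sum_distrib_left)
  also have "\<dots> = (\<Sum>i\<in>{0, D}. c i * (\<Sum>a\<in>polys_lt D - {0}. l a ^ (q ^ i - 1)))"
  proof (rule sum.mono_neutral_right)
    show "\<forall>i\<in>{..D} - {0, D}. c i * (\<Sum>a\<in>polys_lt D - {0}. l a ^ (q ^ i - 1)) = 0"
    proof
      fix i assume i: "i \<in> {..D} - {0, D}"
      then have "2 \<le> q ^ i" "q ^ i < q ^ D"
        using power_q_gt_1[of i] q_ge_2 by (auto intro: power_strict_increasing)
      then show "c i * (\<Sum>a\<in>polys_lt D - {0}. l a ^ (q ^ i - 1)) = 0"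
        by (subst sum_nonzero_power[OF l]) auto
    qed
  qed auto
  also have "\<dots> = -1 + c D * (\<Sum>a\<in>polys_lt D - {0}. l a ^ (q ^ D - 1))"
    using False c0 sum_nonzero_1[of D] by simp
  also have "(\<Sum>a\<in>polys_lt D - {0}. l a ^ (q ^ D - 1)) = (\<Sum>a\<in>polys_lt D. l a ^ (q ^ D - 1))"
    using False power_q_gt_1[of D] by (simp add: sum_diff1 lin_0[OF l] zero_power)
  finally show ?thesis by (simp add: eq_neg_iff_add_eq_0)
qed

lemma apoly_times_sum_inverse:
  assumes inj: "\<And>a. a \<in> polys_lt D \<Longrightarrow> l a = 0 \<Longrightarrow> a = 0" and c0: "c 0 = 1"
    and nz: "\<And>a. a \<in> polys_lt D \<Longrightarrow> z + l a \<noteq> 0"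
  shows "apoly c D z * (\<Sum>a\<in>polys_lt D. inverse (z + l a)) = 1"
proof -
  let ?es = "concat (map (\<lambda>i. replicate (q - 1) i) [0..<D])"
  have "apoly c D z * (\<Sum>a\<in>polys_lt D. inverse ((z + l a) ^ 1)) =
      (\<Sum>i\<le>D. c i * (\<Sum>a\<in>polys_lt D. (z + l a) ^ (q ^ i - 1)))"
    unfolding sum_inverse_power_times_apoly
  proof (intro sum.cong refl arg_cong2[where f = "(*)"])
    fix i a assume "a \<in> (polys_lt D :: 'f poly set)"
    then show "(z + l a) ^ q ^ i * inverse ((z + l a) ^ 1) = (z + l a) ^ (q ^ i - 1)"
      using nz[of a] power_Suc2[of "z + l a" "q ^ i - 1"] by (simp add: Suc_le_eq)
  qed
  also have "\<dots> = (\<Sum>i\<le>D. if i = D then c D * (\<Sum>a\<in>polys_lt D. (z + l a) ^ (q ^ D - 1)) else 0)"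
  proof (intro sum.cong refl)
    fix i assume i: "i \<in> {..D}"
    have "Suc (q ^ i - 1) < q ^ D" if "i \<noteq> D"
      using that i q_ge_2 power_strict_increasing[of i D q] by simp
    then show "c i * (\<Sum>a\<in>polys_lt D. (z + l a) ^ (q ^ i - 1)) =
        (if i = D then c D * (\<Sum>a\<in>polys_lt D. (z + l a) ^ (q ^ D - 1)) else 0)"
      using sum_power_all[OF l] by simp
  qed
  also have "\<dots> = c D * (\<Sum>a\<in>polys_lt D. (z + l a) ^ (q ^ D - 1))"
    by simp
  also have "(\<Sum>a\<in>polys_lt D. (z + l a) ^ (q ^ D - 1)) = (\<Sum>a\<in>polys_lt D. l a ^ (q ^ D - 1))"
    using sum_prod_affine_power_eq_linear[of "{}" "\<lambda>_ _. 0" l ?es D "\<lambda>_. 0" z] l wt_top[of D] by simp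
  also have "c D * \<dots> = 1" by (rule lead_coeff_apoly[OF inj c0])
  finally show ?thesis by simp
qed

lemma apoly_times_sum_inverse_power:
  assumes k: "2 \<le> k" and nz: "\<And>a. a \<in> polys_lt D \<Longrightarrow> z + l a \<noteq> 0"
  shows "apoly c D z * (\<Sum>a\<in>polys_lt D. inverse ((z + l a) ^ k)) =
    (\<Sum>i | i \<le> D \<and> q ^ i < k. c i * (\<Sum>a\<in>polys_lt D. inverse ((z + l a) ^ (k - q ^ i))))"
proof -
  have "apoly c D z * (\<Sum>a\<in>polys_lt D. inverse ((z + l a) ^ k)) =
      (\<Sum>i\<le>D. if q ^ i < k then c i * (\<Sum>a\<in>polys_lt D. inverse ((z + l a) ^ (k - q ^ i))) else 0)"
    unfolding sum_inverse_power_times_apoly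
  proof (intro sum.cong refl)
    fix i assume i: "i \<in> {..D}"
    show "c i * (\<Sum>a\<in>polys_lt D. (z + l a) ^ q ^ i * inverse ((z + l a) ^ k)) =
        (if q ^ i < k then c i * (\<Sum>a\<in>polys_lt D. inverse ((z + l a) ^ (k - q ^ i))) else 0)"
    proof (cases "q ^ i < k")
      case True
      have "(z + l a) ^ q ^ i * inverse ((z + l a) ^ k) = inverse ((z + l a) ^ (k - q ^ i))"
        if "a \<in> polys_lt D" for a
      proof -
        have "(z + l a) ^ k = (z + l a) ^ q ^ i * (z + l a) ^ (k - q ^ i)"
          using True by (simp flip: power_add)
        then show ?thesis using nz[OF that] by simp
      qed
      then show ?thesis using True by simp
    next
      case False
      have "(z + l a) ^ q ^ i * inverse ((z + l a) ^ k) = (z + l a) ^ (q ^ i - k)"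
        if "a \<in> polys_lt D" for a
      proof -
        have "(z + l a) ^ q ^ i = (z + l a) ^ (q ^ i - k) * (z + l a) ^ k"
          using False by (simp flip: power_add)
        then show ?thesis using nz[OF that] by simp
      qed
      moreover have "Suc (q ^ i - k) < q ^ D"
        using False k i power_increasing[of i D q] by auto
      ultimately show ?thesis using False sum_power_all[OF l] by simp
    qed
  qed
  then show ?thesis by (simp add: sum.inter_filter[symmetric] conj_commute)
qed

text \<open>
  The coefficients of degree \<open>q\<^sup>j\<close> with \<open>j \<ge> 1\<close> are read off from
  \<open>\<Sum>\<lambda>\<^bsup>-q^j\<^esup>E(\<lambda>) = 0\<close>, by induction on \<open>j\<close>.
\<close>

lemma apoly_unique_zero:
  assumes inj: "\<And>a. a \<in> polys_lt D \<Longrightarrow> l a = 0 \<Longrightarrow> a = 0" and c0: "c 0 = 0"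
    and "j \<le> D"
  shows "c j = 0"
  using \<open>j \<le> D\<close>
proof (induction j rule: less_induct)
  case (less j)
  show ?case
  proof (cases "j = 0")
    case False
    have "0 = (\<Sum>a\<in>polys_lt D - {0}. apoly c D (l a) * inverse (l a ^ q ^ j))"
      by (simp add: kills)
    also have "\<dots> = (\<Sum>a\<in>polys_lt D - {0}. \<Sum>i\<in>{j..D}. c i * l a ^ (q ^ i - q ^ j))"
    proof (intro sum.cong refl)
      fix a assume "a \<in> polys_lt D - {0 :: 'f poly}"
      then have nz: "l a \<noteq> 0" using inj by blast
      have "apoly c D (l a) = (\<Sum>i\<in>{j..D}. c i * l a ^ q ^ i)"
        unfolding apoly_def by (rule sum.mono_neutral_right) (auto simp: less.IH)
      moreover have "l a ^ q ^ i * inverse (l a ^ q ^ j) = l a ^ (q ^ i - q ^ j)" if "j \<le> i" for i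
      proof -
        have "q ^ j \<le> q ^ i" using that by (intro power_increasing) auto
        then have "l a ^ q ^ i = l a ^ (q ^ i - q ^ j) * l a ^ q ^ j" by (simp flip: power_add)
        then show ?thesis using nz by simp
      qed
      ultimately show "apoly c D (l a) * inverse (l a ^ q ^ j) = (\<Sum>i\<in>{j..D}. c i * l a ^ (q ^ i - q ^ j))"
        by (simp add: sum_distrib_right mult.assoc)
    qed
    also have "\<dots> = (\<Sum>i\<in>{j..D}. c i * (\<Sum>a\<in>polys_lt D - {0}. l a ^ (q ^ i - q ^ j)))"
      by (subst sum.swap) (simp add: sum_distrib_left)
    also have "\<dots> = (\<Sum>i\<in>{j}. c i * (\<Sum>a\<in>polys_lt D - {0}. l a ^ (q ^ i - q ^ j)))"
    proof (rule sum.mono_neutral_right)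
      show "\<forall>i\<in>{j..D} - {j}. c i * (\<Sum>a\<in>polys_lt D - {0}. l a ^ (q ^ i - q ^ j)) = 0"
      proof
        fix i assume i: "i \<in> {j..D} - {j}"
        then have "2 \<le> q ^ j" "q ^ j < q ^ i" "q ^ i \<le> q ^ D"
          using power_q_gt_1[of j] False q_ge_2
          by (auto intro: power_strict_increasing power_increasing)
        then show "c i * (\<Sum>a\<in>polys_lt D - {0}. l a ^ (q ^ i - q ^ j)) = 0"
          by (subst sum_nonzero_power[OF l]) auto
      qed
    qed (use less.prems in auto)
    also have "\<dots> = - c j" using sum_nonzero_1[of D] False less.prems by simp
    finally show ?thesis by simp
  qed (simp add: c0)
qed

end

text \<open>The composite of \<open>E\<close> with \<open>X \<mapsto> X - X\<^sup>q / x\<^bsup>q-1\<^esup>\<close>, whose kernel is \<open>\<F>\<^sub>q x\<close>.\<close>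

definition enlarge :: "(nat \<Rightarrow> 'c) \<Rightarrow> 'c \<Rightarrow> nat \<Rightarrow> 'c" where
  "enlarge c x i = c i - (case i of 0 \<Rightarrow> 0 | Suc k \<Rightarrow> c k ^ q) / x ^ (q - 1)"

lemma apoly_enlarge:
  assumes "c (Suc D) = 0"
  shows "apoly (enlarge c x) (Suc D) z = apoly c D z - apoly c D z ^ q / x ^ (q - 1)"
proof -
  have "apoly (enlarge c x) (Suc D) z = (\<Sum>i\<le>Suc D. c i * z ^ q ^ i) -
      (\<Sum>i\<le>Suc D. (case i of 0 \<Rightarrow> 0 | Suc k \<Rightarrow> c k ^ q) * z ^ q ^ i) / x ^ (q - 1)"
    by (simp add: apoly_def enlarge_def left_diff_distrib sum_subtractf sum_divide_distrib del: sum.atMost_Suc)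
  also have "(\<Sum>i\<le>Suc D. c i * z ^ q ^ i) = apoly c D z"
    using assms by (simp add: apoly_def)
  also have "(\<Sum>i\<le>Suc D. (case i of 0 \<Rightarrow> 0 | Suc k \<Rightarrow> c k ^ q) * z ^ q ^ i) = apoly c D z ^ q"
    unfolding sum.atMost_Suc_shift apoly_def frobenius_sum
    by (simp add: power_mult_distrib power_mult[symmetric] mult.commute)
  finally show ?thesis .
qed

lemma apoly_enlarge_cst:
  assumes "c (Suc D) = 0" "apoly c D z = cst k * x" "x \<noteq> 0"
  shows "apoly (enlarge c x) (Suc D) z = 0"
proof -
  have "apoly c D z ^ q = cst k * x * x ^ (q - 1)"
    unfolding assms(2) power_mult_distrib cst_power_card
    by (simp add: power_Suc[symmetric] Suc_pred del: power_Suc)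
  then show ?thesis using assms by (simp add: apoly_enlarge)
qed


section \<open>The exponential of the lattice \<open>A\<close>\<close>

text \<open>
  \<open>E D\<close> is the polynomial \<open>z \<Prod>(1 - z/a)\<close>, \<open>a\<close> running over the non-zero polynomials of degree \<open>< D\<close>;
  the step from \<open>D\<close> to \<open>D + 1\<close> adds \<open>\<theta>\<^bsup>D\<^esup>\<close> to its zeros.
\<close>

primrec Ec :: "nat \<Rightarrow> nat \<Rightarrow> 'c" where
  "Ec 0 = (\<lambda>i. if i = 0 then 1 else 0)"
| "Ec (Suc D) = enlarge (Ec D) (apoly (Ec D) D (\<theta> ^ D))"

definition E :: "nat \<Rightarrow> 'c \<Rightarrow> 'c" where "E D = apoly (Ec D) D"

lemma E_add: "E D (x + y) = E D x + E D y"
  and E_cst_mult: "E D (cst k * x) = cst k * E D x"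
  and E_zero [simp]: "E D 0 = 0"
  by (simp_all add: E_def apoly_add apoly_cst_mult)

lemma E_sum: "E D (sum f S) = (\<Sum>x\<in>S. E D (f x))"
  by (induction S rule: infinite_finite_induct) (auto simp: E_add)

lemma Ec_high: "D < i \<Longrightarrow> Ec D i = 0"
  by (induction D arbitrary: i) (auto simp: enlarge_def zero_power split: nat.splits)

lemma Ec_coeff_0 [simp]: "Ec D 0 = 1"
  by (induction D) (simp_all add: enlarge_def)

lemma E_Suc: "E (Suc D) z = E D z - E D z ^ q / E D (\<theta> ^ D) ^ (q - 1)"
  by (simp add: E_def apoly_enlarge Ec_high)

lemma E_0: "E 0 z = z"
  by (simp add: E_def apoly_def)

lemma theta_power_plus_nz: "a \<in> polys_lt D \<Longrightarrow> \<theta> ^ D + emb a \<noteq> 0"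
proof -
  assume a: "a \<in> polys_lt D"
  then have "coeff (monom 1 D + a) D = 1" by (simp add: polys_lt_def)
  then have "monom 1 D + a \<noteq> 0" by (metis coeff_0 zero_neq_one)
  then have "emb (monom 1 D + a) \<noteq> 0" by (simp only: emb_eq_0_iff not_False_eq_True)
  then show ?thesis by (simp add: emb_add emb_monom)
qed

text \<open>
  The value at \<open>\<theta>\<^bsup>D\<^esup>\<close>, by which the next step divides, is non-zero because its product with a sum of
  inverses equals \<open>1\<close> (\<open>apoly_times_sum_inverse\<close>).
\<close>

lemma E_kills_and_nonzero: "(\<forall>a\<in>polys_lt D. E D (emb a) = 0) \<and> E D (\<theta> ^ D) \<noteq> 0"
proof (induction D)
  case (Suc D)
  have kills: "E (Suc D) (emb a) = 0" if a: "a \<in> polys_lt (Suc D)" for a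
  proof -
    let ?b = "a - monom (coeff a D) D"
    have "coeff ?b i = 0" if "D \<le> i" for i
      using a that by (cases "i = D") (auto simp: polys_lt_def)
    then have b: "?b \<in> polys_lt D" unfolding polys_lt_def by blast
    have "emb a = emb (?b + monom (coeff a D) D)" unfolding diff_add_cancel ..
    also have "\<dots> = emb ?b + cst (coeff a D) * \<theta> ^ D"
      unfolding emb_add[of ?b] emb_monom ..
    finally have "E D (emb a) = cst (coeff a D) * E D (\<theta> ^ D)"
      using Suc b by (simp add: E_add E_cst_mult)
    then show ?thesis
      using Suc by (simp add: E_def apoly_enlarge_cst Ec_high)
  qed
  have "apoly (Ec (Suc D)) (Suc D) (\<theta> ^ Suc D) * (\<Sum>a\<in>polys_lt (Suc D). inverse (\<theta> ^ Suc D + emb a)) = 1"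
    by (rule apoly_times_sum_inverse[OF lin_emb])
      (use kills theta_power_plus_nz[of _ "Suc D"] in \<open>auto simp: E_def simp del: Ec.simps power_Suc\<close>)
  then have "E (Suc D) (\<theta> ^ Suc D) \<noteq> 0" by (auto simp: E_def)
  with kills show ?case by blast
qed (simp add: E_0)

lemma E_kills: "a \<in> polys_lt D \<Longrightarrow> E D (emb a) = 0"
  and E_theta_nz: "E D (\<theta> ^ D) \<noteq> 0"
  using E_kills_and_nonzero by blast+

definition S :: "nat \<Rightarrow> nat \<Rightarrow> 'c \<Rightarrow> 'c" where
  "S k D z = (\<Sum>a\<in>polys_lt D. inverse ((z + emb a) ^ k))"

lemma E_times_S_1:
  assumes "\<And>a. a \<in> polys_lt D \<Longrightarrow> z + emb a \<noteq> 0"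
  shows "E D z * S 1 D z = 1"
  using apoly_times_sum_inverse[OF lin_emb, of D "Ec D" z] E_kills assms
  by (simp add: E_def S_def)

lemma E_times_S:
  assumes "2 \<le> k" "\<And>a. a \<in> polys_lt D \<Longrightarrow> z + emb a \<noteq> 0"
  shows "E D z * S k D z = (\<Sum>i | i \<le> D \<and> q ^ i < k. Ec D i * S (k - q ^ i) D z)"
  using apoly_times_sum_inverse_power[OF lin_emb, of D "Ec D" k z] E_kills assms
  by (simp add: E_def S_def)

text \<open>
  For these \<open>z\<close> no denominator \<open>z + a\<close> vanishes, and \<open>1/z\<close> dominates in the sum of the inverses.
\<close>

definition small :: "'c \<Rightarrow> bool" where "small z \<longleftrightarrow> 0 < nrm z \<and> nrm z < 1"

lemma nrm_emb_ge_1: "a \<noteq> 0 \<Longrightarrow> 1 \<le> nrm (emb a)"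
  by (simp add: nrm_emb)

lemma nrm_small_plus_emb: "small z \<Longrightarrow> a \<noteq> 0 \<Longrightarrow> nrm (z + emb a) = nrm (emb a)"
  using nrm_add_eq[of z "emb a"] nrm_emb_ge_1[of a] by (simp add: small_def add.commute)

lemma small_plus_emb_nz: "small z \<Longrightarrow> z + emb a \<noteq> 0"
  using nrm_small_plus_emb[of z a] nrm_emb_ge_1[of a] by (cases "a = 0") (force simp: small_def)+

lemma small_inverse_theta_power: "0 < k \<Longrightarrow> small (inverse (\<theta> ^ k))"
  by (simp add: small_def nrm_inverse nrm_power inverse_less_1_iff one_less_power)

lemma nrm_S_1:
  assumes z: "small z"
  shows "nrm (S 1 D z) = inverse (nrm z)"
proof -
  have "nrm (\<Sum>a\<in>polys_lt D - {0}. inverse (z + emb a)) \<le> 1"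
  proof (rule nrm_sum_le)
    fix a assume "a \<in> polys_lt D - {0 :: 'f poly}"
    then show "nrm (inverse (z + emb a)) \<le> 1"
      using nrm_small_plus_emb[OF z, of a] nrm_emb_ge_1[of a] by (simp add: nrm_inverse inverse_le_1_iff)
  qed simp
  also have "1 < nrm (inverse z)" using z by (simp add: small_def nrm_inverse one_less_inverse)
  finally have "nrm (inverse z + (\<Sum>a\<in>polys_lt D - {0}. inverse (z + emb a))) = nrm (inverse z)"
    by (rule nrm_add_eq)
  then show ?thesis
    by (simp add: S_def nrm_inverse sum.remove[of "polys_lt D" 0])
qed

lemma nrm_E_small:
  assumes "small z"
  shows "nrm (E D z) = nrm z"
proof -
  have "nrm (E D z) * inverse (nrm z) = 1"
    using arg_cong[OF E_times_S_1[of D z], of nrm] small_plus_emb_nz[OF assms] nrm_S_1[OF assms, of D]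
    by (simp add: nrm_mult)
  moreover have "nrm z \<noteq> 0" using assms by (simp add: small_def)
  ultimately show ?thesis by (simp add: field_simps)
qed

lemma tendsto_half_power: "(\<lambda>n. inverse (2 ^ n) :: real) \<longlonglongrightarrow> 0"
  by (rule LIMSEQ_inverse_realpow_zero) simp

lemma S_convergent:
  assumes z: "small z" and k: "1 \<le> k"
  shows "\<exists>L. (\<lambda>D. S k D z) \<longlonglongrightarrow> L"
proof -
  have "(\<lambda>D. S k (Suc D) z - S k D z) \<longlonglongrightarrow> 0"
  proof (rule tendsto_0_nrm_le[OF _ tendsto_half_power])
    fix D
    have "S k (Suc D) z - S k D z = (\<Sum>a\<in>polys_lt (Suc D) - polys_lt D. inverse ((z + emb a) ^ k))"
      by (simp add: S_def sum_diff polys_lt_mono)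
    also have "nrm \<dots> \<le> inverse (2 ^ D)"
    proof (rule nrm_sum_le)
      fix a assume a: "a \<in> polys_lt (Suc D) - (polys_lt D :: 'f poly set)"
      then have "a \<noteq> 0" by auto
      have "D \<le> degree a" using a polys_lt_if_degree_less[of a D] by force
      then have "(2 :: real) ^ D \<le> 2 ^ degree a" by (intro power_increasing) auto
      also have "\<dots> \<le> (2 ^ degree a) ^ k" using k by (intro self_le_power) auto
      finally show "nrm (inverse ((z + emb a) ^ k)) \<le> inverse (2 ^ D)"
        using \<open>a \<noteq> 0\<close> by (simp add: nrm_inverse nrm_power nrm_small_plus_emb[OF z] nrm_emb)
    qed simp
    finally show "nrm (S k (Suc D) z - S k D z) \<le> inverse (2 ^ D)" .
  qed
  then show ?thesis by (rule convergent_of_steps) blast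
qed

definition S_inf :: "nat \<Rightarrow> 'c \<Rightarrow> 'c" where "S_inf k z = lim (\<lambda>D. S k D z)"

lemma S_tendsto:
  assumes "small z" "1 \<le> k"
  shows "(\<lambda>D. S k D z) \<longlonglongrightarrow> S_inf k z"
  using S_convergent[OF assms] by (auto simp: S_inf_def limI)

text \<open>
  The exponential function of the lattice \<open>A\<close>, that is \<open>z \<Prod>(1 - z/a)\<close> over all non-zero \<open>a \<in> A\<close>.
\<close>

definition e :: "'c \<Rightarrow> 'c" where "e z = lim (\<lambda>D. E D z)"

lemma e_eqI: "(\<lambda>D. E D z) \<longlonglongrightarrow> L \<Longrightarrow> e z = L"
  by (simp add: e_def limI)

lemma S_inf_1_nz:
  assumes "small z"
  shows "S_inf 1 z \<noteq> 0"
proof -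
  have "(\<lambda>D. inverse (nrm z)) \<longlonglongrightarrow> nrm (S_inf 1 z)"
    using tendsto_nrm[OF S_tendsto[OF assms, of 1]] by (simp add: nrm_S_1[OF assms] del: One_nat_def)
  from LIMSEQ_unique[OF this tendsto_const] have "nrm (S_inf 1 z) = inverse (nrm z)" .
  then show ?thesis using assms by (auto simp: small_def)
qed

lemma E_tendsto_small:
  assumes "small z"
  shows "(\<lambda>D. E D z) \<longlonglongrightarrow> inverse (S_inf 1 z)"
proof -
  have "E D z = inverse (S 1 D z)" for D
    using E_times_S_1[of D z] small_plus_emb_nz[OF assms] by (metis inverse_unique mult.commute)
  then show ?thesis
    using tendsto_c_inverse[OF S_tendsto[OF assms, of 1] S_inf_1_nz[OF assms]] by simp
qed

lemma e_small: "small z \<Longrightarrow> e z = inverse (S_inf 1 z)"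
  by (rule e_eqI) (rule E_tendsto_small)

lemma E_tendsto_e: "small z \<Longrightarrow> (\<lambda>D. E D z) \<longlonglongrightarrow> e z"
  using E_tendsto_small e_small by simp

lemma nrm_e:
  assumes "small z"
  shows "nrm (e z) = nrm z"
proof -
  have "(\<lambda>D. nrm z) \<longlonglongrightarrow> nrm (e z)"
    using tendsto_nrm[OF E_tendsto_e[OF assms]] by (simp add: nrm_E_small[OF assms])
  from LIMSEQ_unique[OF this tendsto_const] show ?thesis .
qed

subsection \<open>The functional equation\<close>

abbreviation eps_part :: "nat \<Rightarrow> 'c" where "eps_part D \<equiv> E D (inverse \<theta>)"

lemma small_inverse_theta: "small (inverse \<theta>)"
  using small_inverse_theta_power[of 1] by simp

lemma eps_part_nz [simp]: "eps_part D \<noteq> 0"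
  using nrm_E_small[OF small_inverse_theta, of D] by force

text \<open>
  Both sides of the functional equation are, up to the factor \<open>\<theta>\<close>, the normalised additive
  polynomial with kernel \<open>\<theta>\<^sup>-\<^sup>1A\<^bsub><D+1\<^esub> = A\<^bsub><D\<^esub> + \<F>\<^sub>q\<theta>\<^sup>-\<^sup>1\<close>.
\<close>

lemma E_functional_coeff:
  assumes "i \<le> Suc D"
  shows "\<theta> ^ (q ^ i - 1) * Ec (Suc D) i = enlarge (Ec D) (eps_part D) i"
proof -
  define f where "f i = \<theta> ^ (q ^ i - 1) * Ec (Suc D) i - enlarge (Ec D) (eps_part D) i" for i
  define l where "l a = inverse \<theta> * emb a" for a
  have "f i = 0"
  proof (rule apoly_unique_zero)
    show l: "lin l" unfolding l_def by (intro lin_mult_const lin_emb)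
    show "apoly f (Suc D) (l a) = 0" if a: "a \<in> polys_lt (Suc D)" for a
    proof -
      have "apoly (\<lambda>i. \<theta> ^ (q ^ i - 1) * Ec (Suc D) i) (Suc D) (l a) = inverse \<theta> * E (Suc D) (emb a)"
        unfolding apoly_def E_def sum_distrib_left
      proof (intro sum.cong refl)
        fix i
        have "\<theta> ^ (q ^ i - 1) * inverse \<theta> ^ q ^ i = inverse \<theta>"
        proof -
          have "\<theta> ^ q ^ i = \<theta> * \<theta> ^ (q ^ i - 1)" by (simp flip: power_Suc)
          then show ?thesis by (simp add: power_inverse)
        qed
        then show "\<theta> ^ (q ^ i - 1) * Ec (Suc D) i * l a ^ q ^ i = inverse \<theta> * (Ec (Suc D) i * emb a ^ q ^ i)"
          by (simp add: l_def power_mult_distrib mult_ac)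
      qed
      also have "\<dots> = 0" by (simp add: E_kills[OF a])
      finally have 1: "apoly (\<lambda>i. \<theta> ^ (q ^ i - 1) * Ec (Suc D) i) (Suc D) (l a) = 0" .
      obtain k b where ab: "a = pCons k b" by (cases a)
      have "b \<in> polys_lt D"
        unfolding polys_lt_def mem_Collect_eq
      proof safe
        fix i assume "D \<le> i"
        then have "coeff a (Suc i) = 0" using a by (simp add: polys_lt_def)
        then show "coeff b i = 0" by (simp add: ab)
      qed
      moreover have "l a = cst k * inverse \<theta> + emb b" by (simp add: l_def ab emb_pCons field_simps)
      ultimately have "E D (l a) = cst k * eps_part D" by (simp add: E_add E_cst_mult E_kills)
      then have "apoly (enlarge (Ec D) (eps_part D)) (Suc D) (l a) = 0"
        by (intro apoly_enlarge_cst) (simp_all add: Ec_high E_def[symmetric])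
      with 1 show ?thesis
        by (simp add: f_def apoly_def left_diff_distrib sum_subtractf)
    qed
    show "a = 0" if "l a = 0" for a using that by (simp add: l_def)
    show "f 0 = 0" by (simp add: f_def enlarge_def)
  qed (rule assms)
  then show ?thesis by (simp add: f_def)
qed

lemma E_functional: "E (Suc D) (\<theta> * z) = \<theta> * (E D z - E D z ^ q / eps_part D ^ (q - 1))"
proof -
  have "\<theta> * apoly (enlarge (Ec D) (eps_part D)) (Suc D) z =
      (\<Sum>i\<le>Suc D. \<theta> * (\<theta> ^ (q ^ i - 1) * Ec (Suc D) i) * z ^ q ^ i)"
    unfolding apoly_def sum_distrib_left
  proof (intro sum.cong refl)
    fix i assume "i \<in> {..Suc D}"
    then have "enlarge (Ec D) (eps_part D) i = \<theta> ^ (q ^ i - 1) * Ec (Suc D) i"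
      using E_functional_coeff[of i D] by simp
    then show "\<theta> * (enlarge (Ec D) (eps_part D) i * z ^ q ^ i) =
        \<theta> * (\<theta> ^ (q ^ i - 1) * Ec (Suc D) i) * z ^ q ^ i"
      by (simp only: mult.assoc)
  qed
  also have "\<dots> = E (Suc D) (\<theta> * z)"
    unfolding E_def apoly_def
  proof (intro sum.cong refl)
    fix i
    have "\<theta> ^ q ^ i = \<theta> * \<theta> ^ (q ^ i - 1)" by (simp flip: power_Suc)
    then show "\<theta> * (\<theta> ^ (q ^ i - 1) * Ec (Suc D) i) * z ^ q ^ i = Ec (Suc D) i * (\<theta> * z) ^ q ^ i"
      by (simp add: power_mult_distrib mult_ac)
  qed
  finally show ?thesis by (simp add: apoly_enlarge Ec_high E_def)
qed

abbreviation eps :: 'c where "eps \<equiv> e (inverse \<theta>)"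

lemma eps_nz [simp]: "eps \<noteq> 0"
  using nrm_e[OF small_inverse_theta] by force

lemma eps_tendsto: "eps_part \<longlonglongrightarrow> eps"
  by (rule E_tendsto_e[OF small_inverse_theta])

lemma e_functional:
  assumes "(\<lambda>D. E D z) \<longlonglongrightarrow> e z"
  shows "(\<lambda>D. E D (\<theta> * z)) \<longlonglongrightarrow> e (\<theta> * z)"
    and "e (\<theta> * z) = \<theta> * (e z - e z ^ q / eps ^ (q - 1))"
proof -
  have "(\<lambda>D. E (Suc D) (\<theta> * z)) \<longlonglongrightarrow> \<theta> * (e z - e z ^ q / eps ^ (q - 1))"
    unfolding E_functional divide_inverse
    by (intro tendsto_c_mult tendsto_c_diff tendsto_c_power tendsto_c_inverse tendsto_const assms eps_tendsto) simp
  then have *: "(\<lambda>D. E D (\<theta> * z)) \<longlonglongrightarrow> \<theta> * (e z - e z ^ q / eps ^ (q - 1))"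
    by (rule LIMSEQ_imp_Suc)
  then show eq: "e (\<theta> * z) = \<theta> * (e z - e z ^ q / eps ^ (q - 1))" by (rule e_eqI)
  show "(\<lambda>D. E D (\<theta> * z)) \<longlonglongrightarrow> e (\<theta> * z)" using * by (simp only: eq)
qed

subsection \<open>Convergence of the coefficients\<close>

lemma nrm_E_theta_power_ge: "2 ^ D \<le> nrm (E D (\<theta> ^ D))"
proof -
  have "nrm (S 1 D (\<theta> ^ D)) \<le> inverse (2 ^ D)"
    unfolding S_def
  proof (rule nrm_sum_le)
    fix a assume a: "a \<in> (polys_lt D :: 'f poly set)"
    have "nrm (\<theta> ^ D + emb a) = 2 ^ D"
    proof (cases "a = 0")
      case False
      then have "nrm (emb a) < nrm (\<theta> ^ D)"
        using degree_less_if_polys_lt[OF a] by (simp add: nrm_emb nrm_power)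
      then show ?thesis by (simp add: nrm_add_eq nrm_power)
    qed (simp add: nrm_power)
    then show "nrm (inverse ((\<theta> ^ D + emb a) ^ 1)) \<le> inverse (2 ^ D)" by (simp add: nrm_inverse)
  qed simp
  moreover have "nrm (E D (\<theta> ^ D)) * nrm (S 1 D (\<theta> ^ D)) = 1"
    using arg_cong[OF E_times_S_1[of D "\<theta> ^ D"], of nrm] theta_power_plus_nz by (simp add: nrm_mult)
  ultimately have "1 \<le> nrm (E D (\<theta> ^ D)) * inverse (2 ^ D)"
    by (metis mult_left_mono nrm_ge_0)
  then show ?thesis by (simp add: field_simps)
qed

text \<open>
  The recursion divides by powers of \<open>E\<^sub>D(\<theta>\<^bsup>D\<^esup>)\<close>, which tends to infinity.
\<close>

lemma Ec_convergent: "\<exists>L. (\<lambda>D. Ec D i) \<longlonglongrightarrow> L"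
proof (induction i)
  case (Suc i)
  then obtain L where L: "(\<lambda>D. Ec D i) \<longlonglongrightarrow> L" by blast
  have z: "(\<lambda>D. inverse (E D (\<theta> ^ D) ^ (q - 1))) \<longlonglongrightarrow> 0"
  proof (rule tendsto_0_nrm_le[OF _ tendsto_half_power])
    fix D
    have "2 ^ D \<le> nrm (E D (\<theta> ^ D))" by (rule nrm_E_theta_power_ge)
    also have "\<dots> \<le> nrm (E D (\<theta> ^ D)) ^ (q - 1)"
      using q_ge_2 order.trans[OF _ nrm_E_theta_power_ge[of D], of 1] by (intro self_le_power) auto
    finally show "nrm (inverse (E D (\<theta> ^ D) ^ (q - 1))) \<le> inverse (2 ^ D)"
      unfolding nrm_inverse nrm_power by (intro le_imp_inverse_le) auto
  qed
  have "(\<lambda>D. - (Ec D i ^ q * inverse (E D (\<theta> ^ D) ^ (q - 1)))) \<longlonglongrightarrow> - (L ^ q * 0)"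
    by (intro tendsto_c_minus tendsto_c_mult tendsto_c_power L z)
  moreover have "Ec (Suc D) (Suc i) - Ec D (Suc i) = - (Ec D i ^ q * inverse (E D (\<theta> ^ D) ^ (q - 1)))" for D
    by (simp add: enlarge_def E_def divide_inverse)
  ultimately have "(\<lambda>D. Ec (Suc D) (Suc i) - Ec D (Suc i)) \<longlonglongrightarrow> 0" by (simp del: Ec.simps)
  then show ?case by (rule convergent_of_steps) blast
qed auto

definition e_coeff :: "nat \<Rightarrow> 'c" where "e_coeff i = lim (\<lambda>D. Ec D i)"

lemma Ec_tendsto: "(\<lambda>D. Ec D i) \<longlonglongrightarrow> e_coeff i"
  using Ec_convergent[of i] by (auto simp: e_coeff_def limI)

lemma e_coeff_0: "e_coeff 0 = 1"
  using LIMSEQ_unique[OF Ec_tendsto[of 0]] by simp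

lemma e_coeff_Suc:
  "\<theta> ^ (q ^ Suc i - 1) * e_coeff (Suc i) = e_coeff (Suc i) - e_coeff i ^ q / eps ^ (q - 1)"
proof -
  have 1: "(\<lambda>D. enlarge (Ec D) (eps_part D) (Suc i)) \<longlonglongrightarrow> e_coeff (Suc i) - e_coeff i ^ q / eps ^ (q - 1)"
    unfolding enlarge_def divide_inverse nat.case
    by (intro tendsto_c_mult tendsto_c_diff tendsto_c_power tendsto_c_inverse tendsto_const Ec_tendsto eps_tendsto) simp
  have 2: "(\<lambda>D. \<theta> ^ (q ^ Suc i - 1) * Ec (Suc D) (Suc i)) \<longlonglongrightarrow> \<theta> ^ (q ^ Suc i - 1) * e_coeff (Suc i)"
    by (intro tendsto_c_mult tendsto_const LIMSEQ_Suc Ec_tendsto)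
  have "\<forall>\<^sub>F D in sequentially. \<theta> ^ (q ^ Suc i - 1) * Ec (Suc D) (Suc i) = enlarge (Ec D) (eps_part D) (Suc i)"
    using eventually_ge_at_top[of i] by eventually_elim (rule E_functional_coeff, simp)
  from tendsto_cong[OF this] 2
  have "(\<lambda>D. enlarge (Ec D) (eps_part D) (Suc i)) \<longlonglongrightarrow> \<theta> ^ (q ^ Suc i - 1) * e_coeff (Suc i)" by blast
  from LIMSEQ_unique[OF this 1] show ?thesis .
qed

lemma e_times_S_inf:
  assumes z: "small z" and k: "2 \<le> k"
  shows "e z * S_inf k z = (\<Sum>i | i < k \<and> q ^ i < k. e_coeff i * S_inf (k - q ^ i) z)"
proof -
  have "\<forall>\<^sub>F D in sequentially. E D z * S k D z = (\<Sum>i | i < k \<and> q ^ i < k. Ec D i * S (k - q ^ i) D z)"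
    using eventually_ge_at_top[of k]
  proof eventually_elim
    case (elim D)
    have "i < k" if "q ^ i < k" for i
    proof -
      have "i < 2 ^ i" by (rule less_exp)
      also have "\<dots> \<le> q ^ i" using q_ge_2 by (intro power_mono) auto
      finally show ?thesis using that by simp
    qed
    then have "{i. i \<le> D \<and> q ^ i < k} = {i. i < k \<and> q ^ i < k}" using elim by force
    then show ?case using E_times_S[OF k] small_plus_emb_nz[OF z] by simp
  qed
  moreover have "(\<lambda>D. E D z * S k D z) \<longlonglongrightarrow> e z * S_inf k z"
    using k by (intro tendsto_c_mult E_tendsto_e S_tendsto z) auto
  ultimately have "(\<lambda>D. \<Sum>i | i < k \<and> q ^ i < k. Ec D i * S (k - q ^ i) D z) \<longlonglongrightarrow> e z * S_inf k z"
    by (simp add: tendsto_cong)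
  moreover have "(\<lambda>D. \<Sum>i | i < k \<and> q ^ i < k. Ec D i * S (k - q ^ i) D z) \<longlonglongrightarrow>
      (\<Sum>i | i < k \<and> q ^ i < k. e_coeff i * S_inf (k - q ^ i) z)"
    by (intro tendsto_c_sum tendsto_c_mult Ec_tendsto S_tendsto z) auto
  ultimately show ?thesis by (rule LIMSEQ_unique)
qed

subsection \<open>The product formula for \<open>e(1/\<theta>)\<close>\<close>

lemma minus_1_power_q_minus_1: "(- 1 :: 'c) ^ (q - 1) = 1"
proof -
  have "cst (-1) = -1" using cst_add[of 1 "-1"] by (simp add: eq_neg_iff_add_eq_0 add.commute)
  then show ?thesis
    using minus_one_power_card_minus_1[where ?'f = 'f] by (metis cst_1 cst_power q_def)
qed

text \<open>
  The two recursions for \<open>E\<^sub>D\<^sub>+\<^sub>1(\<theta>\<^bsup>D+1\<^esup>)\<close> and \<open>E\<^sub>D\<^sub>+\<^sub>1(\<theta>\<^sup>-\<^sup>1)\<close> combine to \<open>u\<^sub>D\<^sub>+\<^sub>1 = \<theta>\<^bsup>q-1\<^esup> u\<^sub>D\<^bsup>q\<^esup>\<close> for the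
  powers \<open>u\<^sub>D\<close> on the left.
\<close>

lemma ratio_power: "(E D (\<theta> ^ D) / eps_part D) ^ (q - 1) = \<theta> ^ (q ^ Suc D - 1)"
proof (induction D)
  case 0
  have "\<theta> ^ 0 / inverse \<theta> = \<theta>" by (simp add: divide_inverse)
  then show ?case by (simp only: E_0 power_Suc power_0 mult_1_right)
next
  case (Suc D)
  let ?x = "E D (\<theta> ^ D)" and ?y = "eps_part D"
  define u where "u = (?x / ?y) ^ (q - 1)"
  have u: "u = \<theta> ^ (q ^ Suc D - 1)" using Suc by (simp add: u_def)
  have pw: "v ^ q = v * v ^ (q - 1)" for v :: 'c by (simp flip: power_Suc)
  have "2 \<le> q ^ Suc D" by (rule power_q_gt_1) simp
  then have "(2 :: real) ^ 1 \<le> 2 ^ (q ^ Suc D - 1)" by (intro power_increasing) auto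
  then have "nrm u \<noteq> 1" by (simp add: u nrm_power)
  then have u1: "u \<noteq> 1" "u \<noteq> 0" by (auto simp: u)
  have "E (Suc D) (\<theta> ^ Suc D) = \<theta> * (?x * (1 - u))"
    using E_theta_nz[of D] by (simp add: E_functional u_def pw power_divide right_diff_distrib)
  moreover have "eps_part (Suc D) = ?y * (1 - inverse u)"
    using E_theta_nz[of D] by (simp add: E_Suc u_def pw power_divide right_diff_distrib)
  moreover have "(1 - u) / (1 - inverse u) = - u" using u1 by (simp add: field_simps)
  ultimately have "E (Suc D) (\<theta> ^ Suc D) / eps_part (Suc D) = (-1) * (\<theta> * (?x / ?y) * u)"
    by (metis (no_types, lifting) mult_minus_left mult_minus_right times_divide_times_eq times_divide_eq_right mult.assoc mult_1)
  then have "(E (Suc D) (\<theta> ^ Suc D) / eps_part (Suc D)) ^ (q - 1) = \<theta> ^ (q - 1) * u * u ^ (q - 1)"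
    by (simp only: power_mult_distrib minus_1_power_q_minus_1 mult_1 u_def)
  also have "\<dots> = \<theta> ^ (q - 1) * u ^ q" by (simp add: pw mult.assoc)
  also have "\<dots> = \<theta> ^ (q - 1 + q * (q ^ Suc D - 1))"
    unfolding u by (simp only: power_add power_mult[symmetric] mult.commute)
  also have "q - 1 + q * (q ^ Suc D - 1) = q ^ Suc (Suc D) - 1"
  proof -
    have "q \<le> q * q ^ Suc D" by simp
    then show ?thesis by (simp add: right_diff_distrib')
  qed
  finally show ?case .
qed

lemma eps_part_product: "eps_part D = inverse \<theta> * (\<Prod>i<D. 1 - inverse (\<theta> ^ (q ^ Suc i - 1)))"
proof (induction D)
  case (Suc D)
  have pw: "v ^ q = v * v ^ (q - 1)" for v :: 'c by (simp flip: power_Suc)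
  have "eps_part (Suc D) = eps_part D * (1 - inverse ((E D (\<theta> ^ D) / eps_part D) ^ (q - 1)))"
    using E_theta_nz[of D] by (simp add: E_Suc pw power_divide right_diff_distrib)
  also have "\<dots> = inverse \<theta> * (\<Prod>i<Suc D. 1 - inverse (\<theta> ^ (q ^ Suc i - 1)))"
    unfolding ratio_power by (simp add: Suc)
  finally show ?case .
qed (simp add: E_0)

end

context V_setting
begin

text \<open>
  The product defining the period is the limit of \<open>eps_part_product\<close>.
\<close>

lemma period_eq: "per = r / eps"
proof -
  define f where "f i = inverse (1 - \<theta> powi (1 - int (q ^ Suc i)))" for i
  have powi: "\<theta> powi (1 - int (q ^ Suc i)) = inverse (\<theta> ^ (q ^ Suc i - 1))" for i
  proof -
    have "1 \<le> q ^ Suc i" by (simp del: power_Suc)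
    then have "1 - int (q ^ Suc i) = - int (q ^ Suc i - 1)" by (simp add: of_nat_diff del: power_Suc)
    then show ?thesis by (simp only: power_int_minus power_int_of_nat)
  qed
  have "(\<Prod>i\<le>n. f (i + 0)) = inverse (\<theta> * eps_part (Suc n))" for n
    unfolding eps_part_product f_def powi
    by (simp add: prod_inversef[unfolded o_def] lessThan_Suc_atMost mult.assoc[symmetric] del: prod.lessThan_Suc)
  moreover have "(\<lambda>n. inverse (\<theta> * eps_part (Suc n))) \<longlonglongrightarrow> inverse (\<theta> * eps)"
    by (intro tendsto_c_inverse tendsto_c_mult tendsto_const LIMSEQ_Suc eps_tendsto) simp
  ultimately have "raw_has_prod f 0 (inverse (\<theta> * eps))"
    by (simp add: raw_has_prod_def)
  then have "f has_prod inverse (\<theta> * eps)" by (simp add: has_prod_def)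
  then have "prodinf f = inverse (\<theta> * eps)" by (rule has_prod_unique[symmetric])
  then show ?thesis
    by (simp add: pi_tilde_def f_def[abs_def] divide_inverse flip: q_def)
qed

end

section \<open>The subfield \<open>K\<close>\<close>

context C_infinity_card
begin

definition Kc :: "'c set" where "Kc = \<iota> ` K_in_Kinf"

lemma Kc_I:
  assumes "b \<noteq> 0"
  shows "emb a / emb b \<in> Kc"
proof -
  have "emb a / emb b = \<iota> (A_to_Kinf a / A_to_Kinf b)" by (simp add: hom_divide emb_def)
  moreover have "A_to_Kinf a / A_to_Kinf b \<in> K_in_Kinf"
    unfolding K_in_Kinf_def by (rule CollectI, intro exI[of _ a] exI[of _ b] conjI refl assms)
  ultimately show ?thesis unfolding Kc_def by (rule image_eqI)
qed

lemma Kc_E: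
  assumes "x \<in> Kc"
  obtains a b where "x = emb a / emb b" "b \<noteq> 0"
proof -
  obtain y where y: "x = \<iota> y" "y \<in> K_in_Kinf" using assms unfolding Kc_def by (rule imageE)
  then obtain a b where "y = A_to_Kinf a / A_to_Kinf b" "b \<noteq> (0 :: 'f poly)"
    unfolding K_in_Kinf_def by (elim CollectE exE conjE)
  with y that show ?thesis by (simp add: hom_divide emb_def)
qed

lemma emb_Kc: "emb a \<in> Kc"
  using Kc_I[of 1 a] by simp

lemma Kc_0 [simp]: "0 \<in> Kc" and Kc_1 [simp]: "1 \<in> Kc"
  using emb_Kc[of 0] emb_Kc[of 1] by simp_all

lemma theta_Kc [simp]: "\<theta> \<in> Kc"
  using emb_Kc[of "monom 1 1"] by (simp add: emb_monom del: One_nat_def)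

lemma Kc_add: "x \<in> Kc \<Longrightarrow> y \<in> Kc \<Longrightarrow> x + y \<in> Kc"
proof (elim Kc_E)
  fix a b c d :: "'f poly" assume *: "x = emb a / emb b" "b \<noteq> 0" "y = emb c / emb d" "d \<noteq> 0"
  then have "x + y = emb (a * d + c * b) / emb (b * d)" by (simp add: emb_add emb_mult add_frac_eq)
  then show ?thesis using * by (simp add: Kc_I)
qed

lemma Kc_mult: "x \<in> Kc \<Longrightarrow> y \<in> Kc \<Longrightarrow> x * y \<in> Kc"
proof (elim Kc_E)
  fix a b c d :: "'f poly" assume *: "x = emb a / emb b" "b \<noteq> 0" "y = emb c / emb d" "d \<noteq> 0"
  then have "x * y = emb (a * c) / emb (b * d)" by (simp add: emb_mult)
  then show ?thesis using * by (simp add: Kc_I)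
qed

lemma Kc_minus: "x \<in> Kc \<Longrightarrow> - x \<in> Kc"
  using Kc_mult[of "emb (- 1)" x] emb_Kc[of "- 1"] by (simp add: emb_minus)

lemma Kc_diff: "x \<in> Kc \<Longrightarrow> y \<in> Kc \<Longrightarrow> x - y \<in> Kc"
  using Kc_add[of x "- y"] Kc_minus[of y] by simp

lemma Kc_inverse: "x \<in> Kc \<Longrightarrow> inverse x \<in> Kc"
proof (elim Kc_E)
  fix a b :: "'f poly" assume *: "x = emb a / emb b" "b \<noteq> 0"
  show ?thesis
  proof (cases "a = 0")
    case False
    then show ?thesis using * Kc_I[of a b] by simp
  qed (use * in simp)
qed

lemma Kc_divide: "x \<in> Kc \<Longrightarrow> y \<in> Kc \<Longrightarrow> x / y \<in> Kc"
  by (simp add: divide_inverse Kc_mult Kc_inverse)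

lemma Kc_power: "x \<in> Kc \<Longrightarrow> x ^ n \<in> Kc"
  by (induction n) (auto intro: Kc_mult)

lemma Kc_sum: "(\<And>i. i \<in> A \<Longrightarrow> f i \<in> Kc) \<Longrightarrow> sum f A \<in> Kc"
  by (induction A rule: infinite_finite_induct) (auto intro: Kc_add)

definition Kpoly :: "'c poly \<Rightarrow> bool" where "Kpoly p \<longleftrightarrow> (\<forall>i. coeff p i \<in> Kc)"

lemma Kpoly_0: "Kpoly 0" and Kpoly_1: "Kpoly 1" and Kpoly_X: "Kpoly [:0, 1:]"
  by (simp_all add: Kpoly_def coeff_pCons coeff_1 split: nat.splits)

lemma Kpoly_monom: "c \<in> Kc \<Longrightarrow> Kpoly (monom c n)"
  by (simp add: Kpoly_def)

lemma Kpoly_smult: "c \<in> Kc \<Longrightarrow> Kpoly p \<Longrightarrow> Kpoly (smult c p)"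
  by (simp add: Kpoly_def Kc_mult)

lemma Kpoly_add: "Kpoly p \<Longrightarrow> Kpoly p' \<Longrightarrow> Kpoly (p + p')"
  by (simp add: Kpoly_def Kc_add)

lemma Kpoly_mult: "Kpoly p \<Longrightarrow> Kpoly p' \<Longrightarrow> Kpoly (p * p')"
  by (simp add: Kpoly_def coeff_mult Kc_sum Kc_mult)

lemma Kpoly_sum: "(\<And>i. i \<in> A \<Longrightarrow> Kpoly (f i)) \<Longrightarrow> Kpoly (sum f A)"
  by (induction A rule: infinite_finite_induct) (auto intro: Kpoly_add Kpoly_0)

lemma Kpoly_prod: "(\<And>i. i \<in> A \<Longrightarrow> Kpoly (f i)) \<Longrightarrow> Kpoly (prod f A)"
  by (induction A rule: infinite_finite_induct) (auto intro: Kpoly_mult Kpoly_1)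

end

section \<open>Torsion points of the Carlitz module\<close>

context V_setting
begin

lemma per_nz [simp]: "per \<noteq> 0"
  by (simp add: period_eq)

text \<open>
  The Carlitz exponential at \<open>\<pi> z\<close>; for \<open>z \<in> K\<close> its values are the torsion points of the Carlitz module.
\<close>

definition tor :: "'c \<Rightarrow> 'c" where "tor z = per * e z"

lemma per_power: "per ^ (q - 1) = - \<theta> / eps ^ (q - 1)"
  by (simp add: period_eq power_divide r_power del: One_nat_def)

lemma power_q: "v ^ q = v * v ^ (q - 1)" for v :: 'c
  by (simp flip: power_Suc)

lemma tor_theta:
  assumes "(\<lambda>D. E D z) \<longlonglongrightarrow> e z"
  shows "tor (\<theta> * z) = \<theta> * tor z + tor z ^ q"
proof -
  have "tor z ^ q = per * (per ^ (q - 1) * e z ^ q)"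
    by (simp only: tor_def power_mult_distrib power_q[of per] mult.assoc)
  also have "\<dots> = - (per * \<theta> * e z ^ q / eps ^ (q - 1))"
    by (simp add: per_power mult.assoc del: One_nat_def)
  finally have pow: "tor z ^ q = - (per * \<theta> * e z ^ q / eps ^ (q - 1))" .
  have "tor (\<theta> * z) = per * (\<theta> * (e z - e z ^ q / eps ^ (q - 1)))"
    unfolding tor_def e_functional(2)[OF assms] ..
  then show ?thesis unfolding pow by (simp add: tor_def right_diff_distrib mult_ac)
qed

lemma E_emb_tendsto_0: "(\<lambda>D. E D (emb a)) \<longlonglongrightarrow> 0"
proof (rule tendsto_eventually)
  show "\<forall>\<^sub>F D in sequentially. E D (emb a) = 0"
    using eventually_gt_at_top[of "degree a"]
    by eventually_elim (rule E_kills, rule polys_lt_if_degree_less)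
qed

lemma E_theta_power_tendsto:
  "(\<lambda>D. E D (\<theta> ^ k * inverse (\<theta> ^ N))) \<longlonglongrightarrow> e (\<theta> ^ k * inverse (\<theta> ^ N))"
proof (cases "k < N")
  case True
  then have "\<theta> ^ k * inverse (\<theta> ^ N) = inverse (\<theta> ^ (N - k))"
    by (simp add: power_diff divide_inverse)
  then show ?thesis using E_tendsto_e[OF small_inverse_theta_power[of "N - k"]] True by simp
next
  case False
  then have eq: "\<theta> ^ k * inverse (\<theta> ^ N) = emb (monom 1 (k - N))"
    by (simp add: power_diff divide_inverse emb_monom)
  show ?thesis unfolding eq using E_emb_tendsto_0 by (simp only: e_eqI[OF E_emb_tendsto_0])
qed

lemma emb_eq_sum:
  assumes "degree a \<le> n"
  shows "emb a = (\<Sum>i\<le>n. cst (coeff a i) * \<theta> ^ i)"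
proof -
  have "emb a = emb (\<Sum>i\<le>n. monom (coeff a i) i)" using poly_as_sum_of_monoms'[OF assms] by simp
  also have "\<dots> = (\<Sum>i\<le>n. emb (monom (coeff a i) i))" by (rule lin_sum[OF lin_emb])
  finally show ?thesis by (simp add: emb_monom)
qed

lemma E_frac_tendsto:
  "(\<lambda>D. E D (emb a * inverse (\<theta> ^ N))) \<longlonglongrightarrow>
    (\<Sum>i\<le>degree a. cst (coeff a i) * e (\<theta> ^ i * inverse (\<theta> ^ N)))"
proof -
  have "E D (emb a * inverse (\<theta> ^ N)) = (\<Sum>i\<le>degree a. cst (coeff a i) * E D (\<theta> ^ i * inverse (\<theta> ^ N)))" for D
    by (simp add: emb_eq_sum[of a "degree a"] sum_distrib_right E_sum mult.assoc E_cst_mult)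
  then show ?thesis
    using tendsto_c_sum[OF tendsto_c_mult[OF tendsto_const E_theta_power_tendsto]] by simp
qed

lemma E_frac_tendsto_e: "(\<lambda>D. E D (emb a * inverse (\<theta> ^ N))) \<longlonglongrightarrow> e (emb a * inverse (\<theta> ^ N))"
  using E_frac_tendsto[of a N] by (simp only: e_eqI[OF E_frac_tendsto])

lemma lin_tor: "lin (\<lambda>a. tor (emb a * inverse (\<theta> ^ N)))"
proof -
  have "e (emb (a + b) * inverse (\<theta> ^ N)) = e (emb a * inverse (\<theta> ^ N)) + e (emb b * inverse (\<theta> ^ N))" for a b
    using tendsto_c_add[OF E_frac_tendsto_e[of a N] E_frac_tendsto_e[of b N]]
    by (intro e_eqI) (simp add: emb_add distrib_right E_add)
  moreover have "e (emb (smult c a) * inverse (\<theta> ^ N)) = cst c * e (emb a * inverse (\<theta> ^ N))" for c a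
    using tendsto_c_mult[OF tendsto_const[of "cst c"] E_frac_tendsto_e[of a N]]
    by (intro e_eqI) (simp add: emb_smult mult.assoc E_cst_mult)
  ultimately show ?thesis by (simp add: lin_def tor_def algebra_simps)
qed

lemma tor_integral: "N \<le> k \<Longrightarrow> tor (\<theta> ^ k * inverse (\<theta> ^ N)) = 0"
proof -
  assume "N \<le> k"
  then have eq: "\<theta> ^ k * inverse (\<theta> ^ N) = emb (monom 1 (k - N))"
    by (simp add: power_diff divide_inverse emb_monom)
  show ?thesis unfolding eq tor_def by (simp only: e_eqI[OF E_emb_tendsto_0] mult_zero_right)
qed

lemma tor_emb_sum:
  "tor (emb a * inverse (\<theta> ^ N)) = (\<Sum>i<N. cst (coeff a i) * tor (\<theta> ^ i * inverse (\<theta> ^ N)))"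
proof -
  define n where "n = max N (degree a)"
  have "tor (emb a * inverse (\<theta> ^ N)) = tor (emb (\<Sum>i\<le>n. monom (coeff a i) i) * inverse (\<theta> ^ N))"
    using poly_as_sum_of_monoms'[of a n] by (simp add: n_def)
  also have "\<dots> = (\<Sum>i\<le>n. tor (emb (monom (coeff a i) i) * inverse (\<theta> ^ N)))"
    by (rule lin_sum[OF lin_tor])
  also have "\<dots> = (\<Sum>i\<le>n. cst (coeff a i) * tor (\<theta> ^ i * inverse (\<theta> ^ N)))"
    using lin_monom[OF lin_tor, of _ _ N] by (simp add: emb_monom)
  also have "\<dots> = (\<Sum>i<N. cst (coeff a i) * tor (\<theta> ^ i * inverse (\<theta> ^ N)))"
    by (rule sum.mono_neutral_right) (auto simp: n_def tor_integral)
  finally show ?thesis .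
qed

lemma tor_mod: "tor (emb (b + monom 1 N * a) * inverse (\<theta> ^ N)) = tor (emb b * inverse (\<theta> ^ N))"
  unfolding tor_emb_sum[of "b + monom 1 N * a"] tor_emb_sum[of b]
  by (intro sum.cong refl) (simp add: coeff_monom_mult)

lemma small_frac:
  assumes "b \<in> polys_lt N" "b \<noteq> 0"
  shows "small (emb b * inverse (\<theta> ^ N))"
proof -
  have "(2 :: real) ^ degree b < 2 ^ N"
    using degree_less_if_polys_lt[OF assms] by (intro power_strict_increasing) auto
  then show ?thesis
    unfolding small_def nrm_mult nrm_inverse nrm_power nrm_theta nrm_emb[OF assms(2)]
    by (simp add: field_simps)
qed

lemma e_small_nz: "small z \<Longrightarrow> e z \<noteq> 0"
  using S_inf_1_nz[of z] by (simp add: e_small)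

lemma tor_nz: "b \<in> polys_lt N \<Longrightarrow> b \<noteq> 0 \<Longrightarrow> tor (emb b * inverse (\<theta> ^ N)) \<noteq> 0"
  unfolding tor_def by (intro no_zero_divisors per_nz e_small_nz small_frac)

subsection \<open>The coefficients of \<open>\<omega>\<close> are torsion points\<close>

text \<open>
  The coefficientwise form of the functional equation \<open>\<omega>\<^sup>(\<^sup>1\<^sup>) = (t - \<theta>) \<omega>\<close>, where \<open>\<omega>\<^sup>(\<^sup>1\<^sup>)\<close> arises by
  raising the coefficients to the power \<open>q\<close>: this removes the first factor of the product and replaces
  \<open>r\<close> by \<open>r\<^bsup>q\<^esup> = -\<theta> r\<close>.
\<close>

lemma om_frobenius:
  "fps_nth (om N) n ^ q =
    (case n of 0 \<Rightarrow> 0 | Suc k \<Rightarrow> fps_nth (om (Suc N)) k) - \<theta> * fps_nth (om (Suc N)) n"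
proof (induction N arbitrary: n)
  case 0
  show ?case
  proof (cases n)
    case 0
    then show ?thesis by (simp add: om_nth_0 power_q[of r] r_power del: One_nat_def)
  next
    case (Suc k)
    then show ?thesis using om_Suc_nth_Suc[of 0 k] by (simp add: zero_power)
  qed
next
  case (Suc N)
  note IH = Suc.IH
  show ?case
  proof (induction n)
    case 0
    show ?case by (simp add: om_nth_0 power_q[of r] r_power del: One_nat_def)
  next
    case (Suc n)
    let ?c = "inverse (\<theta> ^ q ^ Suc N)"
    have c: "inverse (\<theta> ^ q ^ N) ^ q = ?c"
      by (simp add: power_inverse power_mult[symmetric] mult.commute)
    have "fps_nth (om (Suc N)) (Suc n) ^ q =
        fps_nth (om N) (Suc n) ^ q + ?c * fps_nth (om (Suc N)) n ^ q"
      by (simp only: om_Suc_nth_Suc frobenius_add power_mult_distrib c)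
    also have "\<dots> = (fps_nth (om (Suc N)) n - \<theta> * fps_nth (om (Suc N)) (Suc n)) +
        ?c * ((case n of 0 \<Rightarrow> 0 | Suc k \<Rightarrow> fps_nth (om (Suc (Suc N))) k) - \<theta> * fps_nth (om (Suc (Suc N))) n)"
      by (simp only: Suc.IH IH nat.case)
    also have "\<dots> = (fps_nth (om (Suc N)) n + ?c * (case n of 0 \<Rightarrow> 0 | Suc k \<Rightarrow> fps_nth (om (Suc (Suc N))) k))
        - \<theta> * (fps_nth (om (Suc N)) (Suc n) + ?c * fps_nth (om (Suc (Suc N))) n)"
      by (simp only: algebra_simps)
    also have "fps_nth (om (Suc N)) n + ?c * (case n of 0 \<Rightarrow> 0 | Suc k \<Rightarrow> fps_nth (om (Suc (Suc N))) k) =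
        fps_nth (om (Suc (Suc N))) n"
      by (cases n) (simp_all only: om_nth_0 om_Suc_nth_Suc[of "Suc N"] nat.case mult_zero_right add_0_right)
    also have "fps_nth (om (Suc N)) (Suc n) + ?c * fps_nth (om (Suc (Suc N))) n = fps_nth (om (Suc (Suc N))) (Suc n)"
      by (rule om_Suc_nth_Suc[of "Suc N", symmetric])
    finally show ?case by (simp only: nat.case)
  qed
qed

lemma omega_frobenius:
  "fps_nth omg (Suc n) ^ q = fps_nth omg n - \<theta> * fps_nth omg (Suc n)"
proof -
  have "(\<lambda>N. fps_nth (om N) (Suc n) ^ q) \<longlonglongrightarrow> fps_nth omg n - \<theta> * fps_nth omg (Suc n)"
    unfolding om_frobenius nat.case
    by (intro tendsto_c_diff tendsto_c_mult tendsto_const LIMSEQ_Suc om_tendsto)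
  moreover have "(\<lambda>N. fps_nth (om N) (Suc n) ^ q) \<longlonglongrightarrow> fps_nth omg (Suc n) ^ q"
    by (intro tendsto_c_power om_tendsto)
  ultimately show ?thesis by (rule LIMSEQ_unique[rotated])
qed

text \<open>
  Both sequences satisfy \<open>\<theta> x\<^sub>n\<^sub>+\<^sub>1 + x\<^sub>n\<^sub>+\<^sub>1\<^bsup>q\<^esup> = x\<^sub>n\<close> and start with \<open>r\<close>.  Two solutions of one step differ by a
  root of \<open>X\<^bsup>q\<^esup> + \<theta> X\<close>, and the non-zero roots have absolute value \<open>|r|\<close>, which is more than that of
  either term.
\<close>

lemma omega_coeff: "fps_nth omg n = tor (inverse (\<theta> ^ Suc n))"
proof (induction n)
  case 0
  have "(\<lambda>N. fps_nth (om N) 0) \<longlonglongrightarrow> r" by (simp add: om_nth_0)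
  from LIMSEQ_unique[OF om_tendsto this] have "fps_nth omg 0 = r" .
  then show ?case by (simp add: tor_def period_eq)
next
  case (Suc n)
  let ?z = "inverse (\<theta> ^ Suc (Suc n))"
  define y where "y = fps_nth omg (Suc n) - tor ?z"
  have small: "small ?z" by (rule small_inverse_theta_power) simp
  have "\<theta> * ?z = inverse (\<theta> ^ Suc n)" by simp
  then have "tor (inverse (\<theta> ^ Suc n)) = \<theta> * tor ?z + tor ?z ^ q"
    using tor_theta[OF E_tendsto_e[OF small]] by (simp only:)
  then have "fps_nth omg (Suc n) ^ q + \<theta> * fps_nth omg (Suc n) = \<theta> * tor ?z + tor ?z ^ q"
    unfolding omega_frobenius Suc by simp
  then have "fps_nth omg (Suc n) ^ q = \<theta> * tor ?z + tor ?z ^ q - \<theta> * fps_nth omg (Suc n)"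
    unfolding eq_diff_eq .
  then have "fps_nth omg (Suc n) ^ q - tor ?z ^ q = \<theta> * tor ?z - \<theta> * fps_nth omg (Suc n)"
    by simp
  then have "y ^ q = - (\<theta> * y)"
    unfolding y_def frobenius_diff by (simp add: right_diff_distrib)
  then have "y * y ^ (q - 1) = y * - \<theta>"
    by (simp only: power_q mult_minus_right mult.commute[of y \<theta>])
  then have y: "y = 0 \<or> y ^ (q - 1) = - \<theta>" by (simp only: mult_cancel_left)
  have "nrm (fps_nth omg (Suc n)) \<le> nrm r / 2 ^ Suc n"
    by (rule nrm_limit_le[OF om_tendsto]) (rule nrm_om_le)
  moreover have "nrm (tor ?z) = nrm r / nrm (inverse \<theta>) * nrm ?z"
    unfolding tor_def nrm_mult nrm_e[OF small] period_eq nrm_divide nrm_e[OF small_inverse_theta] ..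
  then have "nrm (tor ?z) \<le> nrm r / 2 ^ Suc n"
    unfolding nrm_inverse nrm_power nrm_theta by (simp add: field_simps)
  ultimately have "nrm y \<le> nrm r / 2 ^ Suc n" unfolding y_def by (rule nrm_diff_le)
  also have "\<dots> < nrm r"
  proof -
    have "1 < (2 :: real) ^ Suc n" by (rule one_less_power) auto
    then have "nrm r * 1 < nrm r * 2 ^ Suc n" by (intro mult_strict_left_mono) auto
    then show ?thesis by (simp only: divide_less_eq) simp
  qed
  finally have "nrm y ^ (q - 1) < nrm r ^ (q - 1)"
    using q_ge_2 by (intro power_strict_mono) auto
  then have "nrm (y ^ (q - 1)) < nrm (- \<theta>)"
    unfolding r_power[symmetric] nrm_power .
  then have "y ^ (q - 1) \<noteq> - \<theta>" by auto
  with y have "y = 0" by blast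
  then show ?case unfolding y_def right_minus_eq .
qed

lemma form_omega: "fps_nth (fps_of_poly (map_poly cst a) * omg) j = tor (emb a * inverse (\<theta> ^ Suc j))"
proof -
  have "fps_nth (fps_of_poly (map_poly cst a) * omg) j =
      (\<Sum>i=0..j. cst (coeff a i) * tor (inverse (\<theta> ^ Suc (j - i))))"
    by (simp add: fps_mult_nth coeff_map_poly omega_coeff del: power_Suc)
  also have "\<dots> = (\<Sum>i<Suc j. cst (coeff a i) * tor (\<theta> ^ i * inverse (\<theta> ^ Suc j)))"
  proof (rule sum.cong)
    fix i assume "i \<in> {..<Suc j}"
    then have "Suc j = i + Suc (j - i)" by simp
    then have "\<theta> ^ Suc j = \<theta> ^ i * \<theta> ^ Suc (j - i)" by (metis power_add)
    then have "\<theta> ^ i * inverse (\<theta> ^ Suc j) = inverse (\<theta> ^ Suc (j - i))" by (simp del: power_Suc)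
    then show "cst (coeff a i) * tor (inverse (\<theta> ^ Suc (j - i))) =
        cst (coeff a i) * tor (\<theta> ^ i * inverse (\<theta> ^ Suc j))" by (simp only:)
  qed auto
  finally show ?thesis unfolding tor_emb_sum .
qed


subsection \<open>Iterates of the Carlitz action\<close>

text \<open>
  The coefficients of the \<open>k\<close>-fold iterate of \<open>X \<mapsto> \<theta> X + X\<^bsup>q\<^esup>\<close> at \<open>X\<^bsup>q^i\<^esup>\<close>.
\<close>

primrec carlitz :: "nat \<Rightarrow> nat \<Rightarrow> 'c" where
  "carlitz 0 = (\<lambda>i. if i = 0 then 1 else 0)"
| "carlitz (Suc k) = (\<lambda>i. \<theta> * carlitz k i + (case i of 0 \<Rightarrow> 0 | Suc j \<Rightarrow> carlitz k j ^ q))"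

lemma carlitz_high: "k < i \<Longrightarrow> carlitz k i = 0"
  by (induction k arbitrary: i) (auto simp: zero_power split: nat.splits)

lemma carlitz_top: "carlitz k k = 1"
  by (induction k) (simp_all add: carlitz_high)

lemma carlitz_bot: "carlitz k 0 = \<theta> ^ k"
  by (induction k) simp_all

lemma carlitz_Kc: "carlitz k i \<in> Kc"
  by (induction k arbitrary: i) (auto intro!: Kc_add Kc_mult Kc_power split: nat.splits)

lemma apoly_carlitz_Suc:
  "apoly (carlitz (Suc k)) (Suc k) y = \<theta> * apoly (carlitz k) k y + apoly (carlitz k) k y ^ q"
proof -
  have "apoly (carlitz (Suc k)) (Suc k) y = \<theta> * (\<Sum>i\<le>Suc k. carlitz k i * y ^ q ^ i) +
      (\<Sum>i\<le>Suc k. (case i of 0 \<Rightarrow> 0 | Suc j \<Rightarrow> carlitz k j ^ q) * y ^ q ^ i)"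
    by (simp add: apoly_def distrib_right sum.distrib sum_distrib_left mult.assoc del: sum.atMost_Suc)
  also have "(\<Sum>i\<le>Suc k. carlitz k i * y ^ q ^ i) = apoly (carlitz k) k y"
    by (simp add: apoly_def carlitz_high)
  also have "(\<Sum>i\<le>Suc k. (case i of 0 \<Rightarrow> 0 | Suc j \<Rightarrow> carlitz k j ^ q) * y ^ q ^ i) = apoly (carlitz k) k y ^ q"
    unfolding sum.atMost_Suc_shift apoly_def frobenius_sum
    by (simp add: power_mult_distrib power_mult[symmetric] mult.commute)
  finally show ?thesis .
qed

lemma tor_theta_power:
  "tor (emb a * inverse (\<theta> ^ N)) = apoly (carlitz k) k (tor (emb a * inverse (\<theta> ^ (N + k))))"
proof (induction k arbitrary: N)
  case 0
  show ?case by (simp add: apoly_def)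
next
  case (Suc k)
  have "\<theta> * (emb a * inverse (\<theta> ^ Suc N)) = emb a * inverse (\<theta> ^ N)" by simp
  then have "tor (emb a * inverse (\<theta> ^ N)) =
      \<theta> * tor (emb a * inverse (\<theta> ^ Suc N)) + tor (emb a * inverse (\<theta> ^ Suc N)) ^ q"
    using tor_theta[OF E_frac_tendsto_e[of a "Suc N"]] by (simp only:)
  also have "\<dots> = apoly (carlitz (Suc k)) (Suc k) (tor (emb a * inverse (\<theta> ^ (Suc N + k))))"
    unfolding apoly_carlitz_Suc Suc[of "Suc N"] ..
  finally show ?case by simp
qed

definition carlitz_poly :: "nat \<Rightarrow> 'c poly" where
  "carlitz_poly k = (\<Sum>i\<le>k. monom (carlitz k i) (q ^ i))"

lemma poly_carlitz_poly: "poly (carlitz_poly k) y = apoly (carlitz k) k y"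
  by (simp add: carlitz_poly_def poly_sum poly_monom apoly_def)

lemma Kpoly_carlitz_poly: "Kpoly (carlitz_poly k)"
  unfolding carlitz_poly_def by (intro Kpoly_sum Kpoly_monom carlitz_Kc)

lemma P_Kc: "fps_nth P\<^sub>\<delta> n \<in> Kc"
proof -
  have "fps_nth (\<Prod>j<k. lin_factor j) n \<in> Kc" for k n
  proof (induction k arbitrary: n)
    case (Suc k)
    have "fps_nth (lin_factor k) i \<in> Kc" for i
      unfolding lin_factor_def fps_sub_nth fps_one_nth fps_mult_left_const_nth fps_X_nth
      by (auto intro!: Kc_diff Kc_inverse Kc_power Kc_minus)
    then show ?case using Suc by (simp add: fps_mult_nth Kc_sum Kc_mult)
  qed simp
  then show ?thesis by (simp add: P\<^sub>\<delta>_def)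
qed

lemma wform_poly:
  assumes "n < N"
  shows "\<exists>Y. Kpoly Y \<and> poly Y 0 = 0 \<and> (\<forall>a. wform n a = poly Y (tor (emb a * inverse (\<theta> ^ N))))"
proof (intro exI conjI allI)
  define Y where "Y = (\<Sum>i=0..n. smult (fps_nth P\<^sub>\<delta> (n - i)) (carlitz_poly (N - Suc i)))"
  show "Kpoly Y" unfolding Y_def by (intro Kpoly_sum Kpoly_smult P_Kc Kpoly_carlitz_poly)
  show "poly Y 0 = 0" by (simp add: Y_def poly_sum poly_carlitz_poly)
  show "wform n a = poly Y (tor (emb a * inverse (\<theta> ^ N)))" for a
  proof -
    have "wform n a = fps_nth ((fps_of_poly (map_poly cst a) * omg) * P\<^sub>\<delta>) n"
      by (simp add: wform_def Om_def mult.assoc)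
    also have "\<dots> = (\<Sum>i=0..n. tor (emb a * inverse (\<theta> ^ Suc i)) * fps_nth P\<^sub>\<delta> (n - i))"
      unfolding fps_mult_nth[of "fps_of_poly (map_poly cst a) * omg"] form_omega ..
    also have "\<dots> = (\<Sum>i=0..n. fps_nth P\<^sub>\<delta> (n - i) * poly (carlitz_poly (N - Suc i)) (tor (emb a * inverse (\<theta> ^ N))))"
    proof (intro sum.cong refl)
      fix i assume "i \<in> {0..n}"
      then have "Suc i + (N - Suc i) = N" using assms by simp
      then show "tor (emb a * inverse (\<theta> ^ Suc i)) * fps_nth P\<^sub>\<delta> (n - i) =
          fps_nth P\<^sub>\<delta> (n - i) * poly (carlitz_poly (N - Suc i)) (tor (emb a * inverse (\<theta> ^ N)))"
        using tor_theta_power[of a "Suc i" "N - Suc i"] by (simp only: poly_carlitz_poly mult.commute)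
    qed
    also have "\<dots> = poly Y (tor (emb a * inverse (\<theta> ^ N)))"
      by (simp add: Y_def poly_sum)
    finally show ?thesis .
  qed
qed

subsection \<open>Power sums of torsion points\<close>

definition power_sum :: "nat \<Rightarrow> int \<Rightarrow> 'c" where
  "power_sum N k = (\<Sum>b\<in>polys_lt N - {0}. tor (emb b * inverse (\<theta> ^ N)) powi k)"

text \<open>
  The torsion points are annihilated by the \<open>N\<close>-th iterate of the Carlitz action.
\<close>

lemma power_sum_recurrence: "(\<Sum>i\<le>N. carlitz N i * power_sum N (k + int (q ^ i))) = 0"
proof -
  have "0 = (\<Sum>b\<in>polys_lt N - {0}. tor (emb b * inverse (\<theta> ^ N)) powi k *
      apoly (carlitz N) N (tor (emb b * inverse (\<theta> ^ N))))"
  proof (rule sum.neutral[symmetric], rule ballI)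
    fix b :: "'f poly"
    have "apoly (carlitz N) N (tor (emb b * inverse (\<theta> ^ N))) = tor (emb b * inverse (\<theta> ^ 0))"
      using tor_theta_power[of b 0 N] by simp
    also have "\<dots> = 0" unfolding tor_emb_sum by simp
    finally show "tor (emb b * inverse (\<theta> ^ N)) powi k *
      apoly (carlitz N) N (tor (emb b * inverse (\<theta> ^ N))) = 0" by simp
  qed
  also have "\<dots> = (\<Sum>b\<in>polys_lt N - {0}. \<Sum>i\<le>N. carlitz N i * tor (emb b * inverse (\<theta> ^ N)) powi (k + int (q ^ i)))"
    by (intro sum.cong refl)
      (simp add: apoly_def sum_distrib_left power_int_add tor_nz mult.left_commute del: of_nat_power)
  also have "\<dots> = (\<Sum>i\<le>N. carlitz N i * power_sum N (k + int (q ^ i)))"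
    unfolding power_sum_def sum_distrib_left by (rule sum.swap)
  finally show ?thesis by simp
qed

text \<open>
  The power sums with exponents \<open>0, \<dots>, q\<^bsup>N\<^esup> - 2\<close> are \<open>-1, 0, \<dots>, 0\<close>; the recurrence continues from there in
  both directions, because its first and its last coefficient, \<open>\<theta>\<^bsup>N\<^esup>\<close> and \<open>1\<close>, are invertible.
\<close>

lemma power_sum_nat_Kc:
  assumes N: "0 < N"
  shows "power_sum N (int n) \<in> Kc"
proof (induction n rule: less_induct)
  case (less n)
  consider "n = 0" | "0 < n" "Suc n < q ^ N" | "q ^ N \<le> Suc n" by linarith
  then show ?case
  proof cases
    case 1
    have "power_sum N 0 = -1" using sum_nonzero_1[OF N] by (simp add: power_sum_def)
    then show ?thesis using 1 by (simp add: Kc_minus)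
  next
    case 2
    then show ?thesis using sum_nonzero_power[OF lin_tor 2, of N] by (simp add: power_sum_def)
  next
    case 3
    define k where "k = int n - int (q ^ N)"
    have "power_sum N (int n) = - (\<Sum>i<N. carlitz N i * power_sum N (k + int (q ^ i)))"
      using power_sum_recurrence[of N k]
      by (simp add: lessThan_Suc_atMost[symmetric] carlitz_top k_def eq_neg_iff_add_eq_0 add.commute)
    also have "\<dots> \<in> Kc"
    proof (intro Kc_minus Kc_sum Kc_mult carlitz_Kc)
      fix i assume "i \<in> {..<N}"
      then have i: "q ^ i < q ^ N" "1 \<le> q ^ i" using q_ge_2 by (auto intro: power_strict_increasing)
      then have "k + int (q ^ i) = int (n + q ^ i - q ^ N)" using 3 unfolding k_def by linarith
      moreover have "n + q ^ i - q ^ N < n" using i 3 by linarith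
      ultimately show "power_sum N (k + int (q ^ i)) \<in> Kc" using less by simp
    qed
    finally show ?thesis .
  qed
qed

lemma power_sum_Kc:
  assumes N: "0 < N"
  shows "power_sum N k \<in> Kc"
proof -
  have "power_sum N (- int n) \<in> Kc" for n
  proof (induction n rule: less_induct)
    case (less n)
    define k where "k = - int n - 1"
    have nonneg: "power_sum N (k + int (q ^ i)) \<in> Kc" if "1 \<le> i" for i
    proof -
      have i: "2 \<le> q ^ i" by (rule power_q_gt_1[OF that])
      show ?thesis
      proof (cases "n + 1 \<le> q ^ i")
        case True
        then have "k + int (q ^ i) = int (q ^ i - (n + 1))" unfolding k_def by linarith
        then show ?thesis using power_sum_nat_Kc[OF N] by simp
      next
        case False
        then have "k + int (q ^ i) = - int (n + 1 - q ^ i)" "n + 1 - q ^ i < n"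
          using i unfolding k_def by linarith+
        then show ?thesis using less by simp
      qed
    qed
    have split: "{..N} = insert 0 {1..N}" by auto
    have "\<theta> ^ N * power_sum N (- int n) = - (\<Sum>i=1..N. carlitz N i * power_sum N (k + int (q ^ i)))"
      using power_sum_recurrence[of N k]
      unfolding split by (simp add: carlitz_bot k_def eq_neg_iff_add_eq_0 del: of_nat_power)
    also have "\<dots> \<in> Kc"
      by (intro Kc_minus Kc_sum Kc_mult carlitz_Kc nonneg) auto
    finally have "\<theta> ^ N * power_sum N (- int n) \<in> Kc" .
    then have "inverse (\<theta> ^ N) * (\<theta> ^ N * power_sum N (- int n)) \<in> Kc"
      by (rule Kc_mult[rotated]) (intro Kc_inverse Kc_power theta_Kc)
    then show ?case by (simp only: mult.assoc[symmetric]) simp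
  qed
  then show ?thesis using power_sum_nat_Kc[OF N] by (cases k rule: int_cases2) auto
qed

subsection \<open>Goss polynomials\<close>

lemma e_coeff_Kc: "inverse (per ^ (q ^ i - 1)) * e_coeff i \<in> Kc"
proof (induction i)
  case 0
  show ?case by (simp add: e_coeff_0)
next
  case (Suc i)
  define w where "w = \<theta> ^ (q ^ Suc i - 1)"
  have "2 \<le> q ^ Suc i" by (rule power_q_gt_1) simp
  then have "(2 :: real) ^ 1 \<le> 2 ^ (q ^ Suc i - 1)" by (intro power_increasing) auto
  then have "nrm w \<noteq> 1" unfolding w_def nrm_power nrm_theta by simp
  then have w1: "w - 1 \<noteq> 0" by auto
  have "(w - 1) * e_coeff (Suc i) = - (e_coeff i ^ q / eps ^ (q - 1))"
    using e_coeff_Suc[of i, folded w_def] by (simp add: left_diff_distrib)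
  then have "\<theta> * ((w - 1) * e_coeff (Suc i)) = per ^ (q - 1) * e_coeff i ^ q"
    by (simp add: per_power del: One_nat_def)
  then have ec: "e_coeff (Suc i) = per ^ (q - 1) * (e_coeff i ^ q / (\<theta> * (w - 1)))"
    using w1 by (simp add: nonzero_eq_divide_eq mult_ac)
  have "q \<le> q * q ^ i" by simp
  then have "q ^ Suc i - 1 = (q - 1) + (q ^ i - 1) * q"
    by (simp add: right_diff_distrib' mult.commute[of _ q])
  then have "per ^ (q ^ Suc i - 1) = per ^ (q - 1) * (per ^ (q ^ i - 1)) ^ q"
    by (simp only: power_add power_mult)
  then have "inverse (per ^ (q ^ Suc i - 1)) * e_coeff (Suc i) =
      (inverse (per ^ (q ^ i - 1)) * e_coeff i) ^ q / (\<theta> * (w - 1))"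
    unfolding ec power_mult_distrib power_inverse by simp
  also have "\<dots> \<in> Kc" unfolding w_def
    using Suc by (intro Kc_divide Kc_power[of "_ * e_coeff i"] Kc_mult[of \<theta>] Kc_diff Kc_power[of \<theta>]) auto
  finally show ?case .
qed

text \<open>
  The recursion \<open>e_times_S_inf\<close> expresses the sum of the \<open>k\<close>-th inverse powers by \<open>1/e(z)\<close> and lower
  such sums; multiplied by \<open>\<pi>\<^bsup>-k\<^esup>\<close> its coefficients become the \<open>\<pi>\<^bsup>1-q^i\<^esup>\<close>-multiples of the coefficients of
  \<open>e\<close>, which lie in \<open>K\<close>.
\<close>

lemma goss_polynomial:
  assumes "1 \<le> k"
  shows "\<exists>Q. Kpoly Q \<and> (\<forall>z. small z \<longrightarrow> inverse (per ^ k) * S_inf k z = poly Q (inverse (tor z)))"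
  using assms
proof (induction k rule: less_induct)
  case (less k)
  show ?case
  proof (cases "k = 1")
    case True
    have "inverse (per ^ 1) * S_inf 1 z = poly [:0, 1:] (inverse (tor z))" if "small z" for z
      using e_small[OF that] by (simp add: tor_def)
    then show ?thesis unfolding True using Kpoly_X by blast
  next
    case False
    then have k: "2 \<le> k" using less.prems by simp
    define I where "I = {i. i < k \<and> q ^ i < k}"
    have "\<forall>i\<in>I. \<exists>Q. Kpoly Q \<and> (\<forall>z. small z \<longrightarrow>
        inverse (per ^ (k - q ^ i)) * S_inf (k - q ^ i) z = poly Q (inverse (tor z)))"
      using less.IH by (auto simp: I_def)
    then obtain Q where Q: "\<And>i. i \<in> I \<Longrightarrow> Kpoly (Q i)"
      "\<And>i z. i \<in> I \<Longrightarrow> small z \<Longrightarrow>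
        inverse (per ^ (k - q ^ i)) * S_inf (k - q ^ i) z = poly (Q i) (inverse (tor z))"
      by metis
    define R where "R = [:0, 1:] * (\<Sum>i\<in>I. smult (inverse (per ^ (q ^ i - 1)) * e_coeff i) (Q i))"
    have "Kpoly R" unfolding R_def
      by (intro Kpoly_mult Kpoly_X Kpoly_sum Kpoly_smult e_coeff_Kc Q(1))
    moreover have "inverse (per ^ k) * S_inf k z = poly R (inverse (tor z))" if z: "small z" for z
    proof -
      have ez: "e z \<noteq> 0" using e_small[OF z] S_inf_1_nz[OF z] by simp
      have "inverse (per ^ k) * S_inf k z = inverse (tor z) * (per * inverse (per ^ k) * (e z * S_inf k z))"
        using ez by (simp add: tor_def field_simps)
      also have "per * inverse (per ^ k) * (e z * S_inf k z) =
          (\<Sum>i\<in>I. per * inverse (per ^ k) * (e_coeff i * S_inf (k - q ^ i) z))"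
        unfolding e_times_S_inf[OF z k] I_def by (simp add: sum_distrib_left)
      also have "\<dots> = (\<Sum>i\<in>I. inverse (per ^ (q ^ i - 1)) * e_coeff i * poly (Q i) (inverse (tor z)))"
      proof (intro sum.cong refl)
        fix i assume i: "i \<in> I"
        have "k = Suc (q ^ i - 1) + (k - q ^ i)" using i by (simp add: I_def)
        then have pk: "per ^ k = per * per ^ (q ^ i - 1) * per ^ (k - q ^ i)"
          by (metis power_Suc power_add)
        have "per * inverse (per ^ k) = inverse (per ^ (q ^ i - 1)) * inverse (per ^ (k - q ^ i))"
          unfolding pk inverse_mult_distrib mult.assoc[symmetric] by simp
        then have "per * inverse (per ^ k) * (e_coeff i * S_inf (k - q ^ i) z) =
            inverse (per ^ (q ^ i - 1)) * e_coeff i * (inverse (per ^ (k - q ^ i)) * S_inf (k - q ^ i) z)"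
          by (simp only: mult_ac)
        then show "per * inverse (per ^ k) * (e_coeff i * S_inf (k - q ^ i) z) =
            inverse (per ^ (q ^ i - 1)) * e_coeff i * poly (Q i) (inverse (tor z))"
          using Q(2)[OF i z] by simp
      qed
      also have "inverse (tor z) * \<dots> = poly R (inverse (tor z))"
        by (simp add: R_def poly_sum)
      finally show ?thesis .
    qed
    ultimately show ?thesis by blast
  qed
qed

section \<open>Rationality of the coefficients\<close>

text \<open>
  The sum over the monic \<open>a\<close> is minus the sum over all non-zero \<open>a\<close>, since \<open>\<alpha> \<equiv> s\<close> modulo \<open>q - 1\<close> makes
  the summand invariant under \<open>\<F>\<^sub>q\<^sup>*\<close>.  It is then taken residue class by residue class modulo
  \<open>\<theta>\<^bsup>N\<^esup>\<close>; the class of zero contributes nothing because \<open>s > 0\<close>.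
\<close>

lemma V_coeff_Kc:
  assumes keys: "Poly_Mapping.keys x \<subseteq> {1..s}"
  shows "mfps_coeff (V_series \<iota> r \<alpha> s) x \<in> Kc"
proof -
  let ?n = "Poly_Mapping.lookup x"
  \<comment> \<open>any bound exceeding all the exponents \<open>?n i\<close>\<close>
  define N where "N = Suc (\<Sum>i=1..s. ?n i)"
  have N: "0 < N" by (simp add: N_def)
  define X where "X a = tor (emb a * inverse (\<theta> ^ N))" for a
  have "?n i < N" if "i \<in> {1..s}" for i
    using member_le_sum[of i "{1..s}" ?n] that by (simp add: N_def less_Suc_eq_le)
  then have "\<forall>i\<in>{1..s}. \<exists>Y. Kpoly Y \<and> poly Y 0 = 0 \<and> (\<forall>a. wform (?n i) a = poly Y (X a))"
    unfolding X_def using wform_poly by blast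
  then obtain Y where Y: "\<And>i. i \<in> {1..s} \<Longrightarrow> Kpoly (Y i)" "\<And>i. i \<in> {1..s} \<Longrightarrow> poly (Y i) 0 = 0"
    "\<And>i a. i \<in> {1..s} \<Longrightarrow> wform (?n i) a = poly (Y i) (X a)"
    by metis
  define Z where "Z = (\<Prod>i=1..s. Y i)"
  have Z: "Kpoly Z" unfolding Z_def by (rule Kpoly_prod) (rule Y(1))
  have Z0: "poly Z 0 = 0"
    unfolding Z_def poly_prod using s_pos Y(2)[of 1] by (intro prod_zero) auto
  have prodZ: "(\<Prod>i=1..s. wform (?n i) a) = poly Z (X a)" for a
    unfolding Z_def poly_prod using Y(3) by (intro prod.cong) auto
  obtain Q where Q: "Kpoly Q" "\<And>z. small z \<Longrightarrow> inverse (per ^ \<alpha>) * S_inf \<alpha> z = poly Q (inverse (tor z))"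
    using goss_polynomial[of \<alpha>] alpha_pos by (auto simp: Suc_le_eq)
  define f where "f a = inverse (emb a ^ \<alpha>) * (\<Prod>i=1..s. wform (?n i) a)" for a
  have inv: "f (smult c a) = f a" if c: "c \<noteq> 0" for c a
  proof -
    have "(\<Prod>i=1..s. wform (?n i) (smult c a)) = cst c ^ s * (\<Prod>i=1..s. wform (?n i) a)"
      by (simp add: lin_smult[OF lin_wform] prod.distrib)
    moreover have "cst c ^ s = cst c ^ \<alpha>"
    proof -
      have per: "cst c ^ (k + (q - 1) * j) = cst c ^ k" for k j
        using finite_field_power_card_minus_1[OF c]
        by (simp add: power_add power_mult q_def flip: cst_power)
      consider j where "s = \<alpha> + (q - 1) * j" | j where "\<alpha> = s + (q - 1) * j"
        using alpha_cong_s cong_sym[OF alpha_cong_s] cong_le_nat[of s \<alpha>] cong_le_nat[of \<alpha> s]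
        by (metis add.commute le_cases mult.commute)
      then show ?thesis by cases (simp_all only: per)
    qed
    ultimately show ?thesis using c by (simp add: f_def emb_smult power_mult_distrib)
  qed
  have "f 0 = 0" using alpha_pos by (simp add: f_def)
  have V_sum_eq: "V_sum x D = - (\<Sum>a\<in>polys_lt D. f a)" for D
    using sum_polys_lt_nonzero_eq_monic[of f D, folded q_def] inv of_nat_q \<open>f 0 = 0\<close>
    by (simp add: V_sum_def f_def[symmetric] sum_diff1 del: One_nat_def)
  let ?B = "polys_lt N - {0 :: 'f poly}"
  define z where "z b = emb b * inverse (\<theta> ^ N)" for b
  have small: "small (z b)" if "b \<in> ?B" for b
    using that small_frac unfolding z_def by blast
  have Xz: "X b = tor (z b)" for b by (simp add: X_def z_def)
  have V_sum_shift: "V_sum x (D + N) = - (\<Sum>b\<in>?B. inverse (\<theta> ^ N) ^ \<alpha> * poly Z (X b) * S \<alpha> D (z b))" for D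
  proof -
    have summand: "f (b + monom 1 N * a) =
        inverse (\<theta> ^ N) ^ \<alpha> * poly Z (X b) * inverse ((z b + emb a) ^ \<alpha>)" for a b
    proof -
      have "X (b + monom 1 N * a) = X b" unfolding X_def by (rule tor_mod)
      moreover have "emb (b + monom 1 N * a) = \<theta> ^ N * (z b + emb a)"
        by (simp add: z_def emb_add emb_mult emb_monom distrib_left)
      ultimately show ?thesis
        unfolding f_def prodZ by (simp add: power_mult_distrib power_inverse)
    qed
    have "X 0 = 0" unfolding X_def tor_emb_sum by simp
    then have "(\<Sum>a\<in>polys_lt (N + D). f a) =
        (\<Sum>b\<in>?B. inverse (\<theta> ^ N) ^ \<alpha> * poly Z (X b) * S \<alpha> D (z b))"
      unfolding sum_polys_lt_add summand S_def sum_distrib_left[symmetric]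
      by (intro sum.mono_neutral_right) (auto simp: Z0)
    then show ?thesis by (simp add: V_sum_eq add.commute)
  qed
  define W where "W = - (\<Sum>b\<in>?B. inverse (\<theta> ^ N) ^ \<alpha> * poly Z (X b) * poly Q (inverse (X b)))"
  have "(\<lambda>D. inverse (per ^ \<alpha>) * V_sum x (D + N)) \<longlonglongrightarrow>
      inverse (per ^ \<alpha>) * - (\<Sum>b\<in>?B. inverse (\<theta> ^ N) ^ \<alpha> * poly Z (X b) * S_inf \<alpha> (z b))"
    unfolding V_sum_shift using alpha_pos
    by (intro tendsto_c_mult tendsto_c_minus tendsto_c_sum tendsto_const S_tendsto small) auto
  also have "inverse (per ^ \<alpha>) * - (\<Sum>b\<in>?B. inverse (\<theta> ^ N) ^ \<alpha> * poly Z (X b) * S_inf \<alpha> (z b)) =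
      - (\<Sum>b\<in>?B. inverse (\<theta> ^ N) ^ \<alpha> * poly Z (X b) * (inverse (per ^ \<alpha>) * S_inf \<alpha> (z b)))"
    by (simp only: mult_minus_right sum_distrib_left mult_ac)
  also have "\<dots> = W"
    unfolding W_def by (intro arg_cong[where f = uminus] sum.cong refl) (simp add: Q(2) small Xz)
  finally have 1: "(\<lambda>D. inverse (per ^ \<alpha>) * V_sum x (D + N)) \<longlonglongrightarrow> W" .
  have "(\<lambda>D. inverse (per ^ \<alpha>) * V_sum x D) \<longlonglongrightarrow> mfps_coeff (V_series \<iota> r \<alpha> s) x"
    using V_coeff_tendsto[of x] by (simp only: keys if_True)
  from LIMSEQ_unique[OF LIMSEQ_ignore_initial_segment[OF this, of N] 1]
  have "mfps_coeff (V_series \<iota> r \<alpha> s) x = W" .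
  also have "W \<in> Kc"
  proof -
    have "(\<Sum>b\<in>?B. poly Z (X b) * poly Q (inverse (X b))) =
        (\<Sum>b\<in>?B. \<Sum>i\<le>degree Z. \<Sum>j\<le>degree Q. coeff Z i * coeff Q j * X b powi (int i - int j))"
    proof (intro sum.cong refl)
      fix b assume b: "b \<in> ?B"
      then have "X b \<noteq> 0" using tor_nz unfolding X_def by blast
      then have "X b ^ i * inverse (X b) ^ j = X b powi (int i - int j)" for i j
        by (simp add: power_int_diff power_inverse divide_inverse)
      then show "poly Z (X b) * poly Q (inverse (X b)) =
          (\<Sum>i\<le>degree Z. \<Sum>j\<le>degree Q. coeff Z i * coeff Q j * X b powi (int i - int j))"
        unfolding poly_altdef sum_product
        by (intro sum.cong refl) (metis (no_types, lifting) mult.assoc mult.left_commute)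
    qed
    also have "\<dots> = (\<Sum>i\<le>degree Z. \<Sum>j\<le>degree Q. \<Sum>b\<in>?B. coeff Z i * coeff Q j * X b powi (int i - int j))"
      by (subst sum.swap) (intro sum.cong refl sum.swap)
    also have "\<dots> = (\<Sum>i\<le>degree Z. \<Sum>j\<le>degree Q. coeff Z i * coeff Q j * power_sum N (int i - int j))"
      by (simp add: power_sum_def X_def sum_distrib_left)
    also have "\<dots> \<in> Kc"
      using Z Q(1) unfolding Kpoly_def by (intro Kc_sum Kc_mult power_sum_Kc N) auto
    finally have "- (inverse (\<theta> ^ N) ^ \<alpha> * (\<Sum>b\<in>?B. poly Z (X b) * poly Q (inverse (X b)))) \<in> Kc"
      by (intro Kc_minus Kc_mult Kc_power Kc_inverse theta_Kc)
    then show ?thesis by (simp only: W_def sum_distrib_left mult.assoc)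
  qed
  finally show ?thesis .
qed

section \<open>The theorem\<close>

lemma V_polys_over: "V_series \<iota> r \<alpha> s \<in> polys_over Kc s"
proof -
  let ?V = "V_series \<iota> r \<alpha> s"
  have sub: "{x. mfps_coeff ?V x \<noteq> 0} \<subseteq>
      {x. Poly_Mapping.lookup x \<in> {g. \<forall>i. (i \<in> {1..s} \<longrightarrow> g i \<in> {..<deg_bound}) \<and> (i \<notin> {1..s} \<longrightarrow> g i = 0)}}"
  proof safe
    fix x i assume nz: "mfps_coeff ?V x \<noteq> 0"
    show "Poly_Mapping.lookup x i < deg_bound" if "i \<in> {1..s}"
      using V_coeff_eq_0_degree[OF that, of x] nz by force
    show "Poly_Mapping.lookup x i = 0" if "i \<notin> {1..s}"
      using V_coeff_eq_0_keys[of x] nz that unfolding subset_iff in_keys_iff by blast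
  qed
  have "finite {g. \<forall>i. (i \<in> {1..s} \<longrightarrow> g i \<in> {..<deg_bound}) \<and> (i \<notin> {1..s} \<longrightarrow> g i = (0 :: nat))}"
    by (rule finite_set_of_finite_funs) auto
  then have "finite {x. Poly_Mapping.lookup x \<in>
      {g. \<forall>i. (i \<in> {1..s} \<longrightarrow> g i \<in> {..<deg_bound}) \<and> (i \<notin> {1..s} \<longrightarrow> g i = (0 :: nat))}}"
    by (rule finite_vimageI[where h = Poly_Mapping.lookup, unfolded vimage_def])
       (rule injI, simp only: poly_mapping_eq_iff)
  then have "finite {x. mfps_coeff ?V x \<noteq> 0}" by (rule finite_subset[OF sub])
  moreover have "mfps_coeff ?V x \<in> Kc" for x
    using V_coeff_Kc[of x] V_coeff_eq_0_keys[of x] by (cases "Poly_Mapping.keys x \<subseteq> {1..s}") simp_all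
  moreover have "Poly_Mapping.keys x \<subseteq> {1..s}" if "mfps_coeff ?V x \<noteq> 0" for x
    using V_coeff_eq_0_keys[of x] that by blast
  ultimately show ?thesis unfolding polys_over_def by blast
qed

lemma V_total_degree: "total_degree (V_series \<iota> r \<alpha> s) \<le> s * (deg_bound - 1)"
proof -
  let ?V = "V_series \<iota> r \<alpha> s"
  have fin: "finite {x. mfps_coeff ?V x \<noteq> 0}"
    using V_polys_over by (simp add: polys_over_def)
  have "monom_degree x \<le> s * (deg_bound - 1)" if nz: "mfps_coeff ?V x \<noteq> 0" for x
  proof -
    have keys: "Poly_Mapping.keys x \<subseteq> {1..s}" using V_coeff_eq_0_keys[of x] nz by blast
    have "monom_degree x = (\<Sum>i=1..s. Poly_Mapping.lookup x i)"
      unfolding monom_degree_def by (rule sum.mono_neutral_left) (use keys in \<open>auto simp: in_keys_iff\<close>)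
    also have "\<dots> \<le> (\<Sum>i=1..s. deg_bound - 1)"
    proof (rule sum_mono)
      fix i assume "i \<in> {1..s}"
      then show "Poly_Mapping.lookup x i \<le> deg_bound - 1"
        using V_coeff_eq_0_degree[of i x] nz by force
    qed
    finally show ?thesis by simp
  qed
  then show ?thesis unfolding total_degree_def using fin by (subst Max_le_iff) auto
qed

text \<open>
  The right-hand side is \<open>s(m - 1) + s/(q - 1)\<close>.
\<close>

lemma deg_bound_le: "real (s * (deg_bound - 1)) \<le> real s * ((real s + real ell) / (real q - 1)) - real s"
proof -
  have q1: "0 < real q - 1" using q_ge_2 by simp
  have "real (m * (q - 1) + 1) = real (s + ell)" by (simp only: m_eq)
  then have "real s + real ell = real m * (real q - 1) + 1" using q_ge_2 by (simp add: of_nat_diff)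
  then have eq: "(real s + real ell) / (real q - 1) = real m + 1 / (real q - 1)"
    using q1 by (simp add: add_divide_distrib)
  have "real (deg_bound - 1) \<le> real m + 1 / (real q - 1) - 1"
    using m_pos q1 by (auto simp: deg_bound_def of_nat_diff)
  then have "real s * real (deg_bound - 1) \<le> real s * (real m + 1 / (real q - 1) - 1)"
    by (rule mult_left_mono) simp
  then show ?thesis unfolding eq by (simp add: right_diff_distrib)
qed

end

theorem theorem4:
  fixes \<iota> :: "'f::{field, finite} fls \<Rightarrow> 'c::{field, complete_space}"
    and r :: 'c
    and \<alpha> s :: nat
  assumes "C_infinity \<iota>"
    and "r ^ (CARD('f) - 1) = - theta \<iota>"
    and "\<alpha> > 0" and "s > 0"
    and "[\<alpha> = s] (mod (CARD('f) - 1))"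
  shows "V_series \<iota> r \<alpha> s \<in> polys_over (\<iota> ` K_in_Kinf) s \<and>
    symmetric_mfps s (V_series \<iota> r \<alpha> s) \<and>
    real (total_degree (V_series \<iota> r \<alpha> s)) \<le>
      real s * ((real s + real (digit_sum CARD('f) (CARD('f) ^ delta CARD('f) \<alpha> s - \<alpha>)))
        / (real CARD('f) - 1)) - real s"
proof -
  interpret C_infinity \<iota> by fact
  interpret V_setting \<iota> "CARD('f)" \<alpha> s r
    by unfold_locales (use assms in auto)
  have "real (total_degree (V_series \<iota> r \<alpha> s)) \<le> real (s * (deg_bound - 1))"
    using V_total_degree by (simp only: of_nat_le_iff)
  also note deg_bound_le
  finally show ?thesis
    using V_polys_over V_coeff_permute
    by (simp add: symmetric_mfps_def Kc_def ell_def \<delta>_def)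
qed

end
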